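(* Let $(M,\omega,\eta)$ be a precosymplectic manifold with $\operatorname{rank}\omega=2r\leq \dim M-1$. For every $x\in M$, there exist local coordinates $\{t,q^i,p_i,z^j\}$ around $x$, where $1\leq i\leq r$ and $1\leq j\leq \dim M-1-2r$, such that $$\eta=\mathrm{d}t,\qquad \omega=\sum_{i=1}^r \mathrm{d}q^i\wedge \mathrm{d}p_i.$$
   Context: All manifolds are real, smooth, Hausdorff, connected, second countable and finite-dimensional; all structures are smooth. A distribution is regular if it is smooth and has constant rank. For a two-form $\omega$, $\ker\omega=\{v\in TM\mid \omega(v,\cdot)=0\}$. A precosymplectic structure on $M$ is a pair $(\omega,\eta)$, where $\omega\in\Omega^2(M)$ and $\eta\in\Omega^1(M)$ are closed differential forms such that $\ker\eta\cap\ker\omega$ is a regular distribution strictly included in $\ker\omega$ at every $x\in M$. (This forces $\omega$ to have constant rank $2r<\dim M$.) If $\operatorname{rank}\omega=2r<\dim M$, the triple $(M,\omega,\eta)$ is called a precosymplectic manifold of rank $2r$. *)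

theory Defs
  imports "HOL-Analysis.Analysis" "HOL-Library.Function_Algebras"
begin

section \<open>Pointwise vector space structure on functions\<close>

instantiation "fun" :: (type, real_vector) real_vector
begin

definition scaleR_fun :: "real \<Rightarrow> ('a \<Rightarrow> 'b) \<Rightarrow> 'a \<Rightarrow> 'b"
  where "scaleR_fun a f = (\<lambda>x. a *\<^sub>R f x)"

instance
  by standard (simp_all add: scaleR_fun_def fun_eq_iff scaleR_add_right scaleR_add_left)

end

section \<open>Smooth maps between Euclidean spaces\<close>

text \<open>Both notions are intended for open sets only, since derivatives are taken in the full space.\<close>

fun Ck_on :: "nat \<Rightarrow> 'a::euclidean_space set \<Rightarrow> ('a \<Rightarrow> 'b::real_normed_vector) \<Rightarrow> bool" where
  "Ck_on 0 S f \<longleftrightarrow> continuous_on S f"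
| "Ck_on (Suc k) S f \<longleftrightarrow>
     (\<forall>x\<in>S. f differentiable (at x)) \<and>
     (\<forall>v. Ck_on k S (\<lambda>x. frechet_derivative f (at x) v))"

definition smooth_on :: "'a::euclidean_space set \<Rightarrow> ('a \<Rightarrow> 'b::real_normed_vector) \<Rightarrow> bool"
  where "smooth_on S f \<longleftrightarrow> (\<forall>k. Ck_on k S f)"

section \<open>Smooth manifolds\<close>

text \<open>
  The manifold is a type \<open>'m\<close>; Hausdorff and second countable are imposed by its sort. It is
  modelled on \<open>'e\<close>, so its dimension is \<open>DIM('e)\<close>. A chart is a pair of its domain and its
  coordinate map, whose values outside the domain are irrelevant.
\<close>

type_synonym ('m, 'e) chart = "'m set \<times> ('m \<Rightarrow> 'e)"

abbreviation chart_dom :: "('m, 'e) chart \<Rightarrow> 'm set"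
  where "chart_dom c \<equiv> fst c"

abbreviation chart_map :: "('m, 'e) chart \<Rightarrow> 'm \<Rightarrow> 'e"
  where "chart_map c \<equiv> snd c"

definition chart_inv :: "('m, 'e) chart \<Rightarrow> 'e \<Rightarrow> 'm"
  where "chart_inv c = inv_into (chart_dom c) (chart_map c)"

definition is_chart :: "('m::topological_space, 'e::euclidean_space) chart \<Rightarrow> bool"
  where "is_chart c \<longleftrightarrow>
    open (chart_dom c) \<and> open (chart_map c ` chart_dom c) \<and>
    homeomorphism (chart_dom c) (chart_map c ` chart_dom c) (chart_map c) (chart_inv c)"

definition transition :: "('m, 'e) chart \<Rightarrow> ('m, 'e) chart \<Rightarrow> 'e \<Rightarrow> 'e"
  where "transition c d = chart_map d \<circ> chart_inv c"

definition smoothly_compatible ::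
    "('m::topological_space, 'e::euclidean_space) chart \<Rightarrow> ('m, 'e) chart \<Rightarrow> bool"
  where "smoothly_compatible c d \<longleftrightarrow>
    smooth_on (chart_map c ` (chart_dom c \<inter> chart_dom d)) (transition c d) \<and>
    smooth_on (chart_map d ` (chart_dom c \<inter> chart_dom d)) (transition d c)"

definition maximal_smooth_atlas ::
    "('m::topological_space, 'e::euclidean_space) chart set \<Rightarrow> bool"
  where "maximal_smooth_atlas A \<longleftrightarrow>
    (\<forall>c\<in>A. is_chart c) \<and>
    (\<Union>c\<in>A. chart_dom c) = UNIV \<and>
    (\<forall>c\<in>A. \<forall>d\<in>A. smoothly_compatible c d) \<and>
    (\<forall>c. is_chart c \<and> (\<forall>d\<in>A. smoothly_compatible c d) \<longrightarrow> c \<in> A)"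

definition smooth_manifold ::
    "('m::{t2_space, second_countable_topology}, 'e::euclidean_space) chart set \<Rightarrow> bool"
  where "smooth_manifold A \<longleftrightarrow> connected (UNIV :: 'm set) \<and> maximal_smooth_atlas A"

section \<open>Tangent vectors\<close>

text \<open>
  A tangent vector at \<open>x\<close> is given by its components \<open>v c\<close> in all charts \<open>c\<close> around \<open>x\<close>,
  which are related by the Jacobians of the transition maps. The value \<open>0\<close> for the other
  arguments is a convention that makes the representation unique; vector space operations are
  pointwise.
\<close>

type_synonym ('m, 'e) vect = "('m, 'e) chart \<Rightarrow> 'e"

definition tangent_space ::
    "('m, 'e::euclidean_space) chart set \<Rightarrow> 'm \<Rightarrow> ('m, 'e) vect set"
  where "tangent_space A x = {v.
    (\<forall>c\<in>A. \<forall>d\<in>A. x \<in> chart_dom c \<and> x \<in> chart_dom d \<longrightarrow>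
       v d = frechet_derivative (transition c d) (at (chart_map c x)) (v c)) \<and>
    (\<forall>c. c \<notin> A \<or> x \<notin> chart_dom c \<longrightarrow> v c = 0)}"

text \<open>The tangent vector at \<open>x\<close> whose component in the chart \<open>c\<close> is \<open>u\<close>; for a basis vector
  \<open>u\<close> this is a coordinate vector of \<open>c\<close>.\<close>

definition coord_vect ::
    "('m, 'e::euclidean_space) chart set \<Rightarrow> ('m, 'e) chart \<Rightarrow> 'm \<Rightarrow> 'e \<Rightarrow> ('m, 'e) vect"
  where "coord_vect A c x u = (\<lambda>d. if d \<in> A \<and> x \<in> chart_dom d
    then frechet_derivative (transition c d) (at (chart_map c x)) u else 0)"

text \<open>The differential at \<open>x\<close> of a function that is smooth near \<open>x\<close>. On tangent vectors it does
  not depend on the chosen chart, by the chain rule.\<close>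

definition differential ::
    "('m, 'e::euclidean_space) chart set \<Rightarrow> ('m \<Rightarrow> real) \<Rightarrow> 'm \<Rightarrow> ('m, 'e) vect \<Rightarrow> real"
  where "differential A f x v =
    (let c = (SOME c. c \<in> A \<and> x \<in> chart_dom c)
     in frechet_derivative (f \<circ> chart_inv c) (at (chart_map c x)) (v c))"

definition smooth_vector_field_on ::
    "('m, 'e::euclidean_space) chart set \<Rightarrow> 'm set \<Rightarrow> ('m \<Rightarrow> ('m, 'e) vect) \<Rightarrow> bool"
  where "smooth_vector_field_on A U X \<longleftrightarrow>
    (\<forall>x\<in>U. X x \<in> tangent_space A x) \<and>
    (\<forall>c\<in>A. smooth_on (chart_map c ` (U \<inter> chart_dom c)) (\<lambda>y. X (chart_inv c y) c))"

section \<open>Regular distributions\<close>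

definition smooth_distribution ::
    "('m::topological_space, 'e::euclidean_space) chart set \<Rightarrow> ('m \<Rightarrow> ('m, 'e) vect set) \<Rightarrow> bool"
  where "smooth_distribution A D \<longleftrightarrow>
    (\<forall>x. subspace (D x) \<and> D x \<subseteq> tangent_space A x) \<and>
    (\<forall>x. \<forall>v \<in> D x. \<exists>U X. open U \<and> x \<in> U \<and> smooth_vector_field_on A U X \<and>
       (\<forall>y\<in>U. X y \<in> D y) \<and> X x = v)"

definition regular_distribution ::
    "('m::topological_space, 'e::euclidean_space) chart set \<Rightarrow> ('m \<Rightarrow> ('m, 'e) vect set) \<Rightarrow> bool"
  where "regular_distribution A D \<longleftrightarrow>
    smooth_distribution A D \<and> (\<exists>k. \<forall>x. dim (D x) = k)"

section \<open>Differential forms of degree one and two\<close>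

text \<open>The values of forms at \<open>x\<close> on arguments that are not tangent vectors at \<open>x\<close> are irrelevant
  throughout.\<close>

type_synonym ('m, 'e) form1 = "'m \<Rightarrow> ('m, 'e) vect \<Rightarrow> real"
type_synonym ('m, 'e) form2 = "'m \<Rightarrow> ('m, 'e) vect \<Rightarrow> ('m, 'e) vect \<Rightarrow> real"

definition linear_form_on :: "'v::real_vector set \<Rightarrow> ('v \<Rightarrow> real) \<Rightarrow> bool"
  where "linear_form_on V f \<longleftrightarrow>
    (\<forall>v\<in>V. \<forall>w\<in>V. f (v + w) = f v + f w) \<and> (\<forall>a. \<forall>v\<in>V. f (a *\<^sub>R v) = a * f v)"

definition comp1 ::
    "('m, 'e::euclidean_space) chart set \<Rightarrow> ('m, 'e) form1 \<Rightarrow> ('m, 'e) chart \<Rightarrow> 'e \<Rightarrow> 'e \<Rightarrow> real"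
  where "comp1 A \<alpha> c y u = \<alpha> (chart_inv c y) (coord_vect A c (chart_inv c y) u)"

definition comp2 ::
    "('m, 'e::euclidean_space) chart set \<Rightarrow> ('m, 'e) form2 \<Rightarrow> ('m, 'e) chart \<Rightarrow> 'e \<Rightarrow> 'e \<Rightarrow> 'e \<Rightarrow> real"
  where "comp2 A \<omega> c y u v = \<omega> (chart_inv c y)
    (coord_vect A c (chart_inv c y) u) (coord_vect A c (chart_inv c y) v)"

definition smooth_form1 :: "('m, 'e::euclidean_space) chart set \<Rightarrow> ('m, 'e) form1 \<Rightarrow> bool"
  where "smooth_form1 A \<alpha> \<longleftrightarrow>
    (\<forall>x. linear_form_on (tangent_space A x) (\<alpha> x)) \<and>
    (\<forall>c\<in>A. \<forall>u. smooth_on (chart_map c ` chart_dom c) (\<lambda>y. comp1 A \<alpha> c y u))"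

definition smooth_form2 :: "('m, 'e::euclidean_space) chart set \<Rightarrow> ('m, 'e) form2 \<Rightarrow> bool"
  where "smooth_form2 A \<omega> \<longleftrightarrow>
    (\<forall>x. \<forall>v \<in> tangent_space A x. linear_form_on (tangent_space A x) (\<omega> x v)) \<and>
    (\<forall>x. \<forall>v \<in> tangent_space A x. \<forall>w \<in> tangent_space A x. \<omega> x v w = - \<omega> x w v) \<and>
    (\<forall>c\<in>A. \<forall>u v. smooth_on (chart_map c ` chart_dom c) (\<lambda>y. comp2 A \<omega> c y u v))"

text \<open>Exterior derivatives, as seen in a chart \<open>c\<close> and evaluated on constant vector fields: with
  these the terms of the invariant formula that involve Lie brackets vanish.\<close>

definition ext_deriv1 ::
    "('m, 'e::euclidean_space) chart set \<Rightarrow> ('m, 'e) form1 \<Rightarrow> ('m, 'e) chart \<Rightarrow> 'e \<Rightarrow> 'e \<Rightarrow> 'e \<Rightarrow> real"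
  where "ext_deriv1 A \<alpha> c y u v =
    frechet_derivative (\<lambda>z. comp1 A \<alpha> c z v) (at y) u
    - frechet_derivative (\<lambda>z. comp1 A \<alpha> c z u) (at y) v"

definition ext_deriv2 ::
    "('m, 'e::euclidean_space) chart set \<Rightarrow> ('m, 'e) form2 \<Rightarrow> ('m, 'e) chart
      \<Rightarrow> 'e \<Rightarrow> 'e \<Rightarrow> 'e \<Rightarrow> 'e \<Rightarrow> real"
  where "ext_deriv2 A \<omega> c y u v w =
    frechet_derivative (\<lambda>z. comp2 A \<omega> c z v w) (at y) u
    - frechet_derivative (\<lambda>z. comp2 A \<omega> c z u w) (at y) v
    + frechet_derivative (\<lambda>z. comp2 A \<omega> c z u v) (at y) w"

definition closed_form1 :: "('m, 'e::euclidean_space) chart set \<Rightarrow> ('m, 'e) form1 \<Rightarrow> bool"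
  where "closed_form1 A \<alpha> \<longleftrightarrow> smooth_form1 A \<alpha> \<and>
    (\<forall>c\<in>A. \<forall>y \<in> chart_map c ` chart_dom c. \<forall>u v. ext_deriv1 A \<alpha> c y u v = 0)"

definition closed_form2 :: "('m, 'e::euclidean_space) chart set \<Rightarrow> ('m, 'e) form2 \<Rightarrow> bool"
  where "closed_form2 A \<omega> \<longleftrightarrow> smooth_form2 A \<omega> \<and>
    (\<forall>c\<in>A. \<forall>y \<in> chart_map c ` chart_dom c. \<forall>u v w. ext_deriv2 A \<omega> c y u v w = 0)"

definition wedge :: "('v \<Rightarrow> real) \<Rightarrow> ('v \<Rightarrow> real) \<Rightarrow> 'v \<Rightarrow> 'v \<Rightarrow> real"
  where "wedge \<alpha> \<beta> v w = \<alpha> v * \<beta> w - \<alpha> w * \<beta> v"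

definition ker1 ::
    "('m, 'e::euclidean_space) chart set \<Rightarrow> ('m, 'e) form1 \<Rightarrow> 'm \<Rightarrow> ('m, 'e) vect set"
  where "ker1 A \<alpha> x = {v \<in> tangent_space A x. \<alpha> x v = 0}"

definition ker2 ::
    "('m, 'e::euclidean_space) chart set \<Rightarrow> ('m, 'e) form2 \<Rightarrow> 'm \<Rightarrow> ('m, 'e) vect set"
  where "ker2 A \<omega> x = {v \<in> tangent_space A x. \<forall>w \<in> tangent_space A x. \<omega> x v w = 0}"

text \<open>The covector \<open>\<omega>(v, -)\<close>, extended by \<open>0\<close> outside the tangent space. The rank of \<open>\<omega>\<close> at \<open>x\<close>
  is the rank of the induced map from the tangent to the cotangent space.\<close>

definition flat ::
    "('m, 'e::euclidean_space) chart set \<Rightarrow> ('m, 'e) form2 \<Rightarrow> 'm \<Rightarrow> ('m, 'e) vect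
      \<Rightarrow> ('m, 'e) vect \<Rightarrow> real"
  where "flat A \<omega> x v = (\<lambda>w. if w \<in> tangent_space A x then \<omega> x v w else 0)"

definition form_rank :: "('m, 'e::euclidean_space) chart set \<Rightarrow> ('m, 'e) form2 \<Rightarrow> 'm \<Rightarrow> nat"
  where "form_rank A \<omega> x = dim (flat A \<omega> x ` tangent_space A x)"

section \<open>Precosymplectic structures and local coordinates\<close>

definition precosymplectic ::
    "('m::topological_space, 'e::euclidean_space) chart set
      \<Rightarrow> ('m, 'e) form2 \<Rightarrow> ('m, 'e) form1 \<Rightarrow> bool"
  where "precosymplectic A \<omega> \<eta> \<longleftrightarrow>
    closed_form2 A \<omega> \<and> closed_form1 A \<eta> \<and>
    regular_distribution A (\<lambda>x. ker1 A \<eta> x \<inter> ker2 A \<omega> x) \<and>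
    (\<forall>x. ker1 A \<eta> x \<inter> ker2 A \<omega> x \<subset> ker2 A \<omega> x)"

text \<open>The functions in the list \<open>fs\<close> are local coordinates on \<open>U\<close>: there are \<open>DIM('e)\<close> of them
  and together they form a chart. The list \<open>bs\<close> enumerates the basis of the model space in order
  to identify it with real coordinate space; its choice is immaterial because permuting
  coordinates is smooth.\<close>

definition local_coordinates ::
    "('m, 'e::euclidean_space) chart set \<Rightarrow> 'm set \<Rightarrow> ('m \<Rightarrow> real) list \<Rightarrow> bool"
  where "local_coordinates A U fs \<longleftrightarrow>
    length fs = DIM('e) \<and>
    (\<exists>bs :: 'e list. distinct bs \<and> set bs = Basis \<and>
       (U, \<lambda>x. \<Sum>i<DIM('e). (fs ! i) x *\<^sub>R (bs ! i)) \<in> A)"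

end

theory Submission
  imports Defs
begin

text \<open>A two-form on an open set of Euclidean space is written as a field \<open>J\<close> of skew operators,
  \<open>\<omega>(u, v) = J u \<bullet> v\<close>, and a one-form as a vector field. In these terms the theorem reduces to a
  Darboux theorem: a closed two-form of constant rank \<open>2 r\<close> is locally
  \<open>\<Sum>i. dq i \<and> dp i\<close> (\<open>darboux_constant_rank\<close>). The rest is then easy. By Poincare's lemma \<open>\<eta>\<close> is
  locally some \<open>dt\<close>. The differentials of the \<open>q i\<close> and \<open>p i\<close> span the annihilator of the kernel of
  \<open>\<omega>\<close>, and there are only \<open>2 r\<close> of them, so they are independent; \<open>\<eta>\<close> does not vanish on that kernel,
  so \<open>dt\<close> is independent of them. Linear functions complete the list to a coordinate system
  by the inverse function theorem (\<open>precosymplectic_local_coordinates\<close>).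

  Darboux's theorem is proved by two deformations, both governed by \<open>moser_pullback\<close>: if the
  velocity \<open>V\<close> of a family of maps \<open>F t\<close> satisfies \<open>\<omega> t (V, -) = - \<beta>\<close>, where the forms \<open>\<omega> t\<close> are closed
  and their time derivative is \<open>d\<beta>\<close>, then the pullback of \<open>\<omega> t\<close> along \<open>F t\<close> is constant in time.
  Let \<open>K\<close> be the kernel of \<open>\<omega>\<close> at the origin, \<open>W\<close> its orthogonal complement and \<open>P\<close> the projection onto
  \<open>W\<close>. The first deformation starts from \<open>P\<close> and moves inside the kernels of \<open>\<omega>\<close>, the kernel
  component of \<open>x\<close> serving as its velocity in the direction of \<open>K\<close>. With \<open>\<beta> = 0\<close> this shows that \<open>\<omega>\<close>
  is, up to a diffeomorphism, the pullback along \<open>P\<close> of its restriction to \<open>W\<close>. This takes the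
  place of the theorem of Frobenius: \<open>d\<omega> = 0\<close> is used directly, not through the integrability of the
  kernels. The second deformation is Moser's: it joins the
  restricted form to its constant value at the origin, with \<open>\<beta>\<close> from Poincare's lemma. A constant form
  is brought to normal form by linear algebra (\<open>skew_rank_normal_form\<close>).

  Both velocities are determined only implicitly, by an equation
  \<open>V t x = \<Psi> t (x, \<integral> V, V t x)\<close> whose last two arguments enter contractively near the
  origin. Working with the velocity instead of the flow, and with this implicit equation, has two
  advantages: the operators that multiply \<open>V\<close> need to be inverted at the origin only, and the inverse
  function theorem is the special case in which the integral does not occur. Existence is
  Picard iteration (\<open>picard_fixed_point\<close>). Smooth dependence on \<open>x\<close> is an induction on the order of
  differentiability (\<open>fixed_point_param_Ck\<close>): a derivative of \<open>V\<close> satisfies the linearised equation,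
  which has the same form and is one degree less smooth.\<close>

section \<open>Smooth dependence on a point, uniformly in time\<close>

abbreviation fderiv :: "('a::real_normed_vector \<Rightarrow> 'b::real_normed_vector) \<Rightarrow> 'a \<Rightarrow> 'a \<Rightarrow> 'b"
  where "fderiv f x \<equiv> frechet_derivative f (at x)"

text \<open>For a function of time and position, differentiability is asked for in position only, but all
  derivatives must be continuous in both variables jointly. For \<open>T = {0}\<close> this is the notion for
  functions of position alone (\<open>Ck_on_iff_param\<close>), so that each closure property is proved once.\<close>

fun param_Ck_on :: "nat \<Rightarrow> real set \<Rightarrow> 'a::euclidean_space set \<Rightarrow>
    (real \<Rightarrow> 'a \<Rightarrow> 'b::real_normed_vector) \<Rightarrow> bool" where
  "param_Ck_on 0 T S f \<longleftrightarrow> continuous_on (T \<times> S) (\<lambda>(t, x). f t x)"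
| "param_Ck_on (Suc k) T S f \<longleftrightarrow>
     continuous_on (T \<times> S) (\<lambda>(t, x). f t x) \<and>
     (\<forall>t\<in>T. \<forall>x\<in>S. f t differentiable (at x)) \<and>
     (\<forall>v. param_Ck_on k T S (\<lambda>t x. fderiv (f t) x v))"

lemma param_Ck_on_imp_continuous:
  "param_Ck_on k T S f \<Longrightarrow> continuous_on (T \<times> S) (\<lambda>(t, x). f t x)"
  by (cases k) auto

lemma param_Ck_on_cong:
  fixes f g :: "real \<Rightarrow> 'a::euclidean_space \<Rightarrow> 'b::real_normed_vector"
  assumes "open S" and "param_Ck_on k T S f" and "\<And>t x. t \<in> T \<Longrightarrow> x \<in> S \<Longrightarrow> f t x = g t x"
  shows "param_Ck_on k T S g"
  using assms(2-)
proof (induction k arbitrary: f g)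
  case 0
  have "continuous_on (T \<times> S) (\<lambda>(t, x). f t x) = continuous_on (T \<times> S) (\<lambda>(t, x). g t x)"
    by (rule continuous_on_cong) (use 0 in auto)
  then show ?case using 0 by simp
next
  case (Suc k)
  have c: "continuous_on (T \<times> S) (\<lambda>(t, x). f t x) = continuous_on (T \<times> S) (\<lambda>(t, x). g t x)"
    by (rule continuous_on_cong) (use Suc in auto)
  have der: "(g t has_derivative fderiv (f t) x) (at x)" if "t \<in> T" "x \<in> S" for t x
  proof (rule has_derivative_transform_within_open[OF _ assms(1) that(2)])
    show "(f t has_derivative fderiv (f t) x) (at x)"
      using Suc.prems(1) that by (simp add: frechet_derivative_works)
  qed (use Suc.prems(2) that in auto)
  then have eq: "fderiv (f t) x = fderiv (g t) x"
    if "t \<in> T" "x \<in> S" for t x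
    using that frechet_derivative_at by blast
  have "param_Ck_on k T S (\<lambda>t x. fderiv (g t) x v)" for v
    by (rule Suc.IH[where f="\<lambda>t x. fderiv (f t) x v"]) (use Suc.prems eq in auto)
  then show ?case
    using c Suc.prems(1) der by (auto simp: differentiable_def)
qed

text \<open>Introduction with an arbitrary formula \<open>f'\<close> for the derivative; openness makes it unique.\<close>

lemma param_Ck_on_SucI:
  fixes f :: "real \<Rightarrow> 'a::euclidean_space \<Rightarrow> 'b::real_normed_vector"
  assumes "open S" and "continuous_on (T \<times> S) (\<lambda>(t, x). f t x)"
    and der: "\<And>t x. t \<in> T \<Longrightarrow> x \<in> S \<Longrightarrow> (f t has_derivative f' t x) (at x)"
    and "\<And>v. param_Ck_on k T S (\<lambda>t x. f' t x v)"
  shows "param_Ck_on (Suc k) T S f"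
proof -
  have "param_Ck_on k T S (\<lambda>t x. fderiv (f t) x v)" for v
    by (rule param_Ck_on_cong[OF assms(1) assms(4)[of v]]) (use der frechet_derivative_at in metis)
  then show ?thesis
    using assms(2) der by (auto simp: differentiable_def)
qed

lemma param_Ck_on_SucD:
  assumes "param_Ck_on (Suc k) T S f"
  shows "t \<in> T \<Longrightarrow> x \<in> S \<Longrightarrow> (f t has_derivative fderiv (f t) x) (at x)"
    and "param_Ck_on k T S (\<lambda>t x. fderiv (f t) x v)"
    and "continuous_on (T \<times> S) (\<lambda>(t, x). f t x)"
  using assms by (auto simp: frechet_derivative_works)

lemma param_Ck_on_SucE:
  "param_Ck_on (Suc k) T S f \<Longrightarrow> param_Ck_on k T S f"
  by (induction k arbitrary: f) auto

lemma param_Ck_on_le: "k \<le> l \<Longrightarrow> param_Ck_on l T S f \<Longrightarrow> param_Ck_on k T S f"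
  by (induction l rule: dec_induct) (use param_Ck_on_SucE in blast)+

lemma param_Ck_on_subset:
  assumes "param_Ck_on k T S f" "T' \<subseteq> T" "S' \<subseteq> S"
  shows "param_Ck_on k T' S' f"
  using assms(1)
proof (induction k arbitrary: f)
  case 0
  then show ?case using assms(2,3) by (auto intro: continuous_on_subset[of "T \<times> S"])
next
  case (Suc k)
  have "T' \<times> S' \<subseteq> T \<times> S" using assms by auto
  then show ?case using Suc assms(2,3) by (auto intro: continuous_on_subset)
qed

lemma param_Ck_on_time:
  fixes c :: "real \<Rightarrow> 'b::real_normed_vector"
  assumes "open S" "continuous_on T c"
  shows "param_Ck_on k T S (\<lambda>t x. c t)"
  using assms(2)
proof (induction k arbitrary: c)
  case 0
  then show ?case
    by (auto simp: split_beta intro!: continuous_on_compose2[OF 0] continuous_intros)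
next
  case (Suc k)
  have 1: "continuous_on (T \<times> S) (\<lambda>(t, x). c t)"
    by (auto simp: split_beta intro!: continuous_on_compose2[OF Suc.prems] continuous_intros)
  show ?case
    by (rule param_Ck_on_SucI[OF assms(1) 1, where f'="\<lambda>t x v. 0"])
       (auto intro!: Suc.IH)
qed

lemma param_Ck_on_const: "open S \<Longrightarrow> param_Ck_on k T S (\<lambda>t x. c)"
  by (rule param_Ck_on_time) auto

lemma param_Ck_on_linear:
  assumes L: "bounded_linear L" and "open S" "param_Ck_on k T S f"
  shows "param_Ck_on k T S (\<lambda>t x. L (f t x))"
  using assms(3)
proof (induction k arbitrary: f)
  case 0
  then show ?case
    using bounded_linear.continuous_on[OF L, of "T \<times> S" "\<lambda>(t, x). f t x"]
    by (simp add: split_beta)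
next
  case (Suc k)
  note D = param_Ck_on_SucD[OF Suc.prems]
  show ?case
    by (rule param_Ck_on_SucI[OF assms(2), where f'="\<lambda>t x v. L (fderiv (f t) x v)"])
      (use bounded_linear.continuous_on[OF L D(3)] Suc.IH[OF D(2)]
        bounded_linear.has_derivative[OF L D(1)] in \<open>auto simp: split_beta\<close>)
qed

lemma param_Ck_on_id:
  assumes "open S" and L: "bounded_linear L"
  shows "param_Ck_on k T S (\<lambda>t x. L x)"
proof (cases k)
  case 0
  then show ?thesis
    using bounded_linear.continuous_on[OF L continuous_on_snd[OF continuous_on_id], of "T \<times> S"]
    by (simp add: split_beta)
next
  case (Suc l)
  have c: "continuous_on (T \<times> S) (\<lambda>(t, x). L x)"
    using bounded_linear.continuous_on[OF L continuous_on_snd[OF continuous_on_id], of "T \<times> S"]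
    by (simp add: split_beta)
  show ?thesis unfolding Suc
    by (rule param_Ck_on_SucI[OF assms(1) c, where f'="\<lambda>t x. L"])
      (auto intro!: param_Ck_on_const assms bounded_linear.has_derivative[OF L])
qed

lemma param_Ck_on_add:
  assumes "open S" "param_Ck_on k T S f" "param_Ck_on k T S g"
  shows "param_Ck_on k T S (\<lambda>t x. f t x + g t x)"
  using assms(2,3)
proof (induction k arbitrary: f g)
  case 0
  then show ?case using continuous_on_add[of "T \<times> S" "\<lambda>(t, x). f t x" "\<lambda>(t, x). g t x"]
    by (simp add: split_beta)
next
  case (Suc k)
  note D = param_Ck_on_SucD[OF Suc.prems(1)]
  note E = param_Ck_on_SucD[OF Suc.prems(2)]
  show ?case
    by (rule param_Ck_on_SucI[OF assms(1), where f'="\<lambda>t x v. fderiv (f t) x v +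
        fderiv (g t) x v"])
      (use continuous_on_add[OF D(3) E(3)] Suc.IH[OF D(2) E(2)]
        has_derivative_add[OF D(1) E(1)] in \<open>auto simp: split_beta\<close>)
qed

lemma param_Ck_on_sum:
  assumes "open S" "\<And>i. i \<in> I \<Longrightarrow> param_Ck_on k T S (f i)"
  shows "param_Ck_on k T S (\<lambda>t x. \<Sum>i\<in>I. f i t x)"
  using assms(2)
  by (induction I rule: infinite_finite_induct)
    (auto intro!: param_Ck_on_const param_Ck_on_add assms(1))

lemma param_Ck_on_bilinear:
  assumes B: "bounded_bilinear B" and "open S" "param_Ck_on k T S f" "param_Ck_on k T S g"
  shows "param_Ck_on k T S (\<lambda>t x. B (f t x) (g t x))"
  using assms(3,4)
proof (induction k arbitrary: f g)
  case 0
  then show ?case using bounded_bilinear.continuous_on[OF B, of "T \<times> S" "\<lambda>(t, x). f t x" "\<lambda>(t, x). g t x"]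
    by (simp add: split_beta)
next
  case (Suc k)
  note D = param_Ck_on_SucD[OF Suc.prems(1)]
  note E = param_Ck_on_SucD[OF Suc.prems(2)]
  show ?case
  proof (rule param_Ck_on_SucI[OF assms(2), where f'="\<lambda>t x v. B (f t x) (fderiv (g t) x v) +
        B (fderiv (f t) x v) (g t x)"])
    show "continuous_on (T \<times> S) (\<lambda>(t, x). B (f t x) (g t x))"
      using bounded_bilinear.continuous_on[OF B D(3) E(3)] by (simp add: split_beta)
    show "((\<lambda>x. B (f t x) (g t x)) has_derivative (\<lambda>v. B (f t x) (fderiv (g t) x v) +
        B (fderiv (f t) x v) (g t x))) (at x)" if "t \<in> T" "x \<in> S" for t x
      using bounded_bilinear.FDERIV[OF B D(1) E(1)] that by simp
    show "param_Ck_on k T S (\<lambda>t x. B (f t x) (fderiv (g t) x v) +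
        B (fderiv (f t) x v) (g t x))" for v
      by (rule param_Ck_on_add[OF assms(2) Suc.IH[OF param_Ck_on_SucE[OF Suc.prems(1)] E(2)]
            Suc.IH[OF D(2) param_Ck_on_SucE[OF Suc.prems(2)]]])
  qed
qed

lemmas param_Ck_on_scaleR = param_Ck_on_bilinear[OF bounded_bilinear_scaleR]
lemmas param_Ck_on_inner_const = param_Ck_on_linear[OF bounded_linear_inner_left]

lemma param_Ck_on_minus:
  assumes "open S" "param_Ck_on k T S f"
  shows "param_Ck_on k T S (\<lambda>t x. - f t x)"
  by (rule param_Ck_on_linear[OF bounded_linear_minus[OF bounded_linear_ident] assms])

lemma param_Ck_on_diff:
  assumes "open S" "param_Ck_on k T S f" "param_Ck_on k T S g"
  shows "param_Ck_on k T S (\<lambda>t x. f t x - g t x)"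
  using param_Ck_on_add[OF assms(1,2) param_Ck_on_minus[OF assms(1,3)]] by simp

lemma linear_eq_sum_Basis:
  fixes L :: "'a::euclidean_space \<Rightarrow> 'b::real_vector"
  assumes "linear L"
  shows "L x = (\<Sum>i\<in>Basis. (x \<bullet> i) *\<^sub>R L i)"
proof -
  have "L x = L (\<Sum>i\<in>Basis. (x \<bullet> i) *\<^sub>R i)" by (simp add: euclidean_representation)
  also have "\<dots> = (\<Sum>i\<in>Basis. (x \<bullet> i) *\<^sub>R L i)"
    by (simp only: linear_sum[OF assms] linear_cmul[OF assms])
  finally show ?thesis .
qed

text \<open>The chain rule expresses a derivative of the composition through the partial derivatives of the
  outer function, along the components of a derivative of the inner one. Each partial derivative is
  again an outer function, of one order less, which is what the induction needs.\<close>

lemma param_Ck_on_compose: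
  fixes g :: "real \<Rightarrow> 'c::euclidean_space \<Rightarrow> 'b::real_normed_vector"
    and h :: "real \<Rightarrow> 'a::euclidean_space \<Rightarrow> 'c"
  assumes S: "open S" and "param_Ck_on k T D g" "param_Ck_on k T S h"
    and m: "\<And>t x. t \<in> T \<Longrightarrow> x \<in> S \<Longrightarrow> h t x \<in> D"
  shows "param_Ck_on k T S (\<lambda>t x. g t (h t x))"
  using assms(2,3)
proof (induction k arbitrary: g)
  case 0
  have "continuous_on (T \<times> S) (\<lambda>p. (\<lambda>(t, y). g t y) ((\<lambda>p. (fst p, h (fst p) (snd p))) p))"
  proof (rule continuous_on_compose2[OF 0(1)[simplified]])
    show "continuous_on (T \<times> S) (\<lambda>p. (fst p, h (fst p) (snd p)))"
      using 0(2) by (auto intro!: continuous_intros simp: split_beta)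
  qed (use m in auto)
  then show ?case by (simp add: split_beta)
next
  case (Suc k)
  note G = param_Ck_on_SucD[OF Suc.prems(1)]
  note H = param_Ck_on_SucD[OF Suc.prems(2)]
  have lin: "linear (fderiv (g t) y)" if "t \<in> T" "y \<in> D" for t y
    using G(1) that has_derivative_linear by blast
  show ?case
  proof (rule param_Ck_on_SucI[OF S])
    have "continuous_on (T \<times> S) (\<lambda>p. (\<lambda>(t, y). g t y) ((\<lambda>p. (fst p, h (fst p) (snd p))) p))"
    proof (rule continuous_on_compose2[OF G(3)])
      show "continuous_on (T \<times> S) (\<lambda>p. (fst p, h (fst p) (snd p)))"
        using H(3) by (auto intro!: continuous_intros simp: split_beta)
    qed (use m in auto)
    then show "continuous_on (T \<times> S) (\<lambda>(t, x). g t (h t x))" by (simp add: split_beta)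
    show "((\<lambda>x. g t (h t x)) has_derivative
       (\<lambda>v. fderiv (g t) (h t x) (fderiv (h t) x v))) (at x)"
      if "t \<in> T" "x \<in> S" for t x
      using diff_chain_at[OF H(1) G(1)] that m by (simp add: o_def)
    show "param_Ck_on k T S (\<lambda>t x. fderiv (g t) (h t x)
         (fderiv (h t) x v))" for v
    proof (rule param_Ck_on_cong[OF S])
      show "param_Ck_on k T S (\<lambda>t x. \<Sum>i\<in>Basis. (fderiv (h t) x v \<bullet> i) *\<^sub>R
          fderiv (g t) (h t x) i)"
        by (intro param_Ck_on_sum[OF S] param_Ck_on_scaleR[OF S] param_Ck_on_inner_const[OF S] H(2)
            Suc.IH[OF G(2)] param_Ck_on_SucE[OF Suc.prems(2)])
      fix t x assume "t \<in> T" "x \<in> S"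
      then show "(\<Sum>i\<in>Basis. (fderiv (h t) x v \<bullet> i) *\<^sub>R
          fderiv (g t) (h t x) i) =
          fderiv (g t) (h t x) (fderiv (h t) x v)"
        using linear_eq_sum_Basis[OF lin] m by metis
    qed
  qed
qed

text \<open>An operator-valued function is as smooth as its values on a basis. This turns statements on
  directional derivatives into continuity of the derivative in operator norm.\<close>

lemma param_Ck_on_blinfun:
  fixes f :: "real \<Rightarrow> 'a::euclidean_space \<Rightarrow> 'c::euclidean_space \<Rightarrow> 'b::euclidean_space"
  assumes S: "open S" and "\<And>i. i \<in> Basis \<Longrightarrow> param_Ck_on k T S (\<lambda>t x. f t x i)"
    and lin: "\<And>t x. t \<in> T \<Longrightarrow> x \<in> S \<Longrightarrow> linear (f t x)"
  shows "param_Ck_on k T S (\<lambda>t x. Blinfun (f t x))"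
proof (rule param_Ck_on_cong[OF S])
  have bl: "bounded_linear (\<lambda>z::'b. blinfun_scaleR_left z o\<^sub>L blinfun_inner_left i)" for i :: 'c
    by (rule bounded_linear_compose[OF bounded_bilinear.bounded_linear_left[OF bounded_bilinear_blinfun_compose]
          bounded_linear_blinfun_scaleR_left])
  show "param_Ck_on k T S (\<lambda>t x. \<Sum>i\<in>Basis. blinfun_scaleR_left (f t x i) o\<^sub>L blinfun_inner_left i)"
    by (rule param_Ck_on_sum[OF S], rule param_Ck_on_linear[OF bl S], rule assms(2))
  fix t x assume "t \<in> T" "x \<in> S"
  then have l: "linear (f t x)" by (rule lin)
  show "(\<Sum>i\<in>Basis. blinfun_scaleR_left (f t x i) o\<^sub>L blinfun_inner_left i) = Blinfun (f t x)"
  proof (rule blinfun_eqI)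
    fix y
    have "blinfun_apply (\<Sum>i\<in>Basis. blinfun_scaleR_left (f t x i) o\<^sub>L blinfun_inner_left i) y =
        (\<Sum>i\<in>Basis. (y \<bullet> i) *\<^sub>R f t x i)"
      by (simp add: blinfun.sum_left inner_commute)
    also have "\<dots> = f t x y" by (rule linear_eq_sum_Basis[OF l, symmetric])
    also have "\<dots> = blinfun_apply (Blinfun (f t x)) y"
      using l by (simp add: bounded_linear_Blinfun_apply linear_conv_bounded_linear)
    finally show "blinfun_apply (\<Sum>i\<in>Basis. blinfun_scaleR_left (f t x i) o\<^sub>L blinfun_inner_left i) y =
        blinfun_apply (Blinfun (f t x)) y" .
  qed
qed

lemma continuous_on_ignore_time:
  "continuous_on S f \<Longrightarrow> continuous_on (T \<times> S) (\<lambda>(t, x). f x)"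
  unfolding split_beta
  by (rule continuous_on_compose2[where f=snd]) (auto intro: continuous_intros)

lemma Ck_on_iff_param:
  fixes f :: "'a::euclidean_space \<Rightarrow> 'b::real_normed_vector"
  shows "Ck_on k S f \<longleftrightarrow> param_Ck_on k {0} S (\<lambda>_. f)"
proof (induction k arbitrary: f)
  case 0
  show ?case
  proof
    assume "Ck_on 0 S f" then show "param_Ck_on 0 {0} S (\<lambda>_. f)"
      by (simp add: continuous_on_ignore_time)
  next
    assume "param_Ck_on 0 {0} S (\<lambda>_. f)"
    then have c: "continuous_on ({0::real} \<times> S) (\<lambda>(t, x). f x)" by simp
    have "continuous_on S (\<lambda>x. (\<lambda>(t, x). f x) (0::real, x))"
      by (rule continuous_on_compose2[OF c]) (auto intro!: continuous_intros)
    then show "Ck_on 0 S f" by simp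
  qed
next
  case (Suc k)
  have "continuous_on ({0::real} \<times> S) (\<lambda>(t, x). f x)" if "\<forall>x\<in>S. f differentiable (at x)"
    using that by (intro continuous_on_ignore_time)
      (simp add: continuous_at_imp_continuous_on differentiable_imp_continuous_within)
  then show ?case using Suc by auto
qed

section \<open>Integration in time and Picard iteration\<close>

definition time_integral :: "(real \<Rightarrow> 'a \<Rightarrow> 'b::euclidean_space) \<Rightarrow> real \<Rightarrow> 'a \<Rightarrow> 'b"
  where "time_integral V t x = integral {0..t} (\<lambda>s. V s x)"

lemma continuous_on_time_slice:
  assumes "continuous_on (T \<times> S) (\<lambda>(t, x). V t x)" "x \<in> S"
  shows "continuous_on T (\<lambda>t. V t x)"
proof -
  have "continuous_on T (\<lambda>t. (\<lambda>(t, x). V t x) (t, x))"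
    by (rule continuous_on_compose2[OF assms(1)]) (use assms(2) in \<open>auto intro!: continuous_intros\<close>)
  then show ?thesis by simp
qed

text \<open>The fixed domain of integration makes the joint continuity of the integral in \<open>t\<close> and \<open>x\<close> an
  instance of the continuity of parametric integrals.\<close>

lemma time_integral_eq_unit_interval:
  assumes t: "t \<in> {0..1}"
  shows "time_integral V t x = t *\<^sub>R integral {0..1} (\<lambda>s. V (t * s) x)"
proof (cases "t = 0")
  case True
  then show ?thesis by (simp add: time_integral_def)
next
  case False
  then have "(\<lambda>x. x / t) ` {0..t} = {0..1}"
    using t by (force simp: image_iff field_simps intro: bexI[where x="t * _"])
  then show ?thesis
    using integral_stretch_real[OF False, of 0 t "\<lambda>s. V s x"] t False
    by (simp add: time_integral_def)
qed

lemma continuous_on_time_integral: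
  assumes c: "continuous_on ({0..1} \<times> S) (\<lambda>(t, x). V t x)"
  shows "continuous_on ({0..1} \<times> S) (\<lambda>(t, x). time_integral V t x)"
proof -
  have "continuous_on (({0..1} \<times> S) \<times> cbox 0 1) (\<lambda>p. (\<lambda>(t, x). V t x) (fst (fst p) * snd p, snd (fst p)))"
    by (rule continuous_on_compose2[OF c]) (auto intro!: continuous_intros mult_le_one)
  then have "continuous_on (({0..1} \<times> S) \<times> cbox 0 1) (\<lambda>(p, s::real). V (fst p * s) (snd p))"
    by (simp add: split_beta)
  from integral_continuous_on_param[OF this]
  have "continuous_on ({0..1} \<times> S) (\<lambda>p. fst p *\<^sub>R integral {0..1} (\<lambda>s. V (fst p * s) (snd p)))"
    by (auto intro!: continuous_intros)
  then show ?thesis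
    by (rule continuous_on_eq) (auto simp: time_integral_eq_unit_interval)
qed

lemma time_integral_diff_le:
  assumes "continuous_on ({0..1} \<times> S) (\<lambda>(t, x). V t x)" "continuous_on ({0..1} \<times> S') (\<lambda>(t, x). W t x)"
    and "x \<in> S" "y \<in> S'" and t: "t \<in> {0..1}" and B: "\<And>s. s \<in> {0..1} \<Longrightarrow> norm (V s x - W s y) \<le> B"
  shows "norm (time_integral V t x - time_integral W t y) \<le> B"
proof -
  have c: "continuous_on {0..t} (\<lambda>s. V s x)" "continuous_on {0..t} (\<lambda>s. W s y)"
    using assms by (auto intro!: continuous_on_subset[OF continuous_on_time_slice[OF assms(1)]]
      continuous_on_subset[OF continuous_on_time_slice[OF assms(2)]])
  have "time_integral V t x - time_integral W t y = integral {0..t} (\<lambda>s. V s x - W s y)"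
    unfolding time_integral_def
    by (rule integral_diff[symmetric]) (auto intro: integrable_continuous_real c)
  also have "norm \<dots> \<le> B * (t - 0)"
    by (rule integral_bound) (use t B in \<open>auto intro!: continuous_intros c\<close>)
  also have "\<dots> \<le> B"
  proof -
    have "0 \<le> B" by (rule order_trans[OF norm_ge_zero B[of 0]]) simp
    then show ?thesis using t by (simp add: mult_left_le)
  qed
  finally show ?thesis .
qed

lemma time_integral_le:
  assumes "continuous_on ({0..1} \<times> S) (\<lambda>(t, x). V t x)"
    and "x \<in> S" and t: "t \<in> {0..1}" and B: "\<And>s. s \<in> {0..1} \<Longrightarrow> norm (V s x) \<le> B"
  shows "norm (time_integral V t x) \<le> B"
proof -
  have "continuous_on ({0..1} \<times> S) (\<lambda>(t, x). 0 :: 'b)" by (simp add: split_beta)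
  from time_integral_diff_le[OF assms(1) this assms(2,2) t, of B] B show ?thesis
    by (simp add: time_integral_def)
qed

lemma has_vector_derivative_time_integral:
  assumes "continuous_on ({0..1} \<times> S) (\<lambda>(t, x). V t x)" "x \<in> S" "t \<in> {0..1}"
  shows "((\<lambda>t. time_integral V t x) has_vector_derivative V t x) (at t within {0..1})"
  unfolding time_integral_def
  by (rule integral_has_vector_derivative[OF continuous_on_time_slice[OF assms(1,2)] assms(3)])

lemma time_integral_sum_scaleR:
  assumes "\<And>i. i \<in> I \<Longrightarrow> continuous_on ({0..1} \<times> S) (\<lambda>(t, x). W i t x)" "finite I"
    and "x \<in> S" "t \<in> {0..1}"
  shows "time_integral (\<lambda>t x. \<Sum>i\<in>I. c i *\<^sub>R W i t x) t x = (\<Sum>i\<in>I. c i *\<^sub>R time_integral (W i) t x)"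
proof -
  have int: "(\<lambda>s. W i s x) integrable_on {0..t}" if "i \<in> I" for i
    by (rule integrable_continuous_real, rule continuous_on_subset[OF continuous_on_time_slice[OF assms(1)]])
      (use that assms in auto)
  show ?thesis
    unfolding time_integral_def
    by (subst integral_sum) (use assms int in \<open>auto intro!: integrable_cmul\<close>)
qed

lemma has_derivative_time_integral:
  assumes S: "open S" and V: "param_Ck_on (Suc 0) {0..1} S V" and "t \<in> {0..1}" "x \<in> S"
  shows "(time_integral V t has_derivative
    (\<lambda>v. time_integral (\<lambda>s x. fderiv (V s) x v) t x)) (at x)"
proof -
  note D = param_Ck_on_SucD[OF V]
  let ?D = "\<lambda>x s. Blinfun (fderiv (V s) x)"
  have lin: "linear (fderiv (V s) x)" if "s \<in> {0..1}" "x \<in> S" for s x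
    using D(1)[OF that] has_derivative_linear by blast
  then have app: "blinfun_apply (?D x s) v = fderiv (V s) x v"
    if "s \<in> {0..1}" "x \<in> S" for s x v
    using that by (simp add: bounded_linear_Blinfun_apply linear_conv_bounded_linear)
  obtain r where r: "r > 0" "ball x r \<subseteq> S" using S \<open>x \<in> S\<close> open_contains_ball by blast
  have "param_Ck_on 0 {0..1} S (\<lambda>s x. ?D x s)"
    by (rule param_Ck_on_blinfun[OF S]) (use D(2) lin in auto)
  then have c: "continuous_on ({0..1} \<times> S) (\<lambda>(s, x). ?D x s)" by simp
  have "continuous_on (ball x r \<times> cbox 0 t) (\<lambda>p. (\<lambda>(s, x). ?D x s) (snd p, fst p))"
    by (rule continuous_on_compose2[OF c]) (use r assms(3) in \<open>auto intro!: continuous_intros\<close>)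
  then have c': "continuous_on (ball x r \<times> cbox 0 t) (\<lambda>(x, s). ?D x s)" by (simp add: split_beta)
  have "((\<lambda>x. integral (cbox 0 t) (\<lambda>s. V s x)) has_derivative integral (cbox 0 t) (?D x)) (at x within ball x r)"
  proof (rule leibniz_rule[OF _ _ c'])
    fix y s assume y: "y \<in> ball x r" and s: "s \<in> cbox 0 t"
    then have "y \<in> S" "s \<in> {0..1}" using r assms(3) by auto
    then show "((\<lambda>x. V s x) has_derivative blinfun_apply (?D y s)) (at y within ball x r)"
      using D(1) app by (metis has_derivative_at_withinI has_derivative_eq_rhs ext)
  next
    fix y assume "y \<in> ball x r"
    then have "y \<in> S" using r by auto
    then show "(\<lambda>s. V s y) integrable_on cbox 0 t"
      using assms(3)
      by (auto intro!: integrable_continuous_real continuous_on_subset[OF continuous_on_time_slice[OF D(3)]])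
  qed (use r in auto)
  then have "(time_integral V t has_derivative blinfun_apply (integral (cbox 0 t) (?D x))) (at x)"
    using r(1) at_within_open[of x "ball x r"] unfolding time_integral_def cbox_interval by simp
  moreover have "blinfun_apply (integral (cbox 0 t) (?D x)) v =
      time_integral (\<lambda>s x. fderiv (V s) x v) t x" for v
  proof -
    have "blinfun_apply (integral (cbox 0 t) (?D x)) v = integral (cbox 0 t) (\<lambda>s. blinfun_apply (?D x s) v)"
      unfolding cbox_interval using assms(3)
      by (intro blinfun_apply_integral integrable_continuous_real
          continuous_on_subset[OF continuous_on_time_slice[OF c \<open>x \<in> S\<close>]]) auto
    also have "\<dots> = integral (cbox 0 t) (\<lambda>s. fderiv (V s) x v)"
      by (rule integral_cong) (use app assms in auto)
    finally show ?thesis by (simp add: time_integral_def)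
  qed
  ultimately show ?thesis by (rule has_derivative_eq_rhs[OF _ ext])
qed

lemma param_Ck_on_time_integral:
  assumes S: "open S" and "param_Ck_on k {0..1} S V"
  shows "param_Ck_on k {0..1} S (time_integral V)"
  using assms(2)
proof (induction k arbitrary: V)
  case 0
  then show ?case by (simp add: continuous_on_time_integral)
next
  case (Suc k)
  note D = param_Ck_on_SucD[OF Suc.prems]
  have "param_Ck_on (Suc 0) {0..1} S V"
    by (rule param_Ck_on_le[OF _ Suc.prems]) simp
  from has_derivative_time_integral[OF S this] show ?case
    by (intro param_Ck_on_SucI[OF S continuous_on_time_integral[OF D(3)], where
        f'="\<lambda>t x v. time_integral (\<lambda>s x. fderiv (V s) x v) t x"]
        Suc.IH[OF D(2)]) auto
qed

text \<open>Each of the last two arguments contributes a Lipschitz constant of a quarter and integration over a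
  time at most one does not increase the supremum norm, so the iteration contracts by one half.
  The iterates are functions of \<open>t\<close> and \<open>x\<close> simultaneously; uniform convergence therefore gives
  joint continuity of the solution.\<close>

lemma picard_fixed_point:
  fixes \<Psi> :: "real \<Rightarrow> 'a::topological_space \<times> 'b::euclidean_space \<times> 'b \<Rightarrow> 'b"
  assumes cont: "continuous_on ({0..1} \<times> (S \<times> cball 0 \<rho> \<times> cball 0 \<rho>)) (\<lambda>(t, p). \<Psi> t p)"
    and small: "\<And>t x. t \<in> {0..1} \<Longrightarrow> x \<in> S \<Longrightarrow> norm (\<Psi> t (x, 0, 0)) \<le> \<rho> / 2"
    and lip: "\<And>t x y w y' w'. t \<in> {0..1} \<Longrightarrow> x \<in> S \<Longrightarrow> {y, w, y', w'} \<subseteq> cball 0 \<rho> \<Longrightarrow>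
      norm (\<Psi> t (x, y, w) - \<Psi> t (x, y', w')) \<le> (norm (y - y') + norm (w - w')) / 4"
    and \<rho>: "\<rho> \<ge> 0"
  obtains V where "continuous_on ({0..1} \<times> S) (\<lambda>(t, x). V t x)"
    "\<And>t x. t \<in> {0..1} \<Longrightarrow> x \<in> S \<Longrightarrow> norm (V t x) \<le> \<rho>"
    "\<And>t x. t \<in> {0..1} \<Longrightarrow> x \<in> S \<Longrightarrow> V t x = \<Psi> t (x, time_integral V t x, V t x)"
proof -
  define a where "a = rec_nat (\<lambda>t x. 0) (\<lambda>n V t x. \<Psi> t (x, time_integral V t x, V t x))"
  have a0: "a 0 = (\<lambda>t x. 0)" by (simp add: a_def)
  have aS: "a (Suc n) = (\<lambda>t x. \<Psi> t (x, time_integral (a n) t x, a n t x))" for n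
    by (simp add: a_def)
  let ?I = "{0..1::real}"
  have inv: "continuous_on (?I \<times> S) (\<lambda>(t, x). a n t x) \<and> (\<forall>t\<in>?I. \<forall>x\<in>S. norm (a n t x) \<le> \<rho>)" for n
  proof (induction n)
    case 0
    then show ?case using \<rho> by (auto simp: a0 split_beta intro!: continuous_intros)
  next
    case (Suc n)
    then have c: "continuous_on (?I \<times> S) (\<lambda>(t, x). a n t x)"
      and b: "\<And>t x. t \<in> ?I \<Longrightarrow> x \<in> S \<Longrightarrow> norm (a n t x) \<le> \<rho>" by auto
    have bi: "norm (time_integral (a n) t x) \<le> \<rho>" if "t \<in> ?I" "x \<in> S" for t x
      using time_integral_le[OF c that(2,1)] b that(2) by auto
    have "continuous_on (?I \<times> S) (\<lambda>p. (\<lambda>(t, p). \<Psi> t p)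
        (fst p, snd p, time_integral (a n) (fst p) (snd p), a n (fst p) (snd p)))"
      by (rule continuous_on_compose2[OF cont])
        (use c continuous_on_time_integral[OF c] b bi in \<open>auto simp: split_beta intro!: continuous_intros\<close>)
    moreover have "norm (\<Psi> t (x, time_integral (a n) t x, a n t x)) \<le> \<rho>" if tx: "t \<in> ?I" "x \<in> S" for t x
      using lip[OF tx, of "time_integral (a n) t x" "a n t x" 0 0] small[OF tx] b[OF tx] bi[OF tx] \<rho>
        norm_triangle_sub[of "\<Psi> t (x, time_integral (a n) t x, a n t x)" "\<Psi> t (x, 0, 0)"]
      by auto
    ultimately show ?case by (auto simp: aS split_beta)
  qed
  then have c: "\<And>n. continuous_on (?I \<times> S) (\<lambda>(t, x). a n t x)"
    and b: "\<And>n t x. t \<in> ?I \<Longrightarrow> x \<in> S \<Longrightarrow> norm (a n t x) \<le> \<rho>" by auto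
  have bi: "norm (time_integral (a n) t x) \<le> \<rho>" if "t \<in> ?I" "x \<in> S" for n t x
    using time_integral_le[OF c that(2,1)] b that(2) by auto
  have step: "norm (a (Suc n) t x - a n t x) \<le> \<rho> * (1/2)^n" if "t \<in> ?I" "x \<in> S" for n t x
    using that
  proof (induction n arbitrary: t x)
    case 0
    then show ?case using b[of t x "Suc 0"] by (simp add: a0)
  next
    case (Suc n)
    have "norm (time_integral (a (Suc n)) t x - time_integral (a n) t x) \<le> \<rho> * (1/2)^n"
      by (rule time_integral_diff_le[OF c c]) (use Suc in auto)
    moreover have "norm (\<Psi> t (x, time_integral (a (Suc n)) t x, a (Suc n) t x) -
        \<Psi> t (x, time_integral (a n) t x, a n t x)) \<le>
      (norm (time_integral (a (Suc n)) t x - time_integral (a n) t x) + norm (a (Suc n) t x - a n t x)) / 4"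
      by (rule lip) (use Suc.prems b bi in auto)
    then have "norm (a (Suc (Suc n)) t x - a (Suc n) t x) \<le>
      (norm (time_integral (a (Suc n)) t x - time_integral (a n) t x) + norm (a (Suc n) t x - a n t x)) / 4"
      by (metis aS)
    ultimately show ?case using Suc.IH[OF Suc.prems] by simp
  qed
  define V where "V t x = (\<Sum>n. a (Suc n) t x - a n t x)" for t x
  have "uniform_limit (?I \<times> S) (\<lambda>n p. \<Sum>i<n. a (Suc i) (fst p) (snd p) - a i (fst p) (snd p))
      (\<lambda>p. V (fst p) (snd p)) sequentially"
    unfolding V_def
    by (rule Weierstrass_m_test[where M="\<lambda>n. \<rho> * (1/2)^n"]) (use step in \<open>auto intro!: summable_mult\<close>)
  then have ul: "uniform_limit (?I \<times> S) (\<lambda>n p. a n (fst p) (snd p)) (\<lambda>p. V (fst p) (snd p)) sequentially"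
    using sum_lessThan_telescope[of "\<lambda>n. a n t x" for t x] a0 by simp
  have cV: "continuous_on (?I \<times> S) (\<lambda>(t, x). V t x)"
    using uniform_limit_theorem[OF _ ul] c by (auto simp: split_beta)
  have lim: "(\<lambda>n. a n t x) \<longlonglongrightarrow> V t x" if "t \<in> ?I" "x \<in> S" for t x
    using tendsto_uniform_limitI[OF ul, of "(t, x)"] that by simp
  have bV: "norm (V t x) \<le> \<rho>" if "t \<in> ?I" "x \<in> S" for t x
    using Lim_norm_ubound[OF _ lim[OF that]] b[OF that] by auto
  have bVi: "norm (time_integral V t x) \<le> \<rho>" if "t \<in> ?I" "x \<in> S" for t x
    using time_integral_le[OF cV that(2,1)] bV that(2) by auto
  have "V t x = \<Psi> t (x, time_integral V t x, V t x)" if tx: "t \<in> ?I" "x \<in> S" for t x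
  proof -
    have "norm (V t x - \<Psi> t (x, time_integral V t x, V t x)) \<le> e" if "e > 0" for e
    proof -
      from uniform_limitD[OF ul, of "e/2"] \<open>e > 0\<close>
      have "\<forall>\<^sub>F n in sequentially. \<forall>p\<in>?I \<times> S. dist (a n (fst p) (snd p)) (V (fst p) (snd p)) < e/2" by simp
      then obtain n where n: "\<And>m t x. m \<ge> n \<Longrightarrow> t \<in> ?I \<Longrightarrow> x \<in> S \<Longrightarrow> dist (a m t x) (V t x) < e/2"
        unfolding eventually_sequentially by fastforce
      have i: "norm (time_integral (a n) t x - time_integral V t x) \<le> e/2"
        by (rule time_integral_diff_le[OF c cV]) (use tx n[of n] in \<open>auto simp: dist_norm less_imp_le\<close>)
      have "norm (a (Suc n) t x - \<Psi> t (x, time_integral V t x, V t x)) \<le>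
        (norm (time_integral (a n) t x - time_integral V t x) + norm (a n t x - V t x)) / 4"
        unfolding aS by (rule lip) (use tx b[OF tx] bi[OF tx] bV[OF tx] bVi[OF tx] in auto)
      also have "\<dots> \<le> (e/2 + e/2) / 4"
        using i n[of n t x] tx by (auto simp: dist_norm less_imp_le intro!: divide_right_mono add_mono)
      finally have "norm (a (Suc n) t x - \<Psi> t (x, time_integral V t x, V t x)) \<le> e / 4" by simp
      moreover have "norm (V t x - a (Suc n) t x) < e/2"
        using n[of "Suc n" t x] tx by (simp add: dist_norm norm_minus_commute)
      ultimately show ?thesis
        using norm_triangle_ineq[of "V t x - a (Suc n) t x" "a (Suc n) t x - \<Psi> t (x, time_integral V t x, V t x)"] \<open>e > 0\<close>
        by auto
    qed
    then show ?thesis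
      by (metis eq_iff_diff_eq_0 field_le_epsilon add_0 norm_le_zero_iff)
  qed
  then show thesis using that cV bV by blast
qed

section \<open>Smoothness of fixed points\<close>

text \<open>Uniform continuity on a compact tube around the graph of \<open>\<gamma>\<close>.\<close>

lemma uniformly_close_along_curve:
  fixes g :: "real \<Rightarrow> 'c::euclidean_space \<Rightarrow> 'd::metric_space"
  assumes T: "compact T" and D: "open D"
    and \<gamma>: "continuous_on T \<gamma>" "\<gamma> ` T \<subseteq> D"
    and g: "continuous_on (T \<times> D) (\<lambda>(t, q). g t q)" and "e > 0"
  obtains \<delta> where "\<delta> > 0"
    "\<And>t q. t \<in> T \<Longrightarrow> dist q (\<gamma> t) < \<delta> \<Longrightarrow> q \<in> D \<and> dist (g t q) (g t (\<gamma> t)) < e"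
proof -
  have "\<exists>\<delta>>0. \<forall>x\<in>\<gamma> ` T. \<forall>y\<in>- D. \<delta> \<le> dist x y"
    by (rule separate_compact_closed) (use T D \<gamma> compact_continuous_image in auto)
  then obtain d where d: "d > 0" "\<And>t y. t \<in> T \<Longrightarrow> y \<notin> D \<Longrightarrow> d \<le> dist (\<gamma> t) y" by auto
  define M where "M = (\<lambda>(t, h). (t, \<gamma> t + h)) ` (T \<times> cball 0 (d/2))"
  have "continuous_on (T \<times> cball 0 (d/2)) (\<lambda>(t, h). (t, \<gamma> t + h))"
    unfolding split_beta
    by (intro continuous_intros continuous_on_compose2[OF \<gamma>(1)]) auto
  then have "compact M"
    unfolding M_def by (rule compact_continuous_image) (use T in \<open>auto intro!: compact_Times\<close>)
  have "M \<subseteq> T \<times> D"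
  proof -
    have "\<gamma> t + h \<in> D" if "t \<in> T" "norm h \<le> d/2" for t h
      using d(2)[OF that(1), of "\<gamma> t + h"] that(2) d(1) by (auto simp: dist_norm)
    then show ?thesis by (auto simp: M_def)
  qed
  then have "uniformly_continuous_on M (\<lambda>(t, q). g t q)"
    using compact_uniformly_continuous[OF continuous_on_subset[OF g] \<open>compact M\<close>] by blast
  from this[unfolded uniformly_continuous_on_def, rule_format, OF \<open>e > 0\<close>]
  obtain \<delta> where \<delta>: "\<delta> > 0"
    "\<And>p p'. p \<in> M \<Longrightarrow> p' \<in> M \<Longrightarrow> dist p' p < \<delta> \<Longrightarrow>
      dist ((\<lambda>(t, q). g t q) p') ((\<lambda>(t, q). g t q) p) < e"
    by blast
  have M: "(t, q) \<in> M" if "t \<in> T" "dist q (\<gamma> t) \<le> d/2" for t q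
  proof -
    have "(t, q - \<gamma> t) \<in> T \<times> cball 0 (d/2)" using that by (simp add: dist_norm norm_minus_commute)
    then have "(\<lambda>(t, h). (t, \<gamma> t + h)) (t, q - \<gamma> t) \<in> M" unfolding M_def by (rule imageI)
    then show ?thesis by simp
  qed
  show thesis
  proof (rule that[of "min \<delta> (d/2)"])
    fix t q assume t: "t \<in> T" and q: "dist q (\<gamma> t) < min \<delta> (d/2)"
    have "(t, q) \<in> M" "(t, \<gamma> t) \<in> M" using M[OF t] q d(1) by auto
    then show "q \<in> D \<and> dist (g t q) (g t (\<gamma> t)) < e"
      using \<delta>(2)[of "(t, \<gamma> t)" "(t, q)"] q \<open>M \<subseteq> T \<times> D\<close> by (auto simp: dist_Pair_Pair)
  qed (use \<delta> d in auto)
qed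

text \<open>Differentiability along \<open>\<gamma>\<close> with a remainder that is uniform in time: the mean value inequality for
  the remainder, whose derivative is uniformly small in a tube.\<close>

lemma uniformly_differentiable_along_curve:
  fixes \<Psi> :: "real \<Rightarrow> 'c::euclidean_space \<Rightarrow> 'd::euclidean_space"
  assumes T: "compact T" and D: "open D" and \<Psi>: "param_Ck_on (Suc 0) T D \<Psi>"
    and \<gamma>: "continuous_on T \<gamma>" "\<gamma> ` T \<subseteq> D" and "e > 0"
  obtains \<delta> where "\<delta> > 0"
    "\<And>t q. t \<in> T \<Longrightarrow> dist q (\<gamma> t) < \<delta> \<Longrightarrow> q \<in> D"
    "\<And>t q. t \<in> T \<Longrightarrow> dist q (\<gamma> t) < \<delta> \<Longrightarrow>
      norm (\<Psi> t q - \<Psi> t (\<gamma> t) - fderiv (\<Psi> t) (\<gamma> t) (q - \<gamma> t)) \<le> e * norm (q - \<gamma> t)"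
proof -
  note E = param_Ck_on_SucD[OF \<Psi>]
  let ?D = "\<lambda>t q. fderiv (\<Psi> t) q"
  have lin: "bounded_linear (?D t q)" if "t \<in> T" "q \<in> D" for t q
    using E(1)[OF that] has_derivative_bounded_linear by blast
  have "param_Ck_on 0 T D (\<lambda>t q. Blinfun (?D t q))"
    by (rule param_Ck_on_blinfun[OF D E(2)]) (use lin bounded_linear.linear in blast)
  then have "continuous_on (T \<times> D) (\<lambda>(t, q). Blinfun (?D t q))" by simp
  from uniformly_close_along_curve[OF T D \<gamma> this \<open>e > 0\<close>]
  obtain \<delta> where \<delta>: "\<delta> > 0" "\<And>t q. t \<in> T \<Longrightarrow> dist q (\<gamma> t) < \<delta> \<Longrightarrow>
      q \<in> D \<and> dist (Blinfun (?D t q)) (Blinfun (?D t (\<gamma> t))) < e" by blast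
  show thesis
  proof (rule that[OF \<delta>(1)])
    fix t q assume t: "t \<in> T" and q: "dist q (\<gamma> t) < \<delta>"
    show "q \<in> D" using \<delta>(2)[OF t q] by simp
    have \<gamma>D: "\<gamma> t \<in> D" using \<gamma> t by auto
    have "norm ((\<Psi> t q - ?D t (\<gamma> t) q) - (\<Psi> t (\<gamma> t) - ?D t (\<gamma> t) (\<gamma> t))) \<le> e * norm (q - \<gamma> t)"
    proof (rule differentiable_bound[where S="ball (\<gamma> t) \<delta>" and f'="\<lambda>z v. ?D t z v - ?D t (\<gamma> t) v"
          and f="\<lambda>q. \<Psi> t q - ?D t (\<gamma> t) q"])
      fix z assume z: "z \<in> ball (\<gamma> t) \<delta>"
      then have zD: "z \<in> D" and close: "dist (Blinfun (?D t z)) (Blinfun (?D t (\<gamma> t))) < e"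
        using \<delta>(2)[OF t, of z] by (auto simp: dist_commute)
      show "((\<lambda>q. \<Psi> t q - ?D t (\<gamma> t) q) has_derivative (\<lambda>v. ?D t z v - ?D t (\<gamma> t) v))
          (at z within ball (\<gamma> t) \<delta>)"
        by (intro has_derivative_diff has_derivative_at_withinI[OF E(1)[OF t zD]]
            bounded_linear.has_derivative[OF lin[OF t \<gamma>D]] has_derivative_ident)
      have "onorm (\<lambda>v. ?D t z v - ?D t (\<gamma> t) v) = norm (Blinfun (?D t z) - Blinfun (?D t (\<gamma> t)))"
        using lin[OF t zD] lin[OF t \<gamma>D]
        by (simp add: norm_blinfun.rep_eq minus_blinfun.rep_eq bounded_linear_Blinfun_apply)
      then show "onorm (\<lambda>v. ?D t z v - ?D t (\<gamma> t) v) \<le> e" using close by (simp add: dist_norm)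
    qed (use q \<delta> in \<open>auto simp: dist_commute\<close>)
    moreover have lq: "?D t (\<gamma> t) (q - \<gamma> t) = ?D t (\<gamma> t) q - ?D t (\<gamma> t) (\<gamma> t)"
      using linear_diff bounded_linear.linear[OF lin[OF t \<gamma>D]] by blast
    ultimately show "norm (\<Psi> t q - \<Psi> t (\<gamma> t) - ?D t (\<gamma> t) (q - \<gamma> t)) \<le> e * norm (q - \<gamma> t)"
      unfolding lq by (simp add: algebra_simps)
  qed
qed

text \<open>Operator norms are of no help for a contraction in the last two arguments only: it controls the
  derivative in some directions, with Lipschitz bounds known along these directions alone.\<close>

lemma derivative_le_of_local_bound:
  fixes f :: "'a::real_normed_vector \<Rightarrow> 'b::real_normed_vector"
  assumes f: "(f has_derivative f') (at x)" and "open D" "x \<in> D"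
    and b: "\<And>s. s > 0 \<Longrightarrow> x + s *\<^sub>R u \<in> D \<Longrightarrow> norm (f (x + s *\<^sub>R u) - f x) \<le> C * s"
  shows "norm (f' u) \<le> C"
proof -
  have "((\<lambda>s. x + s *\<^sub>R u) has_derivative (\<lambda>s. s *\<^sub>R u)) (at 0)"
    by (auto intro!: derivative_eq_intros)
  from diff_chain_at[OF this, of f f'] f
  have "((\<lambda>s. f (x + s *\<^sub>R u)) has_derivative (\<lambda>s. f' (s *\<^sub>R u))) (at 0)" by (simp add: o_def)
  moreover have "f' (s *\<^sub>R u) = s *\<^sub>R f' u" for s
    using linear_cmul[OF has_derivative_linear[OF f]] .
  ultimately have "((\<lambda>s. norm (f (x + s *\<^sub>R u) - f x - s *\<^sub>R f' u) / norm s) \<longlongrightarrow> 0) (at 0)"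
    by (simp add: has_derivative_at)
  then have "((\<lambda>s. C + norm (f (x + s *\<^sub>R u) - f x - s *\<^sub>R f' u) / norm s) \<longlongrightarrow> C + 0) (at_right 0)"
    by (intro tendsto_intros) (simp add: filterlim_at_split)
  then have lim: "((\<lambda>s. C + norm (f (x + s *\<^sub>R u) - f x - s *\<^sub>R f' u) / norm s) \<longlongrightarrow> C) (at_right 0)"
    by simp
  have "((\<lambda>s. x + s *\<^sub>R u) \<longlongrightarrow> x + 0 *\<^sub>R u) (at_right 0)" by (intro tendsto_intros)
  then have "\<forall>\<^sub>F s in at_right 0. x + s *\<^sub>R u \<in> D"
    using assms(2,3) by (intro topological_tendstoD) auto
  moreover have "\<forall>\<^sub>F s in at_right (0::real). s > 0" by (rule eventually_at_right_less)
  ultimately have "\<forall>\<^sub>F s in at_right 0. norm (f' u) \<le>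
      C + norm (f (x + s *\<^sub>R u) - f x - s *\<^sub>R f' u) / norm s"
  proof eventually_elim
    case (elim s)
    have "s * norm (f' u) = norm (s *\<^sub>R f' u)" using elim(2) by simp
    also have "\<dots> \<le> norm (f (x + s *\<^sub>R u) - f x) + norm (f (x + s *\<^sub>R u) - f x - s *\<^sub>R f' u)"
      by (metis norm_triangle_sub norm_minus_commute add.commute)
    also have "\<dots> \<le> C * s + norm (f (x + s *\<^sub>R u) - f x - s *\<^sub>R f' u)"
      using b elim by simp
    finally show ?case using elim(2) by (simp add: field_simps)
  qed
  then show ?thesis
    by (intro tendsto_lowerbound[OF lim]) auto
qed

lemma continuous_on_Times_localI:
  fixes f :: "real \<Rightarrow> 'a::metric_space \<Rightarrow> 'b::topological_space"
  assumes "\<And>x. x \<in> N \<Longrightarrow> \<exists>r>0. continuous_on (T \<times> (N \<inter> ball x r)) (\<lambda>(t, x). f t x)"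
  shows "continuous_on (T \<times> N) (\<lambda>(t, x). f t x)"
  unfolding continuous_on_eq_continuous_within
proof
  fix p assume p: "p \<in> T \<times> N"
  then obtain r where r: "r > 0" "continuous_on (T \<times> (N \<inter> ball (snd p) r)) (\<lambda>(t, x). f t x)"
    using assms[of "snd p"] by auto
  have "at p within (T \<times> N) = at p within (T \<times> (N \<inter> ball (snd p) r))"
    by (rule at_within_nhd[of _ "UNIV \<times> ball (snd p) r"])
      (use r(1) in \<open>auto intro!: open_Times simp: mem_Times_iff\<close>)
  then show "continuous (at p within T \<times> N) (\<lambda>(t, x). f t x)"
    using r p unfolding continuous_on_eq_continuous_within by (cases p) auto
qed


text \<open>The partial derivatives of a solution are found before differentiability is known: they are
  the solutions \<open>W i\<close> of the linearised equation. The increment of \<open>V\<close> and then its difference to the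
  linear candidate are estimated in the supremum norm over time; the contraction bound lets the
  part of the right-hand side that contains the unknown be absorbed on the left.
  The second claim is what the induction on the order of differentiability works with: it concerns
  one derivative in an arbitrary direction at a time.\<close>

lemma fixed_point_has_derivative:
  fixes \<Psi> :: "real \<Rightarrow> 'a::euclidean_space \<times> 'b::euclidean_space \<times> 'b \<Rightarrow> 'b"
  assumes N: "open N" and D: "open D" and \<Psi>: "param_Ck_on (Suc 0) {0..1} D \<Psi>"
    and contr: "\<And>t p y w. t \<in> {0..1} \<Longrightarrow> p \<in> D \<Longrightarrow>
      norm (fderiv (\<Psi> t) p (0, y, w)) \<le> (norm y + norm w) / 4"
    and V: "continuous_on ({0..1} \<times> N) (\<lambda>(t, x). V t x)"
    and VD: "\<And>t x. t \<in> {0..1} \<Longrightarrow> x \<in> N \<Longrightarrow> (x, time_integral V t x, V t x) \<in> D"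
    and Veq: "\<And>t x. t \<in> {0..1} \<Longrightarrow> x \<in> N \<Longrightarrow> V t x = \<Psi> t (x, time_integral V t x, V t x)"
    and x: "x \<in> N" and t: "t \<in> {0..1}"
    and M: "open M" "x \<in> M"
    and W: "\<And>i. i \<in> Basis \<Longrightarrow> continuous_on ({0..1} \<times> M) (\<lambda>(t, x). W i t x)"
    and Weq: "\<And>i t. i \<in> Basis \<Longrightarrow> t \<in> {0..1} \<Longrightarrow> W i t x =
      fderiv (\<Psi> t) (x, time_integral V t x, V t x) (i, time_integral (W i) t x, W i t x)"
  shows "(V t has_derivative (\<lambda>v. \<Sum>i\<in>Basis. (v \<bullet> i) *\<^sub>R W i t x)) (at x)"
    and "(\<Sum>i\<in>Basis. (v \<bullet> i) *\<^sub>R W i t x) =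
      fderiv (\<Psi> t) (x, time_integral V t x, V t x)
        (v, time_integral (\<lambda>t x. \<Sum>i\<in>Basis. (v \<bullet> i) *\<^sub>R W i t x) t x, \<Sum>i\<in>Basis. (v \<bullet> i) *\<^sub>R W i t x)"
proof -
  let ?I = "{0..1::real}"
  let ?p = "\<lambda>t x. (x, time_integral V t x, V t x)"
  let ?L = "\<lambda>t. fderiv (\<Psi> t) (?p t x)"
  let ?U = "\<lambda>h t x. \<Sum>i\<in>Basis. (h \<bullet> i) *\<^sub>R W i t x"
  note E = param_Ck_on_SucD[OF \<Psi>]
  have lin: "linear (?L t)" if "t \<in> ?I" for t
    using E(1)[OF that VD[OF that x]] has_derivative_linear by blast
  have cTV: "continuous_on (?I \<times> N) (\<lambda>(t, x). time_integral V t x)"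
    by (rule continuous_on_time_integral[OF V])
  have c\<gamma>: "continuous_on ?I (\<lambda>t. ?p t x)"
    by (intro continuous_intros continuous_on_time_slice[OF cTV x] continuous_on_time_slice[OF V x])
  have \<gamma>D: "(\<lambda>t. ?p t x) ` ?I \<subseteq> D" using VD x by auto
  \<comment> \<open>By linearity the candidate in direction \<open>h\<close> solves the linearised equation, since each \<open>W i\<close> does.\<close>
  have cU: "continuous_on (?I \<times> M) (\<lambda>(t, x). ?U h t x)" for h
    using W by (auto simp: split_beta intro!: continuous_intros)
  have Ueq: "?U h t x = ?L t (h, time_integral (?U h) t x, ?U h t x)" if t: "t \<in> ?I" for h t
  proof -
    have "time_integral (?U h) t x = (\<Sum>i\<in>Basis. (h \<bullet> i) *\<^sub>R time_integral (W i) t x)"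
      by (rule time_integral_sum_scaleR[OF W]) (use M t in auto)
    then have "(h, time_integral (?U h) t x, ?U h t x) =
        (\<Sum>i\<in>Basis. (h \<bullet> i) *\<^sub>R (i, time_integral (W i) t x, W i t x))"
      by (simp add: prod_eq_iff fst_sum snd_sum euclidean_representation)
    then have "?L t (h, time_integral (?U h) t x, ?U h t x) =
        (\<Sum>i\<in>Basis. (h \<bullet> i) *\<^sub>R ?L t (i, time_integral (W i) t x, W i t x))"
      by (simp only: linear_sum[OF lin[OF t]] linear_cmul[OF lin[OF t]])
    also have "\<dots> = ?U h t x" using Weq t by simp
    finally show ?thesis by simp
  qed
  \<comment> \<open>The partial derivative in \<open>x\<close> is not small; a bound that is uniform in time suffices for it.\<close>
  obtain B where B: "B \<ge> 0" "\<And>t h. t \<in> ?I \<Longrightarrow> norm (?L t (h, 0, 0)) \<le> B * norm h"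
  proof -
    have "continuous_on ?I (\<lambda>t. \<Sum>i\<in>Basis. norm (?L t (i, 0, 0)))"
    proof (intro continuous_intros)
      fix i :: 'a
      have "continuous_on ?I (\<lambda>t. (\<lambda>(t, p). fderiv (\<Psi> t) p (i, 0, 0)) (t, ?p t x))"
        by (rule continuous_on_compose2[OF param_Ck_on_imp_continuous[OF E(2)]])
          (use \<gamma>D in \<open>auto intro!: continuous_intros c\<gamma>\<close>)
      then show "continuous_on ?I (\<lambda>t. ?L t (i, 0, 0))" by simp
    qed
    then have "bounded ((\<lambda>t. \<Sum>i\<in>Basis. norm (?L t (i::'a, 0, 0))) ` ?I)"
      by (intro compact_imp_bounded compact_continuous_image) auto
    then obtain B where "\<And>t. t \<in> ?I \<Longrightarrow> norm (\<Sum>i\<in>Basis. norm (?L t (i::'a, 0, 0))) \<le> B"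
      unfolding bounded_iff by blast
    then have B: "\<And>t. t \<in> ?I \<Longrightarrow> (\<Sum>i\<in>Basis. norm (?L t (i::'a, 0, 0))) \<le> B"
      by (metis abs_le_D1 real_norm_def)
    have "norm (?L t (h, 0, 0)) \<le> B * norm h" if t: "t \<in> ?I" for t h
    proof -
      have "(h, 0::'b, 0::'b) = (\<Sum>i\<in>Basis. (h \<bullet> i) *\<^sub>R (i, 0, 0))"
        by (simp add: prod_eq_iff fst_sum snd_sum euclidean_representation)
      then have "?L t (h, 0, 0) = (\<Sum>i\<in>Basis. (h \<bullet> i) *\<^sub>R ?L t (i, 0, 0))"
        by (simp only: linear_sum[OF lin[OF t]] linear_cmul[OF lin[OF t]])
      also have "norm \<dots> \<le> (\<Sum>i\<in>Basis. norm h * norm (?L t (i, 0, 0)))"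
        by (intro sum_norm_le) (auto intro!: mult_right_mono simp: Basis_le_norm)
      also have "\<dots> = norm h * (\<Sum>i\<in>Basis. norm (?L t (i, 0, 0)))" by (simp add: sum_distrib_left)
      also have "\<dots> \<le> norm h * B" using B[OF t] by (intro mult_left_mono) auto
      finally show ?thesis by (simp add: mult.commute)
    qed
    moreover have "B \<ge> 0" by (rule order_trans[OF sum_nonneg B[of 0]]) auto
    ultimately show thesis using that by blast
  qed
  \<comment> \<open>Estimates are made at a time where the norm is maximal, so that it also bounds the time integral.\<close>
  have sup: "\<exists>s\<in>?I. \<forall>t\<in>?I. norm (f t) \<le> norm (f s)" if "continuous_on ?I f" for f :: "real \<Rightarrow> 'b"
    using continuous_attains_sup[of ?I "\<lambda>t. norm (f t)"] that by (auto intro!: continuous_intros)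
  have key: "\<exists>\<delta>>0. \<forall>h. norm h < \<delta> \<longrightarrow> norm (V t (x + h) - V t x - ?U h t x) \<le> e * norm h"
    if e: "e > 0" for e
  proof -
    \<comment> \<open>\<open>4 * B + 1\<close> will be a Lipschitz constant of \<open>V\<close> at \<open>x\<close>, so that \<open>K\<close> is one of the whole curve; the
      absorption at the end costs another factor two.\<close>
    define K where "K = 1 + 2 * (4 * B + 1)"
    define \<epsilon> where "\<epsilon> = min (1/8) (e / (2 * K))"
    have K: "K \<ge> 1" using B by (simp add: K_def)
    have \<epsilon>: "\<epsilon> > 0" "\<epsilon> \<le> 1/8" "2 * K * \<epsilon> \<le> e"
    proof -
      have "2 * K * \<epsilon> \<le> 2 * K * (e / (2 * K))"
        unfolding \<epsilon>_def using K by (intro mult_left_mono) auto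
      then show "2 * K * \<epsilon> \<le> e" using K by simp
    qed (use e K in \<open>auto simp: \<epsilon>_def\<close>)
    obtain \<delta>1 where \<delta>1: "\<delta>1 > 0" "\<And>t q. t \<in> ?I \<Longrightarrow> dist q (?p t x) < \<delta>1 \<Longrightarrow> q \<in> D"
      "\<And>t q. t \<in> ?I \<Longrightarrow> dist q (?p t x) < \<delta>1 \<Longrightarrow>
        norm (\<Psi> t q - \<Psi> t (?p t x) - ?L t (q - ?p t x)) \<le> \<epsilon> * norm (q - ?p t x)"
      by (rule uniformly_differentiable_along_curve[OF compact_Icc D \<Psi> c\<gamma> \<gamma>D \<epsilon>(1)]) (rule that)
    have cp: "continuous_on (?I \<times> N) (\<lambda>(t, x). ?p t x)"
      using V cTV by (auto simp: split_beta intro!: continuous_intros)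
    have xN: "(\<lambda>_. x) ` ?I \<subseteq> N" using x by auto
    obtain \<delta>2 where \<delta>2: "\<delta>2 > 0" "\<And>t q. t \<in> ?I \<Longrightarrow> dist q x < \<delta>2 \<Longrightarrow>
      q \<in> N \<and> dist (?p t q) (?p t x) < \<delta>1"
      by (rule uniformly_close_along_curve[OF compact_Icc N continuous_on_const xN cp \<delta>1(1)]) (rule that)
    have "norm (V t (x + h) - V t x - ?U h t x) \<le> e * norm h" if h: "norm h < \<delta>2" for h
    proof -
      have xh: "x + h \<in> N" using \<delta>2(2)[of 0 "x + h"] h by (simp add: dist_norm)
      define R where "R s = V s (x + h) - V s x - ?L s (?p s (x + h) - ?p s x)" for s
      have R: "norm (R s) \<le> \<epsilon> * norm (?p s (x + h) - ?p s x)" if s: "s \<in> ?I" for s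
        using \<delta>1(3)[OF s, of "?p s (x + h)"] \<delta>2(2)[OF s, of "x + h"] h Veq[OF s x] Veq[OF s xh]
        by (simp add: R_def dist_norm)
      have split: "?L s (h, y, w) = ?L s (h, 0, 0) + ?L s (0, y, w)" if "s \<in> ?I" for s y w
        using linear_add[OF lin[OF that], of "(h, 0, 0)" "(0, y, w)"] by simp
      have pn: "norm (h, y, w) \<le> norm h + norm y + norm w" for y w :: 'b
        using norm_Pair_le[of h "(y, w)"] norm_Pair_le[of y w] by linarith
      have p: "?p s (x + h) - ?p s x =
          (h, time_integral V s (x + h) - time_integral V s x, V s (x + h) - V s x)" for s by simp
      \<comment> \<open>First the increment of \<open>V\<close>: the terms that contain its maximum \<open>m\<close> add up to \<open>3/4 m\<close>.\<close>
      obtain s where s: "s \<in> ?I" and smax: "\<And>t. t \<in> ?I \<Longrightarrow> norm (V t (x + h) - V t x) \<le> norm (V s (x + h) - V s x)"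
        using sup[OF continuous_on_diff[OF continuous_on_time_slice[OF V xh] continuous_on_time_slice[OF V x]]]
        by auto
      define m where "m = norm (V s (x + h) - V s x)"
      have ti: "norm (time_integral V t (x + h) - time_integral V t x) \<le> m" if "t \<in> ?I" for t
        by (rule time_integral_diff_le[OF V V]) (use that x xh smax m_def in auto)
      have pm: "norm (?p t (x + h) - ?p t x) \<le> norm h + 2 * m" if "t \<in> ?I" for t
        unfolding p using pn[of "time_integral V t (x + h) - time_integral V t x" "V t (x + h) - V t x"]
          ti[OF that] smax[OF that] by (simp add: m_def)
      let ?d = "(0, time_integral V s (x + h) - time_integral V s x, V s (x + h) - V s x)"
      have "V s (x + h) - V s x = R s + (?L s (h, 0, 0) + ?L s ?d)"
        unfolding split[OF s, symmetric] p[symmetric] by (simp add: R_def)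
      from arg_cong[OF this, of norm]
      have "m \<le> norm (R s) + (norm (?L s (h, 0, 0)) + norm (?L s ?d))"
        using norm_triangle_ineq[of "R s" "?L s (h, 0, 0) + ?L s ?d"]
          norm_triangle_ineq[of "?L s (h, 0, 0)" "?L s ?d"] unfolding m_def by linarith
      moreover have "8 * norm (R s) \<le> norm h + 2 * m"
      proof -
        have "\<epsilon> * norm (?p s (x + h) - ?p s x) \<le> (1/8) * (norm h + 2 * m)"
          by (rule mult_mono[OF \<epsilon>(2) pm[OF s]]) auto
        from order_trans[OF R[OF s] this] show ?thesis by simp
      qed
      moreover have L2: "norm (?L s ?d) \<le> (m + m) / 4"
        by (rule order_trans[OF contr[OF s VD[OF s x]]], intro divide_right_mono add_mono ti s)
          (simp_all add: m_def)
      moreover from L2 have "4 * norm (?L s ?d) \<le> m + m" by simp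
      moreover have "norm (?L s (h, 0, 0)) \<le> B * norm h" by (rule B(2)[OF s])
      moreover have "(4 * B + 1) * norm h = 4 * (B * norm h) + norm h" by (simp add: algebra_simps)
      ultimately have m: "m \<le> (4 * B + 1) * norm h"
        using norm_ge_zero[of h] by linarith
      then have pK: "norm (?p t (x + h) - ?p t x) \<le> K * norm h" if "t \<in> ?I" for t
      proof -
        have "K * norm h = norm h + 2 * ((4 * B + 1) * norm h)" by (simp add: K_def algebra_simps)
        then show ?thesis using pm[OF that] m by linarith
      qed
      \<comment> \<open>Then the same absorption for the distance to the candidate.\<close>
      let ?e = "\<lambda>t. V t (x + h) - V t x - ?U h t x"
      have cUx: "continuous_on ?I (\<lambda>t. ?U h t x)" by (rule continuous_on_time_slice[OF cU M(2)])
      have ce: "continuous_on ?I ?e"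
        by (intro continuous_on_diff continuous_on_time_slice[OF V xh] continuous_on_time_slice[OF V x] cUx)
      obtain s where s: "s \<in> ?I" and smax: "\<And>t. t \<in> ?I \<Longrightarrow> norm (?e t) \<le> norm (?e s)"
        using sup[OF ce] by auto
      have ti: "time_integral V s (x + h) - time_integral V s x - time_integral (?U h) s x =
          integral {0..s} ?e"
      proof -
        have c: "continuous_on {0..s} (\<lambda>t. V t (x + h))" "continuous_on {0..s} (\<lambda>t. V t x)"
          "continuous_on {0..s} (\<lambda>t. ?U h t x)"
          using s by (auto intro!: continuous_on_subset[OF continuous_on_time_slice[OF V x]]
            continuous_on_subset[OF continuous_on_time_slice[OF V xh]] continuous_on_subset[OF cUx])
        show ?thesis
          unfolding time_integral_def
          by (subst integral_diff; (subst integral_diff)?)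
            (auto intro!: integrable_continuous_real continuous_intros c)
      qed
      have ie: "norm (integral {0..s} ?e) \<le> norm (?e s)"
      proof -
        have "norm (integral {0..s} ?e) \<le> norm (?e s) * (s - 0)"
          by (rule integral_bound) (use s smax in \<open>auto intro!: continuous_on_subset[OF ce]\<close>)
        also have "\<dots> \<le> norm (?e s)" using s by (simp add: mult_left_le)
        finally show ?thesis .
      qed
      have "?e s = R s + (?L s (?p s (x + h) - ?p s x) - ?L s (h, time_integral (?U h) s x, ?U h s x))"
        using Ueq[OF s, of h] by (simp add: R_def)
      also have "?L s (?p s (x + h) - ?p s x) - ?L s (h, time_integral (?U h) s x, ?U h s x) =
          ?L s (0, integral {0..s} ?e, ?e s)"
        unfolding linear_diff[OF lin[OF s], symmetric] ti[symmetric] by simp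
      finally have es: "?e s = R s + ?L s (0, integral {0..s} ?e, ?e s)" .
      have "norm (?e s) \<le> norm (R s) + norm (?L s (0, integral {0..s} ?e, ?e s))"
        by (rule order_trans[OF eq_refl[OF arg_cong[OF es, of norm]] norm_triangle_ineq])
      also have "\<dots> \<le> \<epsilon> * (K * norm h) + (norm (?e s) + norm (?e s)) / 4"
      proof (rule add_mono)
        show "norm (R s) \<le> \<epsilon> * (K * norm h)"
          using R[OF s] mult_left_mono[OF pK[OF s], of \<epsilon>] \<epsilon>(1) by linarith
        show "norm (?L s (0, integral {0..s} ?e, ?e s)) \<le> (norm (?e s) + norm (?e s)) / 4"
          by (rule order_trans[OF contr[OF s VD[OF s x]]]) (intro divide_right_mono add_mono ie order_refl, simp)
      qed
      finally have ne: "norm (?e s) \<le> \<epsilon> * (K * norm h) + (norm (?e s) + norm (?e s)) / 4" .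
      have "n \<le> 2 * a" if "n \<le> a + (n + n) / 4" for n a :: real using that by simp
      from this[OF ne] have "norm (?e s) \<le> 2 * K * \<epsilon> * norm h" by (simp only: ac_simps)
      also have "\<dots> \<le> e * norm h" using \<epsilon>(3) by (intro mult_right_mono) auto
      finally show ?thesis using smax[OF t] by linarith
    qed
    then show ?thesis using \<delta>2(1) by blast
  qed
  have "bounded_linear (\<lambda>h. ?U h t x)"
    by (intro bounded_linear_sum bounded_linear_scaleR_const bounded_linear_inner_left)
  then show "(V t has_derivative (\<lambda>v. \<Sum>i\<in>Basis. (v \<bullet> i) *\<^sub>R W i t x)) (at x)"
    unfolding has_derivative_at_alt
  proof (intro conjI allI impI)
    fix e :: real assume "e > 0"
    from key[OF this] obtain \<delta> where \<delta>: "\<delta> > 0"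
      "\<And>h. norm h < \<delta> \<Longrightarrow> norm (V t (x + h) - V t x - ?U h t x) \<le> e * norm h" by blast
    show "\<exists>d>0. \<forall>y. norm (y - x) < d \<longrightarrow> norm (V t y - V t x - ?U (y - x) t x) \<le> e * norm (y - x)"
      using \<delta>(1) \<delta>(2)[of "y - x" for y] by auto
  qed
  show "?U v t x = ?L t (v, time_integral (?U v) t x, ?U v t x)" by (rule Ueq[OF t])
qed

text \<open>Induction on the order for all equations at once. The derivative of \<open>V\<close> in direction \<open>v\<close> solves the
  equation given by \<open>\<Phi> v\<close>, which is affine in the unknown, satisfies the same contraction bound,
  and loses one order of smoothness only, because \<open>V\<close> itself already has the lower order
  by the induction hypothesis.
  The contraction is stated as a Lipschitz bound, since at order zero there is no derivative to bound.\<close>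

lemma fixed_point_param_Ck:
  fixes \<Psi> :: "real \<Rightarrow> 'a::euclidean_space \<times> 'b::euclidean_space \<times> 'b \<Rightarrow> 'b"
  assumes N: "open N" and "open D" and "param_Ck_on k {0..1} D \<Psi>"
    and "\<And>t x y w y' w'. t \<in> {0..1} \<Longrightarrow> (x, y, w) \<in> D \<Longrightarrow> (x, y', w') \<in> D \<Longrightarrow>
      norm (\<Psi> t (x, y, w) - \<Psi> t (x, y', w')) \<le> (norm (y - y') + norm (w - w')) / 4"
    and "continuous_on ({0..1} \<times> N) (\<lambda>(t, x). V t x)"
    and "\<And>t x. t \<in> {0..1} \<Longrightarrow> x \<in> N \<Longrightarrow> (x, time_integral V t x, V t x) \<in> D"
    and "\<And>t x. t \<in> {0..1} \<Longrightarrow> x \<in> N \<Longrightarrow> V t x = \<Psi> t (x, time_integral V t x, V t x)"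
  shows "param_Ck_on k {0..1} N V"
  using assms(2-)
proof (induction k arbitrary: \<Psi> V D)
  case 0
  then show ?case by simp
next
  case (Suc k)
  let ?I = "{0..1::real}"
  let ?p = "\<lambda>t x. (x, time_integral V t x, V t x)"
  let ?D = "\<lambda>t p. fderiv (\<Psi> t) p"
  note D = Suc.prems(1) and \<Psi> = Suc.prems(2) and lip = Suc.prems(3) and V = Suc.prems(4)
    and VD = Suc.prems(5) and Veq = Suc.prems(6)
  note E = param_Ck_on_SucD[OF \<Psi>]
  have \<Psi>1: "param_Ck_on (Suc 0) ?I D \<Psi>" by (rule param_Ck_on_le[OF _ \<Psi>]) simp
  have Vk: "param_Ck_on k ?I N V"
    by (rule Suc.IH[OF D param_Ck_on_SucE[OF \<Psi>] lip V VD Veq])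
  have lin: "linear (?D t p)" if "t \<in> ?I" "p \<in> D" for t p
    using E(1)[OF that] has_derivative_linear by blast
  have contr: "norm (?D t p (0, y, w)) \<le> (norm y + norm w) / 4" if t: "t \<in> ?I" and p: "p \<in> D" for t p y w
  proof (rule derivative_le_of_local_bound[OF E(1)[OF t p] D p])
    fix s :: real assume s: "s > 0" and ps: "p + s *\<^sub>R (0, y, w) \<in> D"
    obtain x y0 w0 where p_eq: "p = (x, y0, w0)" by (cases p) auto
    show "norm (\<Psi> t (p + s *\<^sub>R (0, y, w)) - \<Psi> t p) \<le> (norm y + norm w) / 4 * s"
      using lip[OF t, of x "y0 + s *\<^sub>R y" "w0 + s *\<^sub>R w" y0 w0] p ps s
      by (simp add: p_eq algebra_simps)
  qed
  define \<Phi> where "\<Phi> v t q = ?D t (?p t (fst q)) (v, snd q)" for v :: 'a and t and q :: "'a \<times> 'b \<times> 'b"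
  have NU: "open (N \<times> (UNIV :: ('b \<times> 'b) set))" using N by (simp add: open_Times)
  have \<Phi>: "param_Ck_on k ?I (N \<times> UNIV) (\<Phi> v)" for v
  proof (rule param_Ck_on_cong[OF NU])
    let ?q = "\<lambda>t q. ?p t (fst q) :: 'a \<times> 'b \<times> 'b"
    have fst: "param_Ck_on k ?I (N \<times> UNIV) (\<lambda>t q :: 'a \<times> 'b \<times> 'b. fst q)"
      by (rule param_Ck_on_id[OF NU bounded_linear_fst])
    have pk: "param_Ck_on k ?I N ?p"
    proof -
      have "param_Ck_on k ?I N (\<lambda>t x. (x, 0) + ((0, time_integral V t x, 0) + (0, 0, V t x)))"
        by (intro param_Ck_on_add[OF N]
            param_Ck_on_linear[OF _ N Vk, of "\<lambda>w. (0, 0, w)"]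
            param_Ck_on_linear[OF _ N param_Ck_on_time_integral[OF N Vk], of "\<lambda>y. (0, y, 0)"]
            param_Ck_on_id[OF N])
          (auto intro!: bounded_linear_Pair bounded_linear_zero bounded_linear_ident)
      then show ?thesis by simp
    qed
    have q: "param_Ck_on k ?I (N \<times> UNIV) (\<lambda>t q. ?p t (fst (q :: 'a \<times> 'b \<times> 'b)))"
      by (rule param_Ck_on_compose[OF NU pk fst]) auto
    have lq: "param_Ck_on k ?I (N \<times> UNIV) (\<lambda>t q :: 'a \<times> 'b \<times> 'b. (v, 0) + (0, snd q))"
      by (intro param_Ck_on_add[OF NU] param_Ck_on_const[OF NU] param_Ck_on_id[OF NU])
        (auto intro!: bounded_linear_Pair bounded_linear_zero bounded_linear_snd)
    show "param_Ck_on k ?I (N \<times> UNIV) (\<lambda>t q. \<Sum>b\<in>Basis. (((v, 0) + (0, snd q)) \<bullet> b) *\<^sub>R ?D t (?p t (fst q)) b)"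
      by (intro param_Ck_on_sum[OF NU] param_Ck_on_scaleR[OF NU] param_Ck_on_inner_const[OF NU lq]
          param_Ck_on_compose[OF NU E(2) q]) (use VD in auto)
    fix t q assume "t \<in> ?I" and q: "q \<in> N \<times> (UNIV :: ('b \<times> 'b) set)"
    then have "linear (?D t (?p t (fst q)))" using VD by (intro lin) auto
    from linear_eq_sum_Basis[OF this, of "(v, snd q)"]
    show "(\<Sum>b\<in>Basis. (((v, 0) + (0, snd q)) \<bullet> b) *\<^sub>R ?D t (?p t (fst q)) b) = \<Phi> v t q"
      by (simp add: \<Phi>_def)
  qed
  have \<Phi>lip: "norm (\<Phi> v t (x, y, w) - \<Phi> v t (x, y', w')) \<le> (norm (y - y') + norm (w - w')) / 4"
    if t: "t \<in> ?I" and x: "x \<in> N" for v t x y w y' w'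
  proof -
    have "\<Phi> v t (x, y, w) - \<Phi> v t (x, y', w') = ?D t (?p t x) (0, y - y', w - w')"
      using linear_diff[OF lin[OF t VD[OF t x]], of "(v, y, w)" "(v, y', w')"] by (simp add: \<Phi>_def)
    then show ?thesis using contr[OF t VD[OF t x], of "y - y'" "w - w'"] by simp
  qed
  have loc: "\<exists>r W. r > 0 \<and> ball x0 r \<subseteq> N \<and> (\<forall>v. continuous_on (?I \<times> ball x0 r) (\<lambda>(t, x). W v t x)) \<and>
      (\<forall>v. \<forall>t\<in>?I. \<forall>x\<in>ball x0 r. W v t x = \<Phi> v t (x, time_integral (W v) t x, W v t x))"
    if x0: "x0 \<in> N" for x0
  proof -
    obtain r where r: "r > 0" "cball x0 r \<subseteq> N" using N x0 open_contains_cball by blast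
    have "\<exists>W. continuous_on (?I \<times> cball x0 r) (\<lambda>(t, x). W t x) \<and>
      (\<forall>t\<in>?I. \<forall>x\<in>cball x0 r. W t x = \<Phi> v t (x, time_integral W t x, W t x))" for v
    proof -
      have c: "continuous_on (?I \<times> (N \<times> UNIV)) (\<lambda>(t, q). \<Phi> v t q)"
        by (rule param_Ck_on_imp_continuous[OF \<Phi>])
      have "continuous_on (?I \<times> cball x0 r) (\<lambda>p. (\<lambda>(t, q). \<Phi> v t q) (fst p, snd p, 0, 0))"
        by (rule continuous_on_compose2[OF c]) (use r in \<open>auto intro!: continuous_intros\<close>)
      then have "bounded ((\<lambda>p. \<Phi> v (fst p) (snd p, 0, 0)) ` (?I \<times> cball x0 r))"
        by (intro compact_imp_bounded compact_continuous_image compact_Times) auto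
      then obtain B where B: "B > 0" "\<And>t x. t \<in> ?I \<Longrightarrow> x \<in> cball x0 r \<Longrightarrow> norm (\<Phi> v t (x, 0, 0)) \<le> B"
        unfolding bounded_pos by fastforce
      obtain W where "continuous_on (?I \<times> cball x0 r) (\<lambda>(t, x). W t x)"
        "\<And>t x. t \<in> ?I \<Longrightarrow> x \<in> cball x0 r \<Longrightarrow> norm (W t x) \<le> 2 * B"
        "\<And>t x. t \<in> ?I \<Longrightarrow> x \<in> cball x0 r \<Longrightarrow> W t x = \<Phi> v t (x, time_integral W t x, W t x)"
      proof (rule picard_fixed_point[of "cball x0 r" "2 * B" "\<Phi> v"])
        show "continuous_on (?I \<times> (cball x0 r \<times> cball 0 (2 * B) \<times> cball 0 (2 * B))) (\<lambda>(t, p). \<Phi> v t p)"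
          by (rule continuous_on_subset[OF c]) (use r in auto)
      qed (use B r \<Phi>lip in auto)
      then show ?thesis by blast
    qed
    then obtain W where W: "\<And>v. continuous_on (?I \<times> cball x0 r) (\<lambda>(t, x). W v t x)"
      "\<And>v t x. t \<in> ?I \<Longrightarrow> x \<in> cball x0 r \<Longrightarrow> W v t x = \<Phi> v t (x, time_integral (W v) t x, W v t x)"
      by metis
    show ?thesis
    proof (intro exI[of _ r] exI[of _ W] conjI allI ballI)
      show "continuous_on (?I \<times> ball x0 r) (\<lambda>(t, x). W v t x)" for v
        by (rule continuous_on_subset[OF W(1)]) auto
    qed (use r W(2) in auto)
  qed
  have main: "V t differentiable (at x) \<and> (\<exists>r>0. continuous_on (?I \<times> (N \<inter> ball x r))
        (\<lambda>(t, x). fderiv (V t) x v)) \<and>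
      fderiv (V t) x v =
        \<Phi> v t (x, time_integral (\<lambda>t x. fderiv (V t) x v) t x, fderiv (V t) x v)"
    if t: "t \<in> ?I" and x: "x \<in> N" for t x v
  proof -
    obtain r W where r: "r > 0" "ball x r \<subseteq> N" and W: "\<And>v. continuous_on (?I \<times> ball x r) (\<lambda>(t, x). W v t x)"
      "\<And>v t y. t \<in> ?I \<Longrightarrow> y \<in> ball x r \<Longrightarrow> W v t y = \<Phi> v t (y, time_integral (W v) t y, W v t y)"
      using loc[OF x] by blast
    let ?U = "\<lambda>v t x. \<Sum>i\<in>Basis. (v \<bullet> i) *\<^sub>R W i t x"
    have *: "(V s has_derivative (\<lambda>v. ?U v s y)) (at y)"
        "?U v s y = ?D s (?p s y) (v, time_integral (?U v) s y, ?U v s y)"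
      if "s \<in> ?I" "y \<in> ball x r" for s y v
    proof -
      have y: "y \<in> N" using that r by auto
      show "(V s has_derivative (\<lambda>v. ?U v s y)) (at y)"
        "?U v s y = ?D s (?p s y) (v, time_integral (?U v) s y, ?U v s y)"
        by (rule fixed_point_has_derivative[OF N D \<Psi>1 contr V VD Veq y that(1) open_ball that(2) W(1)];
          use W(2) that(2) in \<open>simp add: \<Phi>_def\<close>)+
    qed
    have fd: "fderiv (V s) y v = ?U v s y" if "s \<in> ?I" "y \<in> ball x r" for s y v
      using frechet_derivative_at[OF *(1)[OF that]] by metis
    have cU: "continuous_on (?I \<times> ball x r) (\<lambda>(t, x). ?U v t x)"
      using W(1) by (auto simp: split_beta intro!: continuous_intros)
    have "continuous_on (?I \<times> (N \<inter> ball x r)) (\<lambda>(t, x). fderiv (V t) x v)"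
      by (rule continuous_on_eq[OF continuous_on_subset[OF cU]]) (auto simp: fd)
    moreover have "time_integral (\<lambda>t x. fderiv (V t) x v) t x = time_integral (?U v) t x"
      unfolding time_integral_def by (rule integral_cong) (use t r fd in auto)
    ultimately show ?thesis
      using *[OF t, of x] r(1) fd[OF t, of x] by (auto simp: \<Phi>_def differentiable_def)
  qed
  have cont: "continuous_on (?I \<times> N) (\<lambda>(t, x). fderiv (V t) x v)" for v
    by (rule continuous_on_Times_localI) (use main[of 0] in auto)
  have "param_Ck_on k ?I N (\<lambda>t x. fderiv (V t) x v)" for v
  proof (rule Suc.IH[OF NU \<Phi>[of v] _ cont])
    show "fderiv (V t) x v =
        \<Phi> v t (x, time_integral (\<lambda>t x. fderiv (V t) x v) t x, fderiv (V t) x v)"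
      if "t \<in> ?I" "x \<in> N" for t x
      using main[OF that, of v] by blast
  qed (use \<Phi>lip in auto)
  then show ?case using V main by auto
qed

section \<open>The inverse function theorem\<close>

definition param_smooth_on :: "real set \<Rightarrow> 'a::euclidean_space set \<Rightarrow>
    (real \<Rightarrow> 'a \<Rightarrow> 'b::real_normed_vector) \<Rightarrow> bool"
  where "param_smooth_on T S f \<longleftrightarrow> (\<forall>k. param_Ck_on k T S f)"

lemma smooth_on_iff_param: "smooth_on S f \<longleftrightarrow> param_smooth_on {0} S (\<lambda>_. f)"
  by (simp add: smooth_on_def param_smooth_on_def Ck_on_iff_param)

lemma param_smooth_on_cong:
  "open S \<Longrightarrow> param_smooth_on T S f \<Longrightarrow> (\<And>t x. t \<in> T \<Longrightarrow> x \<in> S \<Longrightarrow> f t x = g t x) \<Longrightarrow> param_smooth_on T S g"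
  unfolding param_smooth_on_def using param_Ck_on_cong by metis

lemma param_smooth_on_subset:
  "param_smooth_on T S f \<Longrightarrow> T' \<subseteq> T \<Longrightarrow> S' \<subseteq> S \<Longrightarrow> param_smooth_on T' S' f"
  unfolding param_smooth_on_def by (rule allI, rule param_Ck_on_subset) auto

lemma param_smooth_on_time:
  "open S \<Longrightarrow> continuous_on T c \<Longrightarrow> param_smooth_on T S (\<lambda>t x. c t)"
  unfolding param_smooth_on_def by (rule allI, rule param_Ck_on_time) auto

lemma param_smooth_on_const: "open S \<Longrightarrow> param_smooth_on T S (\<lambda>t x. c)"
  unfolding param_smooth_on_def by (rule allI, rule param_Ck_on_const) auto

lemma param_smooth_on_linear:
  "bounded_linear L \<Longrightarrow> open S \<Longrightarrow> param_smooth_on T S f \<Longrightarrow> param_smooth_on T S (\<lambda>t x. L (f t x))"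
  unfolding param_smooth_on_def by (rule allI, rule param_Ck_on_linear) auto

lemma param_smooth_on_id:
  "open S \<Longrightarrow> bounded_linear L \<Longrightarrow> param_smooth_on T S (\<lambda>t. L)"
  unfolding param_smooth_on_def by (rule allI, rule param_Ck_on_id) auto

lemma param_smooth_on_add:
  "open S \<Longrightarrow> param_smooth_on T S f \<Longrightarrow> param_smooth_on T S g \<Longrightarrow> param_smooth_on T S (\<lambda>t x. f t x + g t x)"
  unfolding param_smooth_on_def by (rule allI, rule param_Ck_on_add) auto

lemma param_smooth_on_diff:
  "open S \<Longrightarrow> param_smooth_on T S f \<Longrightarrow> param_smooth_on T S g \<Longrightarrow> param_smooth_on T S (\<lambda>t x. f t x - g t x)"
  unfolding param_smooth_on_def by (rule allI, rule param_Ck_on_diff) auto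

lemma param_smooth_on_sum:
  "open S \<Longrightarrow> (\<And>i. i \<in> I \<Longrightarrow> param_smooth_on T S (f i)) \<Longrightarrow> param_smooth_on T S (\<lambda>t x. \<Sum>i\<in>I. f i t x)"
  unfolding param_smooth_on_def by (rule allI, rule param_Ck_on_sum) auto

lemma param_smooth_on_bilinear:
  "bounded_bilinear B \<Longrightarrow> open S \<Longrightarrow> param_smooth_on T S f \<Longrightarrow> param_smooth_on T S g \<Longrightarrow>
    param_smooth_on T S (\<lambda>t x. B (f t x) (g t x))"
  unfolding param_smooth_on_def by (rule allI, rule param_Ck_on_bilinear) auto

lemma param_smooth_on_compose:
  fixes g :: "real \<Rightarrow> 'c::euclidean_space \<Rightarrow> 'b::real_normed_vector"
    and h :: "real \<Rightarrow> 'a::euclidean_space \<Rightarrow> 'c"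
  shows "open S \<Longrightarrow> param_smooth_on T D g \<Longrightarrow> param_smooth_on T S h \<Longrightarrow>
    (\<And>t x. t \<in> T \<Longrightarrow> x \<in> S \<Longrightarrow> h t x \<in> D) \<Longrightarrow> param_smooth_on T S (\<lambda>t x. g t (h t x))"
  unfolding param_smooth_on_def by (rule allI, rule param_Ck_on_compose) auto

lemma param_smooth_on_time_integral:
  "open S \<Longrightarrow> param_smooth_on {0..1} S V \<Longrightarrow> param_smooth_on {0..1} S (time_integral V)"
  unfolding param_smooth_on_def by (rule allI, rule param_Ck_on_time_integral) auto

lemma param_smooth_on_blinfun:
  fixes f :: "real \<Rightarrow> 'a::euclidean_space \<Rightarrow> 'c::euclidean_space \<Rightarrow> 'b::euclidean_space"
  shows "open S \<Longrightarrow> (\<And>i. i \<in> Basis \<Longrightarrow> param_smooth_on T S (\<lambda>t x. f t x i)) \<Longrightarrow>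
    (\<And>t x. t \<in> T \<Longrightarrow> x \<in> S \<Longrightarrow> linear (f t x)) \<Longrightarrow> param_smooth_on T S (\<lambda>t x. Blinfun (f t x))"
  unfolding param_smooth_on_def by (rule allI, rule param_Ck_on_blinfun) auto

lemma param_Ck_on_of_Ck_on: "Ck_on k S f \<Longrightarrow> param_Ck_on k T S (\<lambda>_. f)"
proof (induction k arbitrary: f)
  case 0
  then show ?case by (simp add: continuous_on_ignore_time)
next
  case (Suc k)
  then have "continuous_on S f"
    by (simp add: continuous_at_imp_continuous_on differentiable_imp_continuous_within)
  then show ?case using Suc by (auto simp: continuous_on_ignore_time)
qed

lemma param_smooth_on_of_smooth_on: "smooth_on S f \<Longrightarrow> param_smooth_on T S (\<lambda>_. f)"
  by (simp add: smooth_on_def param_smooth_on_def param_Ck_on_of_Ck_on)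

lemma smooth_on_time_slice:
  assumes "param_smooth_on T S f" "t \<in> T"
  shows "smooth_on S (f t)"
proof -
  have "Ck_on k S (f t)" if "param_Ck_on k T S f" for k and f :: "real \<Rightarrow> 'a \<Rightarrow> 'b"
    using that
  proof (induction k arbitrary: f)
    case 0
    then have c: "continuous_on (T \<times> S) (\<lambda>(t, x). f t x)" by simp
    have "continuous_on S (\<lambda>x. (\<lambda>(t, x). f t x) (t, x))"
      by (rule continuous_on_compose2[OF c]) (use assms(2) in \<open>auto intro!: continuous_intros\<close>)
    then show ?case by simp
  next
    case (Suc k)
    have "Ck_on k S (\<lambda>x. fderiv (f t) x v)" for v
      using Suc.IH[of "\<lambda>t x. fderiv (f t) x v"] Suc.prems by simp
    then show ?case using Suc.prems assms(2) by simp
  qed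
  then show ?thesis using assms(1) by (simp add: param_smooth_on_def smooth_on_def)
qed

lemma smooth_on_compose:
  fixes g :: "'c::euclidean_space \<Rightarrow> 'b::real_normed_vector" and h :: "'a::euclidean_space \<Rightarrow> 'c"
  assumes "open S" "smooth_on D g" "smooth_on S h" "\<And>x. x \<in> S \<Longrightarrow> h x \<in> D"
  shows "smooth_on S (\<lambda>x. g (h x))"
  using param_smooth_on_compose[OF assms(1), of "{0}" D "\<lambda>_. g" "\<lambda>_. h"] assms
  by (simp add: smooth_on_iff_param)

lemma smooth_on_cong: "open S \<Longrightarrow> smooth_on S f \<Longrightarrow> (\<And>x. x \<in> S \<Longrightarrow> f x = g x) \<Longrightarrow> smooth_on S g"
  unfolding smooth_on_iff_param using param_smooth_on_cong by metis

lemma smooth_on_subset: "smooth_on S f \<Longrightarrow> S' \<subseteq> S \<Longrightarrow> smooth_on S' f"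
  unfolding smooth_on_iff_param using param_smooth_on_subset by blast

lemma smooth_on_const: "open S \<Longrightarrow> smooth_on S (\<lambda>x. c)"
  unfolding smooth_on_iff_param by (rule param_smooth_on_const)

lemma smooth_on_linear_map: "open S \<Longrightarrow> bounded_linear L \<Longrightarrow> smooth_on S L"
  unfolding smooth_on_iff_param by (rule param_smooth_on_id)

lemma smooth_on_linear: "bounded_linear L \<Longrightarrow> open S \<Longrightarrow> smooth_on S f \<Longrightarrow> smooth_on S (\<lambda>x. L (f x))"
  unfolding smooth_on_iff_param by (rule param_smooth_on_linear)

lemma smooth_on_add: "open S \<Longrightarrow> smooth_on S f \<Longrightarrow> smooth_on S g \<Longrightarrow> smooth_on S (\<lambda>x. f x + g x)"
  unfolding smooth_on_iff_param by (rule param_smooth_on_add)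

lemma smooth_on_diff: "open S \<Longrightarrow> smooth_on S f \<Longrightarrow> smooth_on S g \<Longrightarrow> smooth_on S (\<lambda>x. f x - g x)"
  unfolding smooth_on_iff_param by (rule param_smooth_on_diff)

lemma smooth_on_sum:
  "open S \<Longrightarrow> (\<And>i. i \<in> I \<Longrightarrow> smooth_on S (f i)) \<Longrightarrow> smooth_on S (\<lambda>x. \<Sum>i\<in>I. f i x)"
  unfolding smooth_on_iff_param by (rule param_smooth_on_sum)

lemma smooth_on_imp_continuous: "smooth_on S f \<Longrightarrow> continuous_on S f"
  unfolding smooth_on_def by (metis Ck_on.simps(1))

lemma smooth_on_has_derivative:
  "smooth_on S f \<Longrightarrow> x \<in> S \<Longrightarrow> (f has_derivative fderiv f x) (at x)"
  unfolding smooth_on_def by (metis Ck_on.simps(2) frechet_derivative_works)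

lemma param_smooth_on_has_derivative:
  "param_smooth_on T S f \<Longrightarrow> t \<in> T \<Longrightarrow> x \<in> S \<Longrightarrow>
    (f t has_derivative fderiv (f t) x) (at x)"
  by (meson smooth_on_time_slice smooth_on_has_derivative)

text \<open>If \<open>\<Psi> t\<close> vanishes at the origin and its derivative there involves the first argument only, then the
  contraction bound holds automatically near the origin. The solution vanishes
  at \<open>x = 0\<close>, and its derivative there can be read off from that of \<open>\<Psi>\<close>.\<close>

lemma smooth_fixed_point_near_0:
  fixes \<Psi> :: "real \<Rightarrow> 'a::euclidean_space \<times> 'b::euclidean_space \<times> 'b \<Rightarrow> 'b"
  assumes D: "open D" "0 \<in> D" and \<Psi>: "param_smooth_on {0..1} D \<Psi>"
    and \<Psi>0: "\<And>t. t \<in> {0..1} \<Longrightarrow> \<Psi> t 0 = 0"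
    and d\<Psi>0: "\<And>t. t \<in> {0..1} \<Longrightarrow> (\<Psi> t has_derivative (\<lambda>p. L t (fst p))) (at 0)"
  obtains \<delta> V where "\<delta> > 0" "param_smooth_on {0..1} (ball 0 \<delta>) V"
    "\<And>t x. t \<in> {0..1} \<Longrightarrow> x \<in> ball 0 \<delta> \<Longrightarrow> (x, time_integral V t x, V t x) \<in> D"
    "\<And>t x. t \<in> {0..1} \<Longrightarrow> x \<in> ball 0 \<delta> \<Longrightarrow> V t x = \<Psi> t (x, time_integral V t x, V t x)"
    "\<And>t. t \<in> {0..1} \<Longrightarrow> V t 0 = 0"
    "\<And>t. t \<in> {0..1} \<Longrightarrow> (V t has_derivative L t) (at 0)"
proof -
  let ?I = "{0..1::real}"
  have \<Psi>1: "param_Ck_on (Suc 0) ?I D \<Psi>" using \<Psi> by (simp only: param_smooth_on_def)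
  note E = param_Ck_on_SucD[OF \<Psi>1]
  let ?D = "\<lambda>t q. fderiv (\<Psi> t) q"
  have lin: "bounded_linear (?D t q)" if "t \<in> ?I" "q \<in> D" for t q
    using E(1)[OF that] has_derivative_bounded_linear by blast
  have D0: "?D t 0 = (\<lambda>p. L t (fst p))" if "t \<in> ?I" for t
    using frechet_derivative_at[OF d\<Psi>0[OF that]] by simp
  have zD: "(\<lambda>_. 0) ` ?I \<subseteq> D" using D by auto
  have "param_Ck_on 0 ?I D (\<lambda>t q. Blinfun (?D t q))"
    by (rule param_Ck_on_blinfun[OF D(1) E(2)]) (use lin bounded_linear.linear in blast)
  then have cB: "continuous_on (?I \<times> D) (\<lambda>(t, q). Blinfun (?D t q))" by simp
  obtain d where d: "d > 0" "\<And>t q. t \<in> ?I \<Longrightarrow> dist q 0 < d \<Longrightarrow>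
      q \<in> D \<and> dist (Blinfun (?D t q)) (Blinfun (?D t 0)) < 1/4"
    by (rule uniformly_close_along_curve[OF compact_Icc D(1) continuous_on_const zD cB, of "1/4"])
      (simp, rule that)
  have "L t 0 = 0" if "t \<in> ?I" for t
    using linear_0[OF has_derivative_linear[OF d\<Psi>0[OF that]]] by simp
  have lip: "norm (\<Psi> t (x, y, w) - \<Psi> t (x, y', w')) \<le> (norm (y - y') + norm (w - w')) / 4"
    if t: "t \<in> ?I" and p: "(x, y, w) \<in> ball 0 d" "(x, y', w') \<in> ball 0 d" for t x y w y' w'
  proof -
    let ?S = "Pair x -` ball 0 d :: ('b \<times> 'b) set"
    have "norm (\<Psi> t (x, (y, w)) - \<Psi> t (x, (y', w'))) \<le> 1/4 * norm ((y, w) - (y', w'))"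
    proof (rule differentiable_bound[where S="?S" and f'="\<lambda>q u. ?D t (x, q) (0, u)"
          and f="\<lambda>q. \<Psi> t (x, q)"])
      show "convex ?S"
      proof (rule convexI)
        fix p q and u v :: real assume "p \<in> ?S" "q \<in> ?S" "0 \<le> u" "0 \<le> v" "u + v = 1"
        then have "u *\<^sub>R (x, p) + v *\<^sub>R (x, q) \<in> ball 0 d"
          using convexD[OF convex_ball, of "(x, p)" 0 d "(x, q)" u v] by simp
        moreover have "u *\<^sub>R (x, p) + v *\<^sub>R (x, q) = (x, u *\<^sub>R p + v *\<^sub>R q)"
          using \<open>u + v = 1\<close> by (simp add: scaleR_add_left[symmetric])
        ultimately show "u *\<^sub>R p + v *\<^sub>R q \<in> ?S" by simp
      qed
      fix q assume "q \<in> ?S"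
      then have q: "(x, q) \<in> D" "dist (Blinfun (?D t (x, q))) (Blinfun (?D t 0)) < 1/4"
        using d(2)[OF t, of "(x, q)"] by (auto simp: dist_commute)
      have "((\<lambda>q. (x, q)) has_derivative (\<lambda>u. (0, u))) (at q within ?S)"
        by (auto intro!: derivative_eq_intros)
      from has_derivative_compose[OF this E(1)[OF t q(1)]]
      show "((\<lambda>q. \<Psi> t (x, q)) has_derivative (\<lambda>u. ?D t (x, q) (0, u))) (at q within ?S)" .
      show "onorm (\<lambda>u. ?D t (x, q) (0, u)) \<le> 1/4"
      proof (rule onorm_le)
        fix u :: "'b \<times> 'b"
        have "?D t (x, q) (0, u) = blinfun_apply (Blinfun (?D t (x, q)) - Blinfun (?D t 0)) (0, u)"
          using lin[OF t q(1)] lin[OF t D(2)] D0[OF t] \<open>t \<in> ?I \<Longrightarrow> L t 0 = 0\<close> t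
          by (simp add: bounded_linear_Blinfun_apply blinfun.diff_left)
        also have "norm \<dots> \<le> norm (Blinfun (?D t (x, q)) - Blinfun (?D t 0)) * norm (0 :: 'a, u)"
          by (rule norm_blinfun)
        also have "\<dots> \<le> 1/4 * norm u"
          using q(2) by (intro mult_mono) (auto simp: dist_norm norm_Pair)
        finally show "norm (?D t (x, q) (0, u)) \<le> 1/4 * norm u" .
      qed
    qed (use p in auto)
    also have "norm ((y, w) - (y', w')) \<le> norm (y - y') + norm (w - w')"
      using norm_Pair_le[of "y - y'" "w - w'"] by simp
    finally show ?thesis by simp
  qed
  define \<rho> where "\<rho> = d / 4"
  have \<rho>: "\<rho> > 0" using d by (simp add: \<rho>_def)
  obtain d' where d': "d' > 0" "\<And>t q. t \<in> ?I \<Longrightarrow> dist q 0 < d' \<Longrightarrow> q \<in> D \<and> dist (\<Psi> t q) (\<Psi> t 0) < \<rho> / 2"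
    by (rule uniformly_close_along_curve[OF compact_Icc D(1) continuous_on_const zD E(3), of "\<rho> / 2"])
      (use \<rho> in simp, rule that)
  define \<delta> where "\<delta> = min d' (d / 4)"
  have \<delta>: "\<delta> > 0" "\<delta> \<le> d'" "\<delta> \<le> d / 4" using d d' by (auto simp: \<delta>_def)
  have box: "(x, y, w) \<in> ball 0 d" if "norm x < d / 4" "norm y \<le> \<rho>" "norm w \<le> \<rho>" for x :: 'a and y w :: 'b
  proof -
    have "norm (x, y, w) \<le> norm x + (norm y + norm w)"
      using norm_Pair_le[of x "(y, w)"] norm_Pair_le[of y w] by linarith
    also have "\<dots> < d / 4 + (d / 4 + d / 4)" using that by (simp add: \<rho>_def)
    also have "\<dots> \<le> d" using d by simp
    finally show ?thesis by simp
  qed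
  have ballD: "ball 0 d \<subseteq> D" using d(2)[of 0] by auto
  obtain V where V: "continuous_on (?I \<times> ball 0 \<delta>) (\<lambda>(t, x). V t x)"
    "\<And>t x. t \<in> ?I \<Longrightarrow> x \<in> ball 0 \<delta> \<Longrightarrow> norm (V t x) \<le> \<rho>"
    "\<And>t x. t \<in> ?I \<Longrightarrow> x \<in> ball 0 \<delta> \<Longrightarrow> V t x = \<Psi> t (x, time_integral V t x, V t x)"
  proof (rule picard_fixed_point[of "ball 0 \<delta>" \<rho> \<Psi>])
    show "continuous_on (?I \<times> (ball 0 \<delta> \<times> cball 0 \<rho> \<times> cball 0 \<rho>)) (\<lambda>(t, p). \<Psi> t p)"
      by (rule continuous_on_subset[OF E(3)]) (use box \<delta> ballD in auto)
    show "norm (\<Psi> t (x, 0, 0)) \<le> \<rho> / 2" if "t \<in> ?I" "x \<in> ball 0 \<delta>" for t x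
      using d'(2)[OF that(1), of "(x, 0, 0)"] that \<delta> \<Psi>0[OF that(1)] by (simp add: norm_Pair)
    show "norm (\<Psi> t (x, y, w) - \<Psi> t (x, y', w')) \<le> (norm (y - y') + norm (w - w')) / 4"
      if "t \<in> ?I" "x \<in> ball 0 \<delta>" "{y, w, y', w'} \<subseteq> cball 0 \<rho>" for t x y w y' w'
      by (rule lip) (use that box \<delta> in auto)
  qed (use \<rho> in auto)
  have TV: "norm (time_integral V t x) \<le> \<rho>" if "t \<in> ?I" "x \<in> ball 0 \<delta>" for t x
    using time_integral_le[OF V(1) that(2,1)] V(2) that(2) by auto
  have Vd: "(x, time_integral V t x, V t x) \<in> ball 0 d" if "t \<in> ?I" "x \<in> ball 0 \<delta>" for t x
    by (rule box) (use that V(2) TV \<delta> in auto)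
  have sm: "param_smooth_on ?I (ball 0 \<delta>) V"
    unfolding param_smooth_on_def
  proof
    fix k
    have "param_Ck_on k ?I (ball 0 d) \<Psi>"
      using \<Psi> ballD param_Ck_on_subset unfolding param_smooth_on_def by blast
    then show "param_Ck_on k ?I (ball 0 \<delta>) V"
      by (rule fixed_point_param_Ck[OF open_ball open_ball _ lip V(1) Vd V(3)])
  qed
  have z: "(0::'a) \<in> ball 0 \<delta>" using \<delta> by simp
  have V0: "V t 0 = 0" if t: "t \<in> ?I" for t
  proof -
    have cV0: "continuous_on ?I (\<lambda>t. V t 0)" by (rule continuous_on_time_slice[OF V(1) z])
    obtain s where s: "s \<in> ?I" "\<And>t. t \<in> ?I \<Longrightarrow> norm (V t 0) \<le> norm (V s 0)"
      using continuous_attains_sup[OF compact_Icc _ continuous_on_norm[OF cV0]] by auto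
    have "norm (time_integral V s 0) \<le> norm (V s 0)"
      by (rule time_integral_le[OF V(1) z s(1)]) (use s in auto)
    moreover have "norm (V s 0) \<le> (norm (time_integral V s 0) + norm (V s 0)) / 4"
      using lip[OF s(1) Vd[OF s(1) z], of 0 0] V(3)[OF s(1) z] \<Psi>0[OF s(1)] d(1)
      by (simp add: zero_prod_def[symmetric])
    then have "4 * norm (V s 0) \<le> norm (time_integral V s 0) + norm (V s 0)" by simp
    ultimately have "norm (V s 0) \<le> 0" using norm_ge_zero[of "V s 0"] by linarith
    then show ?thesis using s(2)[OF t] by simp
  qed
  have ti0: "time_integral V t 0 = 0" if "t \<in> ?I" for t
    unfolding time_integral_def using that by (subst integral_cong[where g="\<lambda>_. 0"]) (auto simp: V0)
  have "(V t has_derivative L t) (at 0)" if t: "t \<in> ?I" for t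
  proof -
    have dV: "(V t has_derivative fderiv (V t) 0) (at 0)"
      by (rule param_smooth_on_has_derivative[OF sm t z])
    have dT: "(time_integral V t has_derivative fderiv (time_integral V t) 0) (at 0)"
      by (rule param_smooth_on_has_derivative[OF param_smooth_on_time_integral[OF open_ball sm] t z])
    have "((\<lambda>x. (x, time_integral V t x, V t x)) has_derivative
      (\<lambda>v. (v, fderiv (time_integral V t) 0 v, fderiv (V t) 0 v))) (at 0)"
      by (intro has_derivative_Pair has_derivative_ident dV dT)
    from has_derivative_compose[OF this, of "\<Psi> t" "\<lambda>p. L t (fst p)"] d\<Psi>0[OF t] V0[OF t] ti0[OF t]
    have "((\<lambda>x. \<Psi> t (x, time_integral V t x, V t x)) has_derivative L t) (at 0)"
      by (simp add: zero_prod_def[symmetric])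
    then show ?thesis
      by (rule has_derivative_transform_within_open[OF _ open_ball z]) (use V(3)[OF t] in auto)
  qed
  then show thesis using that[OF \<delta>(1) sm _ V(3) V0] Vd ballD by blast
qed

text \<open>\<open>\<Phi> w = y\<close> is the fixed point equation \<open>w = y + (w - \<Phi> w)\<close>, in which \<open>w - \<Phi> w\<close> has derivative zero.\<close>

lemma smooth_right_inverse_near_0:
  fixes \<Phi> :: "'a::euclidean_space \<Rightarrow> 'a"
  assumes S: "open S" "0 \<in> S" and \<Phi>: "smooth_on S \<Phi>" and "\<Phi> 0 = 0"
    and d\<Phi>: "(\<Phi> has_derivative (\<lambda>v. v)) (at 0)"
  obtains \<delta> G where "\<delta> > 0" "smooth_on (ball 0 \<delta>) G" "\<And>y. y \<in> ball 0 \<delta> \<Longrightarrow> G y \<in> S \<and> \<Phi> (G y) = y"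
    "G 0 = 0" "(G has_derivative (\<lambda>v. v)) (at 0)"
proof -
  define \<Psi> :: "real \<Rightarrow> 'a \<times> 'a \<times> 'a \<Rightarrow> 'a" where "\<Psi> t p = fst p + (snd (snd p) - \<Phi> (snd (snd p)))" for t p
  have o: "open (UNIV \<times> UNIV \<times> S :: ('a \<times> 'a \<times> 'a) set)" using S by (simp add: open_Times)
  have bl: "bounded_linear (\<lambda>p :: 'a \<times> 'a \<times> 'a. snd (snd p))"
    by (rule bounded_linear_compose[OF bounded_linear_snd bounded_linear_snd])
  obtain \<delta> V where V: "\<delta> > 0" "param_smooth_on {0..1} (ball 0 \<delta>) V"
    "\<And>t x. t \<in> {0..1} \<Longrightarrow> x \<in> ball 0 \<delta> \<Longrightarrow> (x, time_integral V t x, V t x) \<in> (UNIV \<times> UNIV \<times> S :: ('a \<times> 'a \<times> 'a) set)"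
    "\<And>t x. t \<in> {0..1} \<Longrightarrow> x \<in> ball 0 \<delta> \<Longrightarrow> V t x = \<Psi> t (x, time_integral V t x, V t x)"
    "\<And>t. t \<in> {0..1} \<Longrightarrow> V t 0 = 0"
    "\<And>t. t \<in> {0..1} \<Longrightarrow> (V t has_derivative (\<lambda>v. v)) (at 0)"
  proof (rule smooth_fixed_point_near_0[OF o])
    show "param_smooth_on {0..1} (UNIV \<times> UNIV \<times> S) \<Psi>"
      unfolding \<Psi>_def
      by (intro param_smooth_on_add[OF o] param_smooth_on_diff[OF o] param_smooth_on_id[OF o] bl bounded_linear_fst
          param_smooth_on_compose[OF o param_smooth_on_of_smooth_on[OF \<Phi>] param_smooth_on_id[OF o bl]]) auto
    fix t :: real
    have "((\<lambda>p :: 'a \<times> 'a \<times> 'a. \<Phi> (snd (snd p))) has_derivative (\<lambda>p. snd (snd p))) (at 0)"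
      by (rule has_derivative_compose[of "\<lambda>p. snd (snd p)" "\<lambda>p. snd (snd p)"])
        (use d\<Phi> in \<open>auto intro!: derivative_eq_intros\<close>)
    then show "(\<Psi> t has_derivative (\<lambda>p. fst p)) (at 0)"
      unfolding \<Psi>_def by (auto intro!: derivative_eq_intros)
  qed (use S \<open>\<Phi> 0 = 0\<close> in \<open>auto simp: \<Psi>_def mem_Times_iff\<close>)
  show thesis
  proof (rule that[of \<delta> "V 0"])
    show "smooth_on (ball 0 \<delta>) (V 0)" by (rule smooth_on_time_slice[OF V(2)]) simp
    show "V 0 y \<in> S \<and> \<Phi> (V 0 y) = y" if "y \<in> ball 0 \<delta>" for y
      using V(3)[OF _ that, of 0] V(4)[OF _ that, of 0] by (simp add: \<Psi>_def)
  qed (use V in auto)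
qed

text \<open>A right inverse \<open>G\<close> of \<open>\<Phi>\<close> has itself a right inverse \<open>H\<close>; then \<open>H = \<Phi> \<circ> G \<circ> H = \<Phi>\<close>, so \<open>G\<close> is a
  two-sided inverse. This gives injectivity of \<open>\<Phi>\<close> and openness of its image
  without further estimates.\<close>

lemma smooth_local_inverse_near_0:
  fixes \<Phi> :: "'a::euclidean_space \<Rightarrow> 'a"
  assumes S: "open S" "0 \<in> S" and \<Phi>: "smooth_on S \<Phi>" and \<Phi>0: "\<Phi> 0 = 0"
    and d\<Phi>: "(\<Phi> has_derivative (\<lambda>v. v)) (at 0)"
  obtains N G where "open N" "0 \<in> N" "N \<subseteq> S" "open (\<Phi> ` N)" "smooth_on (\<Phi> ` N) G"
    "\<And>x. x \<in> N \<Longrightarrow> G (\<Phi> x) = x"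
proof -
  obtain \<delta> G where G: "\<delta> > 0" "smooth_on (ball 0 \<delta>) G" "\<And>y. y \<in> ball 0 \<delta> \<Longrightarrow> G y \<in> S \<and> \<Phi> (G y) = y"
    "G 0 = 0" "(G has_derivative (\<lambda>v. v)) (at 0)"
    using smooth_right_inverse_near_0[OF assms] by blast
  obtain \<delta>' H where H: "\<delta>' > 0" "smooth_on (ball 0 \<delta>') H"
    "\<And>y. y \<in> ball 0 \<delta>' \<Longrightarrow> H y \<in> ball 0 \<delta> \<and> G (H y) = y" "H 0 = 0"
    using smooth_right_inverse_near_0[OF open_ball _ G(2,4,5)] G(1) by (metis centre_in_ball)
  define N where "N = ball 0 \<delta>' \<inter> S"
  have HN: "\<Phi> x = H x" if "x \<in> N" for x
    using G(3)[of "H x"] H(3)[of x] that by (auto simp: N_def)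
  have img: "\<Phi> ` N = G -` N \<inter> ball 0 \<delta>"
  proof (intro equalityI subsetI)
    fix y assume "y \<in> \<Phi> ` N"
    then obtain x where "x \<in> N" "y = \<Phi> x" by blast
    then show "y \<in> G -` N \<inter> ball 0 \<delta>" using HN[of x] H(3)[of x] by (auto simp: N_def)
  next
    fix y assume "y \<in> G -` N \<inter> ball 0 \<delta>"
    then show "y \<in> \<Phi> ` N" using G(3)[of y] by (auto intro!: image_eqI[of _ _ "G y"])
  qed
  show thesis
  proof (rule that[of N G])
    show "open N" using S by (simp add: N_def open_Int)
    then show "open (\<Phi> ` N)"
      unfolding img using smooth_on_imp_continuous[OF G(2)] continuous_on_open_vimage[OF open_ball] by blast
    show "smooth_on (\<Phi> ` N) G" by (rule smooth_on_subset[OF G(2)]) (auto simp: img)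
    show "G (\<Phi> x) = x" if "x \<in> N" for x using HN[OF that] H(3)[of x] that by (simp add: N_def)
  qed (use S H(1) in \<open>auto simp: N_def\<close>)
qed

text \<open>The inverse function theorem, reduced by affine changes of coordinates to the case where the point
  is the origin and the derivative the identity.\<close>

theorem smooth_local_inverse:
  fixes \<Phi> :: "'a::euclidean_space \<Rightarrow> 'a"
  assumes S: "open S" "x0 \<in> S" and \<Phi>: "smooth_on S \<Phi>"
    and d\<Phi>: "(\<Phi> has_derivative L) (at x0)" and "inj L"
  obtains N G where "open N" "x0 \<in> N" "N \<subseteq> S" "open (\<Phi> ` N)" "smooth_on (\<Phi> ` N) G"
    "\<And>x. x \<in> N \<Longrightarrow> G (\<Phi> x) = x"
proof -
  have "linear L" using d\<Phi> has_derivative_linear by blast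
  then obtain M where M: "linear M" "\<And>x. L (M x) = x" "\<And>x. M (L x) = x"
    using linear_injective_isomorphism[OF _ \<open>inj L\<close>] by blast
  have Mb: "bounded_linear M" using M(1) linear_conv_bounded_linear by blast
  have Lb: "bounded_linear L" using \<open>linear L\<close> linear_conv_bounded_linear by blast
  define \<Phi>' where "\<Phi>' x = M (\<Phi> (x0 + x) - \<Phi> x0)" for x
  define S' where "S' = (\<lambda>x. x0 + x) -` S"
  have S': "open S'" "0 \<in> S'"
    using S open_vimage[OF S(1), of "\<lambda>x. x0 + x"] by (auto simp: S'_def intro!: continuous_intros)
  have tr: "smooth_on S' (\<lambda>x. x0 + x)"
    by (intro smooth_on_add smooth_on_const S' smooth_on_linear_map bounded_linear_ident)
  have "smooth_on S' \<Phi>'"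
    unfolding \<Phi>'_def
    by (intro smooth_on_linear[OF Mb] smooth_on_diff smooth_on_const S' smooth_on_compose[OF S'(1) \<Phi> tr])
      (simp add: S'_def)
  moreover have "(\<Phi>' has_derivative (\<lambda>v. v)) (at 0)"
  proof -
    have "((\<lambda>x. \<Phi> (x0 + x)) has_derivative L) (at 0)"
      by (rule has_derivative_compose[of "\<lambda>x. x0 + x" "\<lambda>x. x", simplified])
        (use d\<Phi> in \<open>auto intro!: derivative_eq_intros\<close>)
    then have "((\<lambda>x. \<Phi> (x0 + x) - \<Phi> x0) has_derivative L) (at 0)" by (auto intro!: derivative_eq_intros)
    from bounded_linear.has_derivative[OF Mb this] show ?thesis unfolding \<Phi>'_def[abs_def] by (simp add: M)
  qed
  ultimately obtain N G where N: "open N" "0 \<in> N" "N \<subseteq> S'" "open (\<Phi>' ` N)" "smooth_on (\<Phi>' ` N) G"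
    "\<And>x. x \<in> N \<Longrightarrow> G (\<Phi>' x) = x"
    using smooth_local_inverse_near_0[OF S'] by (metis \<Phi>'_def M(1) add.right_neutral diff_self linear_0)
  define N' where "N' = (\<lambda>x. x - x0) -` N"
  define g where "g y = M (y - \<Phi> x0)" for y
  have gb: "g (\<Phi> x) = \<Phi>' (x - x0)" for x by (simp add: g_def \<Phi>'_def)
  have img: "\<Phi> ` N' = g -` (\<Phi>' ` N)"
  proof (intro equalityI subsetI)
    fix y assume "y \<in> \<Phi> ` N'"
    then show "y \<in> g -` (\<Phi>' ` N)" using gb by (auto simp: N'_def)
  next
    fix y assume "y \<in> g -` (\<Phi>' ` N)"
    then obtain x where x: "x \<in> N" "M (y - \<Phi> x0) = M (\<Phi> (x0 + x) - \<Phi> x0)" by (auto simp: g_def \<Phi>'_def)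
    from arg_cong[OF x(2), of L] have "y = \<Phi> (x0 + x)" by (simp add: M)
    then show "y \<in> \<Phi> ` N'" using x(1) by (auto simp: N'_def)
  qed
  have cg: "continuous_on UNIV g"
    unfolding g_def by (intro bounded_linear.continuous_on[OF Mb] continuous_intros)
  have sg: "smooth_on (\<Phi> ` N') g" if "open (\<Phi> ` N')"
    unfolding g_def by (intro smooth_on_linear[OF Mb] smooth_on_diff that smooth_on_const smooth_on_linear_map bounded_linear_ident)
  show thesis
  proof (rule that[of N' "\<lambda>y. x0 + G (g y)"])
    show "open N'" unfolding N'_def by (intro open_vimage N(1) continuous_intros)
    show o: "open (\<Phi> ` N')" unfolding img by (rule open_vimage[OF N(4) cg])
    show "smooth_on (\<Phi> ` N') (\<lambda>y. x0 + G (g y))"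
      by (intro smooth_on_add smooth_on_const o smooth_on_compose[OF o N(5) sg[OF o]]) (auto simp: img)
    show "N' \<subseteq> S"
    proof
      fix x assume "x \<in> N'"
      then have "x - x0 \<in> S'" using N(3) by (auto simp: N'_def)
      then show "x \<in> S" by (simp add: S'_def)
    qed
  qed (use N gb in \<open>auto simp: N'_def\<close>)
qed

section \<open>Poincare's lemma\<close>

lemma smooth_on_radial_vector_derivative:
  assumes "smooth_on S h" "s *\<^sub>R x \<in> S"
  shows "((\<lambda>s. h (s *\<^sub>R x)) has_vector_derivative fderiv h (s *\<^sub>R x) x) (at s within T)"
proof -
  have "((\<lambda>s. s *\<^sub>R x) has_derivative (\<lambda>r. r *\<^sub>R x)) (at s within T)"
    by (auto intro!: derivative_eq_intros)
  from has_derivative_compose[OF this smooth_on_has_derivative[OF assms]]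
  have "((\<lambda>s. h (s *\<^sub>R x)) has_derivative (\<lambda>r. fderiv h (s *\<^sub>R x) (r *\<^sub>R x))) (at s within T)" .
  then show ?thesis
    unfolding has_vector_derivative_def
    using linear_cmul[OF has_derivative_linear[OF smooth_on_has_derivative[OF assms]]] by simp
qed

lemma scaleR_unit_in_ball: "t \<in> {0..1} \<Longrightarrow> x \<in> ball 0 R \<Longrightarrow> t *\<^sub>R x \<in> ball (0::'a::real_normed_vector) R"
  using mult_right_mono[of t 1 "norm x"] by auto

lemma param_smooth_on_radial:
  fixes h :: "'a::euclidean_space \<Rightarrow> 'b::real_normed_vector"
  assumes h: "smooth_on (ball 0 R) h"
  shows "param_smooth_on {0..1} (ball 0 R) (\<lambda>s x. h (s *\<^sub>R x))"
proof (rule param_smooth_on_compose[OF open_ball param_smooth_on_of_smooth_on[OF h]])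
  show "param_smooth_on {0..1} (ball 0 R) (\<lambda>s x :: 'a. s *\<^sub>R x)"
    by (rule param_smooth_on_bilinear[OF bounded_bilinear_scaleR open_ball])
      (auto intro!: param_smooth_on_time param_smooth_on_id[OF open_ball bounded_linear_ident])
qed (rule scaleR_unit_in_ball)

lemma radial_has_derivative:
  assumes h: "smooth_on (ball 0 R) h" and "s \<in> {0..1}" "x \<in> ball 0 R"
  shows "((\<lambda>x. h (s *\<^sub>R x)) has_derivative (\<lambda>v. s *\<^sub>R fderiv h (s *\<^sub>R x) v)) (at x)"
proof -
  have hd: "(h has_derivative fderiv h (s *\<^sub>R x)) (at (s *\<^sub>R x))"
    by (rule smooth_on_has_derivative[OF h scaleR_unit_in_ball[OF assms(2,3)]])
  have "((\<lambda>x. s *\<^sub>R x) has_derivative (\<lambda>v. s *\<^sub>R v)) (at x)"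
    by (auto intro!: derivative_eq_intros)
  from has_derivative_compose[OF this hd] show ?thesis
    using linear_cmul[OF has_derivative_linear[OF hd]] by simp
qed


text \<open>The potential is \<open>f x = \<integral> \<eta> (s x) \<bullet> x ds\<close> over the unit interval; closedness turns the integrand of
  its derivative into the \<open>s\<close>-derivative of \<open>s (\<eta> (s x) \<bullet> v)\<close>.\<close>

lemma poincare_one_form:
  fixes \<eta> :: "'a::euclidean_space \<Rightarrow> 'a"
  assumes \<eta>: "smooth_on (ball 0 R) \<eta>"
    and closed: "\<And>y u v. y \<in> ball 0 R \<Longrightarrow>
      fderiv \<eta> y u \<bullet> v = fderiv \<eta> y v \<bullet> u"
  obtains f where "smooth_on (ball 0 R) f"
    "\<And>y. y \<in> ball 0 R \<Longrightarrow> (f has_derivative (\<lambda>v. \<eta> y \<bullet> v)) (at y)"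
proof -
  let ?V = "\<lambda>s x. \<eta> (s *\<^sub>R x) \<bullet> x"
  let ?D = "\<lambda>y. fderiv \<eta> y"
  have V: "param_smooth_on {0..1} (ball 0 R) ?V"
    by (rule param_smooth_on_bilinear[OF bounded_bilinear_inner open_ball param_smooth_on_radial[OF \<eta>]
          param_smooth_on_id[OF open_ball bounded_linear_ident]])
  have V1: "param_Ck_on (Suc 0) {0..1} (ball 0 R) ?V" using V by (simp only: param_smooth_on_def)
  show thesis
  proof (rule that)
    show "smooth_on (ball 0 R) (time_integral ?V 1)"
      by (rule smooth_on_time_slice[OF param_smooth_on_time_integral[OF open_ball V]]) simp
    fix x :: 'a assume x: "x \<in> ball 0 R"
    have dV: "fderiv (?V s) x v = \<eta> (s *\<^sub>R x) \<bullet> v + s * (?D (s *\<^sub>R x) x \<bullet> v)"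
      if "s \<in> {0..1}" for s v
    proof -
      have "(?V s has_derivative (\<lambda>v. \<eta> (s *\<^sub>R x) \<bullet> v + (s *\<^sub>R ?D (s *\<^sub>R x) v) \<bullet> x)) (at x)"
        by (rule has_derivative_inner[OF radial_has_derivative[OF \<eta> that x] has_derivative_ident])
      from frechet_derivative_at[OF this, symmetric] show ?thesis
        using closed[OF scaleR_unit_in_ball[OF that x], of v x] by simp
    qed
    have "time_integral (\<lambda>s x. fderiv (?V s) x v) 1 x = \<eta> x \<bullet> v" for v
    proof -
      have "((\<lambda>s. \<eta> (s *\<^sub>R x) \<bullet> v + s * (?D (s *\<^sub>R x) x \<bullet> v)) has_integral
          1 * (\<eta> (1 *\<^sub>R x) \<bullet> v) - 0 * (\<eta> (0 *\<^sub>R x) \<bullet> v)) {0..1}"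
      proof (rule fundamental_theorem_of_calculus)
        fix s :: real assume s: "s \<in> {0..1}"
        from bounded_linear.has_vector_derivative[OF bounded_linear_inner_left
            smooth_on_radial_vector_derivative[OF \<eta> scaleR_unit_in_ball[OF s x]]]
        have "((\<lambda>s. \<eta> (s *\<^sub>R x) \<bullet> v) has_vector_derivative ?D (s *\<^sub>R x) x \<bullet> v) (at s within {0..1})" .
        from has_vector_derivative_mult[OF has_vector_derivative_id this]
        show "((\<lambda>s. s * (\<eta> (s *\<^sub>R x) \<bullet> v)) has_vector_derivative
            \<eta> (s *\<^sub>R x) \<bullet> v + s * (?D (s *\<^sub>R x) x \<bullet> v)) (at s within {0..1})"
          by (simp add: add.commute)
      qed simp
      then have "integral {0..1} (\<lambda>s. \<eta> (s *\<^sub>R x) \<bullet> v + s * (?D (s *\<^sub>R x) x \<bullet> v)) = \<eta> x \<bullet> v"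
        by (simp add: integral_unique)
      moreover have "time_integral (\<lambda>s x. fderiv (?V s) x v) 1 x =
          integral {0..1} (\<lambda>s. \<eta> (s *\<^sub>R x) \<bullet> v + s * (?D (s *\<^sub>R x) x \<bullet> v))"
        unfolding time_integral_def by (rule integral_cong) (rule dV)
      ultimately show ?thesis by simp
    qed
    then show "(time_integral ?V 1 has_derivative (\<lambda>v. \<eta> x \<bullet> v)) (at x)"
      using has_derivative_time_integral[OF open_ball V1 _ x, of 1] by simp
  qed
qed

text \<open>The two-form is \<open>J y u \<bullet> v\<close>; the last condition is the vanishing of its exterior derivative on
  constant vector fields.\<close>

definition closed_two_form :: "'a::euclidean_space set \<Rightarrow> ('a \<Rightarrow> 'a \<Rightarrow>\<^sub>L 'a) \<Rightarrow> bool"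
  where "closed_two_form S J \<longleftrightarrow> smooth_on S J \<and>
    (\<forall>y\<in>S. \<forall>u v. J y u \<bullet> v = - (J y v \<bullet> u)) \<and>
    (\<forall>y\<in>S. \<forall>u v w. fderiv J y u v \<bullet> w
      - fderiv J y v u \<bullet> w + fderiv J y w u \<bullet> v = 0)"

lemma closed_two_formD:
  assumes "closed_two_form S J"
  shows "smooth_on S J" "y \<in> S \<Longrightarrow> J y u \<bullet> v = - (J y v \<bullet> u)"
    "y \<in> S \<Longrightarrow> fderiv J y u v \<bullet> w
      - fderiv J y v u \<bullet> w + fderiv J y w u \<bullet> v = 0"
  using assms unfolding closed_two_form_def by blast+

lemma closed_two_form_subset: "closed_two_form S J \<Longrightarrow> S' \<subseteq> S \<Longrightarrow> closed_two_form S' J"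
  unfolding closed_two_form_def using smooth_on_subset by blast

lemma closed_two_form_const:
  fixes J0 :: "'a::euclidean_space \<Rightarrow>\<^sub>L 'a"
  assumes "open S" and "\<And>u v. J0 u \<bullet> v = - (J0 v \<bullet> u)"
  shows "closed_two_form S (\<lambda>_. J0)"
  unfolding closed_two_form_def using smooth_on_const[OF assms(1)] assms(2)
  by (intro conjI ballI allI) (assumption | simp only: frechet_derivative_const blinfun.zero_left inner_zero_left)+

lemma closed_two_form_diff:
  assumes S: "open S" and A: "closed_two_form S A" and B: "closed_two_form S B"
  shows "closed_two_form S (\<lambda>y. A y - B y)"
  unfolding closed_two_form_def
proof (intro conjI ballI allI)
  show "smooth_on S (\<lambda>y. A y - B y)"
    by (intro smooth_on_diff S closed_two_formD(1)[OF A] closed_two_formD(1)[OF B])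
  fix y assume y: "y \<in> S"
  show "(A y - B y) u \<bullet> v = - ((A y - B y) v \<bullet> u)" for u v
    using closed_two_formD(2)[OF A y, of u v] closed_two_formD(2)[OF B y, of u v]
    by (simp add: blinfun.diff_left inner_diff_left)
  have "((\<lambda>y. A y - B y) has_derivative (\<lambda>u. fderiv A y u - fderiv B y u)) (at y)"
    by (intro has_derivative_diff smooth_on_has_derivative[OF closed_two_formD(1)[OF A] y]
        smooth_on_has_derivative[OF closed_two_formD(1)[OF B] y])
  from frechet_derivative_at[OF this, symmetric]
  have d: "fderiv (\<lambda>y. A y - B y) y u = fderiv A y u - fderiv B y u" for u
    by simp
  show "fderiv (\<lambda>y. A y - B y) y u v \<bullet> w - fderiv (\<lambda>y. A y - B y) y v u \<bullet> w
     + fderiv (\<lambda>y. A y - B y) y w u \<bullet> v = 0" for u v w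
    using closed_two_formD(3)[OF A y, of u v w] closed_two_formD(3)[OF B y, of u v w]
    by (simp add: d blinfun.diff_left inner_diff_left)
qed

lemma blinfun_field_apply_has_derivative:
  fixes J :: "'a::euclidean_space \<Rightarrow> 'c::real_normed_vector \<Rightarrow>\<^sub>L 'b::real_normed_vector"
  assumes "smooth_on S J" "y \<in> S"
  shows "((\<lambda>z. J z u) has_derivative (\<lambda>v. fderiv J y v u)) (at y)"
  using bounded_linear.has_derivative[OF blinfun.bounded_linear_left smooth_on_has_derivative[OF assms]] .

text \<open>The primitive is \<open>\<beta> x = \<integral> s (B (s x) x) ds\<close>; closedness turns the integrand of its exterior
  derivative into the \<open>s\<close>-derivative of \<open>s^2 (B (s x) u \<bullet> v)\<close>. The last three claims prepare the use
  in Moser's equation: \<open>\<beta>\<close> vanishes to second order at the origin if \<open>B\<close> vanishes there, and it takes its values in every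
  subspace that contains the values of \<open>B\<close>.\<close>

lemma poincare_two_form:
  fixes B :: "'a::euclidean_space \<Rightarrow> 'a \<Rightarrow>\<^sub>L 'a"
  assumes B: "closed_two_form (ball 0 R) B"
  obtains \<beta> where "smooth_on (ball 0 R) \<beta>"
    "\<And>y u v. y \<in> ball 0 R \<Longrightarrow>
      fderiv \<beta> y u \<bullet> v - fderiv \<beta> y v \<bullet> u = B y u \<bullet> v"
    "\<beta> 0 = 0" "\<And>u. 0 < R \<Longrightarrow> B 0 = 0 \<Longrightarrow> fderiv \<beta> 0 u = 0"
    "\<And>P y. bounded_linear P \<Longrightarrow> y \<in> ball 0 R \<Longrightarrow> (\<And>y u. y \<in> ball 0 R \<Longrightarrow> P (B y u) = B y u) \<Longrightarrow> P (\<beta> y) = \<beta> y"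
proof -
  note Bs = closed_two_formD(1)[OF B]
  let ?V = "\<lambda>s x. s *\<^sub>R B (s *\<^sub>R x) x"
  let ?D = "\<lambda>y. fderiv B y"
  let ?I = "\<lambda>x u s. s *\<^sub>R (B (s *\<^sub>R x) u + s *\<^sub>R ?D (s *\<^sub>R x) u x)"
  have V: "param_smooth_on {0..1} (ball 0 R) ?V"
    by (rule param_smooth_on_bilinear[OF bounded_bilinear_scaleR open_ball])
      (auto intro!: param_smooth_on_time param_smooth_on_bilinear[OF bounded_bilinear_blinfun_apply open_ball]
        param_smooth_on_radial[OF Bs] param_smooth_on_id[OF open_ball bounded_linear_ident])
  have V1: "param_Ck_on (Suc 0) {0..1} (ball 0 R) ?V" using V by (simp only: param_smooth_on_def)
  have dV: "fderiv (?V s) x u = ?I x u s" if "s \<in> {0..1}" "x \<in> ball 0 R" for s x u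
  proof -
    have "(?V s has_derivative (\<lambda>u. s *\<^sub>R (B (s *\<^sub>R x) u + (s *\<^sub>R ?D (s *\<^sub>R x) u) x))) (at x)"
      by (intro bounded_linear.has_derivative[OF bounded_linear_scaleR_right]
          bounded_bilinear.FDERIV[OF bounded_bilinear_blinfun_apply radial_has_derivative[OF Bs that] has_derivative_ident])
    from frechet_derivative_at[OF this, symmetric] show ?thesis by (simp add: blinfun.scaleR_left)
  qed
  define \<beta> where "\<beta> = time_integral ?V 1"
  have \<beta>: "smooth_on (ball 0 R) \<beta>"
    unfolding \<beta>_def by (rule smooth_on_time_slice[OF param_smooth_on_time_integral[OF open_ball V]]) simp
  have d\<beta>: "(?I x u has_integral fderiv \<beta> x u) {0..1}" if x: "x \<in> ball 0 R" for x u
  proof -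
    have "fderiv \<beta> x u = time_integral (\<lambda>s x. fderiv (?V s) x u) 1 x"
      using frechet_derivative_at[OF has_derivative_time_integral[OF open_ball V1 _ x, of 1]]
      unfolding \<beta>_def by (simp add: fun_eq_iff)
    moreover have "((\<lambda>s. fderiv (?V s) x u) has_integral
        time_integral (\<lambda>s x. fderiv (?V s) x u) 1 x) {0..1}"
      unfolding time_integral_def
      by (intro integrable_integral integrable_continuous_real
          continuous_on_time_slice[OF param_Ck_on_imp_continuous[OF param_Ck_on_SucD(2)[OF V1]] x])
    ultimately have "((\<lambda>s. fderiv (?V s) x u) has_integral fderiv \<beta> x u) {0..1}"
      by simp
    then show ?thesis by (rule has_integral_eq[rotated]) (rule dV[OF _ x])
  qed
  show thesis
  proof (rule that[OF \<beta>])
    fix x u v assume x: "x \<in> ball (0::'a) R"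
    have hI: "((\<lambda>s. ?I x u s \<bullet> v - ?I x v s \<bullet> u) has_integral
        fderiv \<beta> x u \<bullet> v - fderiv \<beta> x v \<bullet> u) {0..1}"
      using has_integral_diff[OF has_integral_linear[OF d\<beta>[OF x, of u] bounded_linear_inner_left[of v]]
          has_integral_linear[OF d\<beta>[OF x, of v] bounded_linear_inner_left[of u]]]
      by (simp only: o_def)
    have eq: "?I x u s \<bullet> v - ?I x v s \<bullet> u = 2 * s * (B (s *\<^sub>R x) u \<bullet> v) + s\<^sup>2 * (?D (s *\<^sub>R x) x u \<bullet> v)"
      if "s \<in> {0..1}" for s
    proof -
      note y = scaleR_unit_in_ball[OF that x]
      have b: "B (s *\<^sub>R x) v \<bullet> u = - (B (s *\<^sub>R x) u \<bullet> v)" by (rule closed_two_formD(2)[OF B y])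
      have c: "?D (s *\<^sub>R x) v x \<bullet> u = ?D (s *\<^sub>R x) u x \<bullet> v - ?D (s *\<^sub>R x) x u \<bullet> v"
        using closed_two_formD(3)[OF B y, of x u v] by simp
      show ?thesis
        by (simp add: inner_add_left b c power2_eq_square algebra_simps)
    qed
    have "((\<lambda>s. 2 * s * (B (s *\<^sub>R x) u \<bullet> v) + s\<^sup>2 * (?D (s *\<^sub>R x) x u \<bullet> v)) has_integral
        1\<^sup>2 * (B (1 *\<^sub>R x) u \<bullet> v) - 0\<^sup>2 * (B (0 *\<^sub>R x) u \<bullet> v)) {0..1}"
    proof (rule fundamental_theorem_of_calculus)
      fix s :: real assume s: "s \<in> {0..1}"
      have bl: "bounded_linear (\<lambda>A :: 'a \<Rightarrow>\<^sub>L 'a. A u \<bullet> v)"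
        by (rule bounded_linear_compose[OF bounded_linear_inner_left blinfun.bounded_linear_left])
      have 1: "((\<lambda>s. B (s *\<^sub>R x) u \<bullet> v) has_vector_derivative ?D (s *\<^sub>R x) x u \<bullet> v) (at s within {0..1})"
        using bounded_linear.has_vector_derivative[OF bl
            smooth_on_radial_vector_derivative[OF Bs scaleR_unit_in_ball[OF s x]]] .
      have 2: "((\<lambda>s. s\<^sup>2) has_vector_derivative 2 * s) (at s within {0..1})"
        by (rule has_real_derivative_iff_has_vector_derivative[THEN iffD1]) (auto intro!: derivative_eq_intros)
      from has_vector_derivative_mult[OF 2 1]
      show "((\<lambda>s. s\<^sup>2 * (B (s *\<^sub>R x) u \<bullet> v)) has_vector_derivative
         2 * s * (B (s *\<^sub>R x) u \<bullet> v) + s\<^sup>2 * (?D (s *\<^sub>R x) x u \<bullet> v)) (at s within {0..1})"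
        by (simp add: add.commute)
    qed simp
    from has_integral_unique[OF has_integral_eq[OF eq hI] this]
    show "fderiv \<beta> x u \<bullet> v - fderiv \<beta> x v \<bullet> u = B x u \<bullet> v" by simp
  next
    show "\<beta> 0 = 0" by (simp add: \<beta>_def time_integral_def blinfun.zero_right)
  next
    fix u assume "0 < R" "B 0 = 0"
    then have "?I 0 u = (\<lambda>s. 0)" by (simp add: blinfun.zero_left blinfun.zero_right)
    then show "fderiv \<beta> 0 u = 0"
      using d\<beta>[of 0 u] \<open>0 < R\<close> by (metis centre_in_ball has_integral_0_eq)
  next
    fix P y assume P: "bounded_linear P" and y: "y \<in> ball (0::'a) R"
      and PB: "\<And>y u. y \<in> ball 0 R \<Longrightarrow> P (B y u) = B y u"
    have "(\<lambda>s. ?V s y) integrable_on {0..1}"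
      by (intro integrable_continuous_real continuous_on_time_slice[OF param_Ck_on_imp_continuous[OF V1] y])
    then have "P (\<beta> y) = integral {0..1} (P \<circ> (\<lambda>s. ?V s y))"
      unfolding \<beta>_def time_integral_def by (rule integral_linear[OF _ P, symmetric])
    also have "\<dots> = integral {0..1} (\<lambda>s. ?V s y)"
    proof (rule integral_cong)
      fix s :: real assume "s \<in> {0..1}"
      then show "(P \<circ> (\<lambda>s. ?V s y)) s = ?V s y"
        using linear_cmul[OF bounded_linear.linear[OF P]] PB[OF scaleR_unit_in_ball[OF _ y]] by (simp del: mem_ball)
    qed
    finally show "P (\<beta> y) = \<beta> y" by (simp add: \<beta>_def time_integral_def)
  qed
qed

section \<open>Moser's method\<close>

text \<open>The time derivative of the pulled back form consists of the transported time derivative \<open>B = d\<beta>\<close> of the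
  form \<open>A + t B\<close>, of its derivative along the velocity, and of two terms with spatial derivatives of
  the velocity. The latter are eliminated by differentiating the equation for the velocity; what
  remains is \<open>dA + t dB\<close> evaluated on the velocity and the two transported vectors, plus \<open>B - d\<beta>\<close>.\<close>

lemma moser_pullback:
  fixes A B :: "'a::euclidean_space \<Rightarrow> 'a \<Rightarrow>\<^sub>L 'a"
  defines "F \<equiv> \<lambda>V a t x. a x + time_integral V t x"
  assumes N: "open N" and V: "param_smooth_on {0..1} N V" and a: "bounded_linear a"
    and A: "closed_two_form S A" and B: "closed_two_form S B" and \<beta>: "smooth_on S \<beta>"
    and d\<beta>: "\<And>y u v. y \<in> S \<Longrightarrow>
      fderiv \<beta> y u \<bullet> v - fderiv \<beta> y v \<bullet> u = B y u \<bullet> v"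
    and FS: "\<And>t x. t \<in> {0..1} \<Longrightarrow> x \<in> N \<Longrightarrow> F V a t x \<in> S"
    and eq: "\<And>t x. t \<in> {0..1} \<Longrightarrow> x \<in> N \<Longrightarrow>
      (A (F V a t x) + t *\<^sub>R B (F V a t x)) (V t x) = - \<beta> (F V a t x)"
    and x: "x \<in> N"
  shows "(A (F V a 1 x) + B (F V a 1 x)) (fderiv (F V a 1) x u)
      \<bullet> fderiv (F V a 1) x v = A (a x) (a u) \<bullet> a v"
proof -
  let ?I = "{0..1::real}" and ?F = "F V a"
  let ?dV = "\<lambda>w s x. fderiv (V s) x w"
  define U where "U w t = a w + time_integral (?dV w) t x" for w t
  have V1: "param_Ck_on (Suc 0) ?I N V" using V by (simp only: param_smooth_on_def)
  note cV = param_Ck_on_imp_continuous[OF V1]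
  note cdV = param_Ck_on_imp_continuous[OF param_Ck_on_SucD(2)[OF V1]]
  have dF: "(?F t has_derivative (\<lambda>w. U w t)) (at x)" if "t \<in> ?I" for t
    unfolding F_def U_def
    by (intro has_derivative_add bounded_linear.has_derivative[OF a] has_derivative_ident
        has_derivative_time_integral[OF N V1 that x])
  have tF: "((\<lambda>t. ?F t x) has_vector_derivative V t x) (at t within ?I)" if "t \<in> ?I" for t
    using has_vector_derivative_add[OF has_vector_derivative_const has_vector_derivative_time_integral[OF cV x that]]
    unfolding F_def by simp
  have tU: "(U w has_vector_derivative ?dV w t x) (at t within ?I)" if "t \<in> ?I" for t w
    using has_vector_derivative_add[OF has_vector_derivative_const has_vector_derivative_time_integral[OF cdV x that]]
    unfolding U_def by simp
  define J where "J t = A (?F t x) + t *\<^sub>R B (?F t x)" for t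
  define g where "g t = J t (U u t) \<bullet> U v t" for t
  have "(g has_vector_derivative 0) (at t within ?I)" if t: "t \<in> ?I" for t
  proof -
    define y where "y = ?F t x"
    have y: "y \<in> S" using FS[OF t x] by (simp add: y_def)
    let ?A = "fderiv A y" and ?B = "fderiv B y"
      and ?b = "fderiv \<beta> y"
    have dA: "(A has_derivative ?A) (at (?F t x))" and dB: "(B has_derivative ?B) (at (?F t x))"
      and db: "(\<beta> has_derivative ?b) (at (?F t x))"
      using smooth_on_has_derivative[OF closed_two_formD(1)[OF A] y]
        smooth_on_has_derivative[OF closed_two_formD(1)[OF B] y]
        smooth_on_has_derivative[OF \<beta> y] by (simp_all add: y_def)
    have dV: "(V t has_derivative (\<lambda>w. ?dV w t x)) (at x)"
      using param_smooth_on_has_derivative[OF V t x] by simp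
    \<comment> \<open>Differentiate the equation that defines \<open>V\<close> in the spatial direction \<open>w\<close>.\<close>
    have J_dV: "J t (?dV w t x) = - ?b (U w t) - ?A (U w t) (V t x) - t *\<^sub>R ?B (U w t) (V t x)" for w
    proof -
      have "((\<lambda>x. (A (?F t x) + t *\<^sub>R B (?F t x)) (V t x)) has_derivative
        (\<lambda>w. (A (?F t x) + t *\<^sub>R B (?F t x)) (?dV w t x) + (?A (U w t) + t *\<^sub>R ?B (U w t)) (V t x))) (at x)"
        by (intro bounded_bilinear.FDERIV[OF bounded_bilinear_blinfun_apply _ dV] has_derivative_add
            bounded_linear.has_derivative[OF bounded_linear_scaleR_right]
            has_derivative_compose[OF dF[OF t] dA] has_derivative_compose[OF dF[OF t] dB])
      then have 1: "((\<lambda>x. - \<beta> (?F t x)) has_derivative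
        (\<lambda>w. (A (?F t x) + t *\<^sub>R B (?F t x)) (?dV w t x) + (?A (U w t) + t *\<^sub>R ?B (U w t)) (V t x))) (at x)"
        by (rule has_derivative_transform_within_open[OF _ N x]) (use eq[OF t] in auto)
      have 2: "((\<lambda>x. - \<beta> (?F t x)) has_derivative (\<lambda>w. - ?b (U w t))) (at x)"
        by (intro has_derivative_minus has_derivative_compose[OF dF[OF t] db])
      from fun_cong[OF has_derivative_unique[OF 1 2], of w] show ?thesis
        by (simp add: J_def blinfun.add_left blinfun.scaleR_left algebra_simps)
    qed
    have tJ: "(J has_vector_derivative ?A (V t x) + (t *\<^sub>R ?B (V t x) + 1 *\<^sub>R B y)) (at t within ?I)"
    proof -
      have "((\<lambda>t. A (?F t x)) has_vector_derivative ?A (V t x)) (at t within ?I)"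
        using vector_derivative_diff_chain_within[OF tF[OF t] has_derivative_at_withinI[OF dA]] by (simp add: o_def)
      moreover have tB: "((\<lambda>t. B (?F t x)) has_vector_derivative ?B (V t x)) (at t within ?I)"
        using vector_derivative_diff_chain_within[OF tF[OF t] has_derivative_at_withinI[OF dB]] by (simp add: o_def)
      have "((\<lambda>t. t *\<^sub>R B (?F t x)) has_vector_derivative (t *\<^sub>R ?B (V t x) + 1 *\<^sub>R B y)) (at t within ?I)"
        using bounded_bilinear.has_vector_derivative[OF bounded_bilinear_scaleR has_vector_derivative_id tB]
        by (simp add: y_def)
      ultimately show ?thesis unfolding J_def[abs_def] by (rule has_vector_derivative_add)
    qed
    let ?X = "V t x" and ?U = "U u t" and ?W = "U v t"
    have "(g has_vector_derivative J t ?U \<bullet> ?dV v t x +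
        (J t (?dV u t x) + (?A ?X + (t *\<^sub>R ?B ?X + 1 *\<^sub>R B y)) ?U) \<bullet> ?W) (at t within ?I)"
      unfolding g_def[abs_def]
      by (intro bounded_bilinear.has_vector_derivative[OF bounded_bilinear_inner]
          bounded_bilinear.has_vector_derivative[OF bounded_bilinear_blinfun_apply] tU t tJ)
    moreover have "J t ?U \<bullet> ?dV v t x + (J t (?dV u t x) + (?A ?X + (t *\<^sub>R ?B ?X + 1 *\<^sub>R B y)) ?U) \<bullet> ?W = 0"
    proof -
      have "J t ?U \<bullet> ?dV v t x = - (J t (?dV v t x) \<bullet> ?U)"
        using closed_two_formD(2)[OF A y, of ?U "?dV v t x"] closed_two_formD(2)[OF B y, of ?U "?dV v t x"]
        by (simp add: J_def y_def[symmetric] blinfun.add_left blinfun.scaleR_left inner_add_left)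
      then have "J t ?U \<bullet> ?dV v t x + (J t (?dV u t x) + (?A ?X + (t *\<^sub>R ?B ?X + 1 *\<^sub>R B y)) ?U) \<bullet> ?W =
          (?A ?X ?U \<bullet> ?W - ?A ?U ?X \<bullet> ?W + ?A ?W ?X \<bullet> ?U)
          + t * (?B ?X ?U \<bullet> ?W - ?B ?U ?X \<bullet> ?W + ?B ?W ?X \<bullet> ?U)
          + (B y ?U \<bullet> ?W - (?b ?U \<bullet> ?W - ?b ?W \<bullet> ?U))"
        unfolding J_dV by (simp add: blinfun.add_left blinfun.scaleR_left inner_add_left inner_diff_left algebra_simps)
      also have "\<dots> = 0"
        using closed_two_formD(3)[OF A y] closed_two_formD(3)[OF B y] d\<beta>[OF y] by simp
      finally show ?thesis .
    qed
    ultimately show ?thesis by simp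
  qed
  then obtain k where "\<And>t. t \<in> ?I \<Longrightarrow> g t = k"
    using has_vector_derivative_zero_constant[of ?I g] by auto
  then have "g 1 = g 0" by simp
  moreover have "fderiv (?F 1) x w = U w 1" for w
    using frechet_derivative_at[OF dF[of 1]] by (simp add: fun_eq_iff)
  moreover have "U w 0 = a w" "?F 0 x = a x" for w by (simp_all add: U_def F_def time_integral_def)
  ultimately show ?thesis by (simp add: g_def J_def)
qed

text \<open>Solves the velocity equation projected to the range of \<open>P\<close>, together with the prescription
  \<open>V - P V = - c x\<close> for the complementary component, as one equation \<open>Z = 0\<close>. Its
  linearisation in \<open>V\<close> at the origin is \<open>A 0 + (1 - P)\<close>; multiplying with the inverse \<open>Q\<close> of this
  constant operator gives a fixed point problem to which \<open>smooth_fixed_point_near_0\<close> applies.\<close>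

lemma moser_flow_exists:
  fixes A B :: "'a::euclidean_space \<Rightarrow> 'a \<Rightarrow>\<^sub>L 'a" and P Q :: "'a \<Rightarrow>\<^sub>L 'a"
    and a c :: "'a \<Rightarrow> 'a"
  assumes S: "open S" "0 \<in> S" and A: "smooth_on S A" and B: "smooth_on S B" and \<beta>: "smooth_on S \<beta>"
    and B0: "B 0 = 0" and \<beta>0: "\<beta> 0 = 0" and d\<beta>0: "\<And>u. fderiv \<beta> 0 u = 0"
    and PP: "\<And>x. P (P x) = P x" and PA: "\<And>x. P (A 0 x) = A 0 x"
    and P\<beta>: "\<And>y. y \<in> S \<Longrightarrow> P (\<beta> y) = \<beta> y"
    and Q1: "\<And>x. Q (A 0 x + (x - P x)) = x" and Q2: "\<And>x. A 0 (Q x) + (Q x - P (Q x)) = x"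
    and a: "bounded_linear a" and c: "bounded_linear c" and Pc: "\<And>x. P (c x) = 0"
  obtains \<delta> V where "\<delta> > 0" "param_smooth_on {0..1} (ball 0 \<delta>) V"
    "\<And>t x. t \<in> {0..1} \<Longrightarrow> x \<in> ball 0 \<delta> \<Longrightarrow> a x + time_integral V t x \<in> S"
    "\<And>t x. t \<in> {0..1} \<Longrightarrow> x \<in> ball 0 \<delta> \<Longrightarrow>
      P ((A (a x + time_integral V t x) + t *\<^sub>R B (a x + time_integral V t x)) (V t x)) =
        - \<beta> (a x + time_integral V t x)"
    "time_integral V 1 0 = 0"
    "((\<lambda>x. a x + time_integral V 1 x) has_derivative (\<lambda>v. a v - Q (c v))) (at 0)"
proof -
  define l :: "'a \<times> 'a \<times> 'a \<Rightarrow> 'a" where "l p = a (fst p) + fst (snd p)" for p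
  let ?w = "\<lambda>p :: 'a \<times> 'a \<times> 'a. snd (snd p)"
  have l: "bounded_linear l"
    unfolding l_def
    by (intro bounded_linear_add bounded_linear_compose[OF a] bounded_linear_fst
        bounded_linear_compose[OF bounded_linear_fst bounded_linear_snd])
  have w: "bounded_linear ?w" by (rule bounded_linear_compose[OF bounded_linear_snd bounded_linear_snd])
  have c': "bounded_linear (\<lambda>p :: 'a \<times> 'a \<times> 'a. c (fst p))"
    by (rule bounded_linear_compose[OF c bounded_linear_fst])
  define D where "D = l -` S"
  have D: "open D" "0 \<in> D"
    unfolding D_def using S linear_0[OF bounded_linear.linear[OF l]]
    by (auto intro!: open_vimage linear_continuous_on[OF l])
  \<comment> \<open>A point \<open>p = (x, y, w)\<close> stands for a parameter, an integrated velocity and a velocity; \<open>l p\<close> is the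
    position reached.\<close>
  define Z where "Z t p = P ((A (l p) + t *\<^sub>R B (l p)) (?w p)) + (?w p - P (?w p)) + c (fst p) + \<beta> (l p)" for t p
  define \<Psi> where "\<Psi> t p = ?w p - Q (Z t p)" for t p
  have comp: "param_smooth_on {0..1} D (\<lambda>t p. h (l p))"
    if h: "smooth_on S h" for h :: "'a \<Rightarrow> 'z::real_normed_vector"
    by (rule param_smooth_on_compose[OF D(1) param_smooth_on_of_smooth_on[OF h] param_smooth_on_id[OF D(1) l]])
      (simp add: D_def)
  have pw: "param_smooth_on {0..1} D (\<lambda>t. ?w)" by (rule param_smooth_on_id[OF D(1) w])
  have pB: "param_smooth_on {0..1} D (\<lambda>t p. t *\<^sub>R B (l p))"
    by (rule param_smooth_on_bilinear[OF bounded_bilinear_scaleR D(1) param_smooth_on_time[OF D(1)] comp[OF B]])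
      simp
  have pAB: "param_smooth_on {0..1} D (\<lambda>t p. P ((A (l p) + t *\<^sub>R B (l p)) (?w p)))"
    by (rule param_smooth_on_linear[OF blinfun.bounded_linear_right D(1)],
        rule param_smooth_on_bilinear[OF bounded_bilinear_blinfun_apply D(1)
          param_smooth_on_add[OF D(1) comp[OF A] pB] pw])
  have pPw: "param_smooth_on {0..1} D (\<lambda>t p. P (?w p))"
    by (rule param_smooth_on_linear[OF blinfun.bounded_linear_right D(1) pw])
  have pZ: "param_smooth_on {0..1} D Z"
    unfolding Z_def
    by (intro param_smooth_on_add[OF D(1)] pAB comp[OF \<beta>] param_smooth_on_id[OF D(1) c']
        param_smooth_on_diff[OF D(1)] pw pPw)
  have p\<Psi>: "param_smooth_on {0..1} D \<Psi>"
    unfolding \<Psi>_def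
    by (rule param_smooth_on_diff[OF D(1) pw param_smooth_on_linear[OF blinfun.bounded_linear_right D(1) pZ]])
  have l0: "l 0 = 0" and c0: "c 0 = 0"
    using linear_0[OF bounded_linear.linear[OF l]] linear_0[OF bounded_linear.linear[OF c]] by auto
  have \<Psi>0: "\<Psi> t 0 = 0" for t
    by (simp add: \<Psi>_def Z_def l0 c0 \<beta>0 blinfun.zero_right)
  have d\<Psi>: "(\<Psi> t has_derivative (\<lambda>p. - Q (c (fst p)))) (at 0)" for t
  proof -
    have dl: "(l has_derivative l) (at 0)" by (rule bounded_linear_imp_has_derivative[OF l])
    have dw: "(?w has_derivative ?w) (at 0)" by (rule bounded_linear_imp_has_derivative[OF w])
    have dA: "((\<lambda>p. A (l p)) has_derivative (\<lambda>p. fderiv A 0 (l p))) (at 0)"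
      using has_derivative_compose[OF dl] smooth_on_has_derivative[OF A S(2)] l0 by simp
    have dB: "((\<lambda>p. B (l p)) has_derivative (\<lambda>p. fderiv B 0 (l p))) (at 0)"
      using has_derivative_compose[OF dl] smooth_on_has_derivative[OF B S(2)] l0 by simp
    have d\<beta>: "((\<lambda>p. \<beta> (l p)) has_derivative (\<lambda>p. fderiv \<beta> 0 (l p))) (at 0)"
      using has_derivative_compose[OF dl] smooth_on_has_derivative[OF \<beta> S(2)] l0 by simp
    have "(\<Psi> t has_derivative (\<lambda>p. ?w p - Q (P ((A (l 0) + t *\<^sub>R B (l 0)) (?w p) +
        (fderiv A 0 (l p) + t *\<^sub>R fderiv B 0 (l p)) (?w 0))
        + (?w p - P (?w p)) + c (fst p) + fderiv \<beta> 0 (l p)))) (at 0)"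
      unfolding \<Psi>_def[abs_def] Z_def
      by (intro has_derivative_diff has_derivative_add bounded_linear.has_derivative[OF blinfun.bounded_linear_right]
          bounded_bilinear.FDERIV[OF bounded_bilinear_blinfun_apply _ dw]
          bounded_linear.has_derivative[OF bounded_linear_scaleR_right] dA dB d\<beta> dw
          bounded_linear_imp_has_derivative[OF c'])
    moreover have "?w p - Q (P ((A (l 0) + t *\<^sub>R B (l 0)) (?w p) +
        (fderiv A 0 (l p) + t *\<^sub>R fderiv B 0 (l p)) (?w 0))
        + (?w p - P (?w p)) + c (fst p) + fderiv \<beta> 0 (l p)) = - Q (c (fst p))" for p
    proof -
      have "?w p - Q (P ((A (l 0) + t *\<^sub>R B (l 0)) (?w p) +
        (fderiv A 0 (l p) + t *\<^sub>R fderiv B 0 (l p)) (?w 0))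
        + (?w p - P (?w p)) + c (fst p) + fderiv \<beta> 0 (l p)) =
        ?w p - Q ((A 0 (?w p) + (?w p - P (?w p))) + c (fst p))"
        by (simp add: l0 B0 d\<beta>0 PA blinfun.zero_right)
      also have "\<dots> = - Q (c (fst p))"
        by (subst blinfun.add_right) (simp only: Q1, simp)
      finally show ?thesis .
    qed
    ultimately show ?thesis by simp
  qed
  obtain \<delta> V where V: "\<delta> > 0" "param_smooth_on {0..1} (ball 0 \<delta>) V"
    "\<And>t x. t \<in> {0..1} \<Longrightarrow> x \<in> ball 0 \<delta> \<Longrightarrow> (x, time_integral V t x, V t x) \<in> D"
    "\<And>t x. t \<in> {0..1} \<Longrightarrow> x \<in> ball 0 \<delta> \<Longrightarrow> V t x = \<Psi> t (x, time_integral V t x, V t x)"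
    "\<And>t. t \<in> {0..1} \<Longrightarrow> V t 0 = 0"
    "\<And>t. t \<in> {0..1} \<Longrightarrow> (V t has_derivative (\<lambda>v. - Q (c v))) (at 0)"
    using smooth_fixed_point_near_0[OF D p\<Psi> \<Psi>0, of "\<lambda>t v. - Q (c v)"] d\<Psi> by blast
  have lp: "l (x, y, w) = a x + y" for x y w by (simp add: l_def)
  show thesis
  proof (rule that[OF V(1,2)])
    fix t :: real and x :: 'a assume t: "t \<in> {0..1}" and x: "x \<in> ball 0 \<delta>"
    let ?p = "(x, time_integral V t x, V t x)"
    show S: "a x + time_integral V t x \<in> S" using V(3)[OF t x] by (simp add: D_def lp)
    \<comment> \<open>The image of \<open>Z = 0\<close> under \<open>P\<close> is the projected velocity equation.\<close>
    have "Q (Z t ?p) = 0" using V(4)[OF t x] by (simp add: \<Psi>_def)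
    then have "Z t ?p = 0" using Q2[of "Z t ?p"] by (simp add: blinfun.zero_right)
    then have "P (Z t ?p) = 0" by (simp add: blinfun.zero_right)
    then have "P ((A (a x + time_integral V t x) + t *\<^sub>R B (a x + time_integral V t x)) (V t x)) +
      \<beta> (a x + time_integral V t x) = 0"
      by (simp only: Z_def lp fst_conv snd_conv blinfun.add_right[of P] blinfun.diff_right[of P] PP Pc P\<beta>[OF S]) simp
    then show "P ((A (a x + time_integral V t x) + t *\<^sub>R B (a x + time_integral V t x)) (V t x)) =
      - \<beta> (a x + time_integral V t x)" by (rule eq_neg_iff_add_eq_0[THEN iffD2])
  next
    show "time_integral V 1 0 = 0"
      unfolding time_integral_def by (subst integral_cong[where g="\<lambda>_. 0"]) (auto simp: V(5))
  next
    have z: "(0::'a) \<in> ball 0 \<delta>" using V(1) by simp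
    have V1: "param_Ck_on (Suc 0) {0..1} (ball 0 \<delta>) V" using V(2) by (simp only: param_smooth_on_def)
    have "time_integral (\<lambda>s x. fderiv (V s) x v) 1 0 = - Q (c v)" for v
    proof -
      have "time_integral (\<lambda>s x. fderiv (V s) x v) 1 0 = integral {0..1::real} (\<lambda>_. - Q (c v))"
        unfolding time_integral_def
        by (rule integral_cong) (use frechet_derivative_at[OF V(6)] in \<open>simp add: fun_eq_iff\<close>)
      then show ?thesis by simp
    qed
    then have "(time_integral V 1 has_derivative (\<lambda>v. - Q (c v))) (at 0)"
      using has_derivative_time_integral[OF open_ball V1 _ z, of 1] by simp
    from has_derivative_add[OF bounded_linear_imp_has_derivative[OF a] this]
    show "((\<lambda>x. a x + time_integral V 1 x) has_derivative (\<lambda>v. a v - Q (c v))) (at 0)" by simp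
  qed
qed

section \<open>Darboux's theorem for closed two-forms of constant rank\<close>

lemma orthogonal_projection_exists:
  fixes W :: "'a::euclidean_space set"
  assumes "subspace W"
  obtains P :: "'a \<Rightarrow>\<^sub>L 'a" where "\<And>x. P x \<in> W" "\<And>x. x \<in> W \<Longrightarrow> P x = x"
    "\<And>x y. P x \<bullet> y = x \<bullet> P y"
proof -
  obtain B where B: "B \<subseteq> W" "pairwise orthogonal B" "\<And>x. x \<in> B \<Longrightarrow> norm x = 1"
    "independent B" "span B = W"
    using orthonormal_basis_subspace[OF assms] by metis
  have fin: "finite B" using B(4) independent_imp_finite by blast
  define p where "p x = (\<Sum>b\<in>B. (x \<bullet> b) *\<^sub>R b)" for x
  have lin: "linear p"
    unfolding p_def by (intro linear_compose_sum ballI linearI) (simp_all add: inner_add_left scaleR_add_left)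
  have pb: "p b = b" if "b \<in> B" for b
  proof -
    have "p b = (\<Sum>b'\<in>B. if b' = b then b else 0)"
      unfolding p_def
    proof (rule sum.cong)
      fix b' assume "b' \<in> B"
      then show "(b \<bullet> b') *\<^sub>R b' = (if b' = b then b else 0)"
        using B(2) B(3)[OF that] that by (auto simp: pairwise_def orthogonal_def dot_square_norm)
    qed simp
    then show ?thesis using fin that by simp
  qed
  have "p x = x" if "x \<in> W" for x
    using linear_eq_on_span[OF lin linear_id, of B x] pb that B(5) by (auto simp: id_def)
  moreover have "p x \<in> W" for x
    unfolding p_def B(5)[symmetric] by (intro span_sum span_scale span_base)
  moreover have "p x \<bullet> y = x \<bullet> p y" for x y
    by (simp add: p_def inner_sum_left inner_sum_right inner_commute mult.commute)
  moreover have "blinfun_apply (Blinfun p) = p"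
    using lin linear_conv_bounded_linear bounded_linear_Blinfun_apply by blast
  ultimately show thesis using that[of "Blinfun p"] by metis
qed

text \<open>Given \<open>u\<close> and \<open>v\<close> with \<open>J u \<bullet> v = 1\<close>, subtracting the wedge of the functionals \<open>J u\<close> and \<open>J v\<close>
  leaves a skew operator whose range lies in the range of \<open>J\<close> and is orthogonal to \<open>u\<close> and \<open>v\<close>, so that
  the rank drops by two. With an inequality for the rank the induction needs no case
  distinction on its exact value, since superfluous terms may vanish.\<close>

lemma skew_rank_normal_form:
  fixes J :: "'a::euclidean_space \<Rightarrow> 'a"
  assumes "linear J" and "\<And>u v. J u \<bullet> v = - (J v \<bullet> u)" and "dim (range J) \<le> 2 * r"
  shows "\<exists>a b :: nat \<Rightarrow> 'a. \<forall>u v. J u \<bullet> v = (\<Sum>i=1..r. (a i \<bullet> u) * (b i \<bullet> v) - (a i \<bullet> v) * (b i \<bullet> u))"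
  using assms
proof (induction r arbitrary: J)
  case 0
  then have "range J \<subseteq> {0}" by (simp add: dim_eq_0)
  then have "J u = 0" for u by auto
  then show ?case by simp
next
  case (Suc r)
  note lin = Suc.prems(1) and skew = Suc.prems(2)
  show ?case
  proof (cases "\<forall>u. J u = 0")
    case True
    then show ?thesis by (intro exI[of _ "\<lambda>_. 0"]) simp
  next
    case False
    then obtain u where u: "J u \<noteq> 0" by blast
    define v where "v = J u /\<^sub>R (J u \<bullet> J u)"
    have uv: "J u \<bullet> v = 1" using u by (simp add: v_def)
    have vu: "J v \<bullet> u = -1" using skew[of u v] uv by simp
    have uu: "J u \<bullet> u = 0" and vv: "J v \<bullet> v = 0" using skew[of u u] skew[of v v] by auto
    define K where "K x = J x - ((J u \<bullet> x) *\<^sub>R J v - (J v \<bullet> x) *\<^sub>R J u)" for x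
    have linK: "linear K"
      unfolding K_def
      by (intro linearI) (simp_all add: linear_add[OF lin] linear_cmul[OF lin] inner_add_right algebra_simps)
    have K: "J x \<bullet> y = K x \<bullet> y + ((J u \<bullet> x) * (J v \<bullet> y) - (J u \<bullet> y) * (J v \<bullet> x))" for x y
      by (simp add: K_def inner_diff_left)
    have skewK: "K x \<bullet> y = - (K y \<bullet> x)" for x y
      using K[of x y] K[of y x] skew[of x y] by simp
    have Ku: "K x \<bullet> u = 0" and Kv: "K x \<bullet> v = 0" for x
      using K[of x u] K[of x v] skew[of x u] skew[of x v] uv vu uu vv by auto
    have sK: "span (range K) = range K"
      using linear_subspace_image[OF linK subspace_UNIV] by (simp add: span_eq_iff)
    have Ju: "J u \<notin> span (range K)" unfolding sK using Kv uv by auto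
    have Jv: "J v \<notin> span (insert (J u) (range K))"
    proof
      assume a: "J v \<in> span (insert (J u) (range K))"
      have "span (insert (J u) (range K)) \<subseteq> {z. u \<bullet> z = 0}"
        by (rule span_minimal[OF _ subspace_hyperplane]) (use Ku uu in \<open>auto simp: inner_commute\<close>)
      then show False using a vu by (auto simp: inner_commute)
    qed
    have "K x \<in> range J" for x
    proof -
      have "K x = J (x - ((J u \<bullet> x) *\<^sub>R v - (J v \<bullet> x) *\<^sub>R u))"
        by (simp add: K_def linear_diff[OF lin] linear_cmul[OF lin])
      then show ?thesis by simp
    qed
    then have "dim (insert (J v) (insert (J u) (range K))) \<le> dim (range J)"
      by (intro dim_subset) auto
    moreover have "dim (insert (J v) (insert (J u) (range K))) = dim (range K) + 2"
      using Ju Jv by (simp add: dim_insert)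
    ultimately have "dim (range K) \<le> 2 * r" using Suc.prems(3) by simp
    from Suc.IH[OF linK skewK this] obtain a b where
      ab: "K x \<bullet> y = (\<Sum>i=1..r. (a i \<bullet> x) * (b i \<bullet> y) - (a i \<bullet> y) * (b i \<bullet> x))" for x y by blast
    show ?thesis
    proof (rule exI[of _ "a(Suc r := J u)"], rule exI[of _ "b(Suc r := J v)"], intro allI)
      fix x y
      show "J x \<bullet> y = (\<Sum>i=1..Suc r. ((a(Suc r := J u)) i \<bullet> x) * ((b(Suc r := J v)) i \<bullet> y) -
          ((a(Suc r := J u)) i \<bullet> y) * ((b(Suc r := J v)) i \<bullet> x))"
        unfolding K[of x y] ab by simp
    qed
  qed
qed

text \<open>This is where constancy of the rank enters. Near \<open>J0\<close> the operator \<open>P \<circ> J + (1 - P)\<close> stays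
  invertible, so \<open>P\<close> maps the range of \<open>J\<close> onto the range of \<open>P\<close>; as both have the same dimension,
  it does so injectively.\<close>

lemma projection_injective_on_nearby_range:
  fixes J J0 P Q :: "'a::euclidean_space \<Rightarrow>\<^sub>L 'a"
  assumes PP: "\<And>x. P (P x) = P x" and PJ0: "\<And>x. P (J0 x) = J0 x"
    and Q: "\<And>x. Q (J0 x + (x - P x)) = x"
    and small: "norm (Q o\<^sub>L (P o\<^sub>L (J0 - J))) < 1"
    and dim: "dim (range J) = dim (range P)"
    and z: "P (J z) = 0"
  shows "J z = 0"
proof -
  define C where "C x = P (J x) + (x - P x)" for x
  have linC: "linear C"
    unfolding C_def by (intro linearI) (simp_all add: blinfun.bilinear_simps algebra_simps)
  have "x = 0" if "C x = 0" for x
  proof -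
    have "x - P x = - P (J x)" using that by (simp add: C_def add_eq_0_iff)
    then have "x = Q (P (J0 x) - P (J x))" using Q[of x] PJ0[of x] by simp
    then have "x = (Q o\<^sub>L (P o\<^sub>L (J0 - J))) x" by (simp add: blinfun.diff_left blinfun.diff_right)
    then have "norm x \<le> norm (Q o\<^sub>L (P o\<^sub>L (J0 - J))) * norm x" by (metis norm_blinfun)
    then have "(1 - norm (Q o\<^sub>L (P o\<^sub>L (J0 - J)))) * norm x \<le> 0" by (simp add: algebra_simps)
    then show "x = 0" using small by (simp add: mult_le_0_iff)
  qed
  then have "inj C" using linear_injective_0[OF linC] by blast
  then obtain G where G: "linear G" "\<And>x. C (G x) = x"
    using linear_injective_isomorphism[OF linC] by blast
  define h where "h w = J (G w)" for w
  have linh: "linear h"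
    unfolding h_def by (intro linearI) (simp_all add: linear_add[OF G(1)] linear_cmul[OF G(1)] blinfun.bilinear_simps)
  have Ph: "P (h w) = w" if "w \<in> range P" for w
  proof -
    have "P (h w) + (G w - P (G w)) = w" using G(2)[of w] by (simp add: C_def h_def)
    then have "P (P (h w) + (G w - P (G w))) = P w" by simp
    then have "P (h w) = P w" by (simp add: blinfun.add_right blinfun.diff_right PP)
    then show ?thesis using that PP by auto
  qed
  have sP: "subspace (range P)" and sJ: "subspace (range J)"
    using linear_subspace_image[OF bounded_linear.linear[OF blinfun.bounded_linear_right] subspace_UNIV] by auto
  have "inj_on h (span (range P))"
    unfolding span_eq_iff[THEN iffD2, OF sP] using Ph by (intro inj_on_inverseI[of _ P])
  then have "dim (h ` range P) = dim (range P)" using dim_image_eq[OF linh] by blast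
  then have "h ` range P = range J"
    using dim by (intro subspace_dim_equal[OF linear_subspace_image[OF linh sP] sJ]) (auto simp: h_def)
  then obtain w where w: "w \<in> range P" "J z = h w" by (metis imageE rangeI)
  then have "w = 0" using Ph[OF w(1)] z by simp
  then show "J z = 0" using w(2) linear_0[OF linh] by simp
qed

lemma closed_two_form_pullback_projection:
  fixes J :: "'a::euclidean_space \<Rightarrow> 'a \<Rightarrow>\<^sub>L 'a" and P :: "'a \<Rightarrow>\<^sub>L 'a"
  assumes S: "open S" and J: "closed_two_form S J" and P: "\<And>x y. P x \<bullet> y = x \<bullet> P y"
  shows "closed_two_form (P -` S) (\<lambda>x. P o\<^sub>L (J (P x) o\<^sub>L P))"
proof -
  have Pb: "bounded_linear P" by (rule blinfun.bounded_linear_right)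
  have o: "open (P -` S)" by (rule open_vimage[OF S linear_continuous_on[OF Pb]])
  have L: "bounded_linear (\<lambda>M :: 'a \<Rightarrow>\<^sub>L 'a. P o\<^sub>L (M o\<^sub>L P))"
    by (rule bounded_linear_compose[OF bounded_bilinear.bounded_linear_right[OF bounded_bilinear_blinfun_compose]
          bounded_bilinear.bounded_linear_left[OF bounded_bilinear_blinfun_compose]])
  show ?thesis
    unfolding closed_two_form_def
  proof (intro conjI ballI allI)
    show "smooth_on (P -` S) (\<lambda>x. P o\<^sub>L (J (P x) o\<^sub>L P))"
      by (rule smooth_on_linear[OF L o], rule smooth_on_compose[OF o closed_two_formD(1)[OF J]
            smooth_on_linear_map[OF o Pb]]) simp
    fix y assume y: "y \<in> P -` S"
    then have Py: "P y \<in> S" by simp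
    show "(P o\<^sub>L (J (P y) o\<^sub>L P)) u \<bullet> v = - ((P o\<^sub>L (J (P y) o\<^sub>L P)) v \<bullet> u)" for u v
      using closed_two_formD(2)[OF J Py, of "P u" "P v"] by (simp add: P)
    have "((\<lambda>x. P o\<^sub>L (J (P x) o\<^sub>L P)) has_derivative
        (\<lambda>u. P o\<^sub>L (fderiv J (P y) (P u) o\<^sub>L P))) (at y)"
      by (rule bounded_linear.has_derivative[OF L], rule has_derivative_compose[OF
            bounded_linear_imp_has_derivative[OF Pb] smooth_on_has_derivative[OF closed_two_formD(1)[OF J] Py]])
    from frechet_derivative_at[OF this, symmetric]
    show "fderiv (\<lambda>x. P o\<^sub>L (J (P x) o\<^sub>L P)) y u v \<bullet> w
      - fderiv (\<lambda>x. P o\<^sub>L (J (P x) o\<^sub>L P)) y v u \<bullet> w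
      + fderiv (\<lambda>x. P o\<^sub>L (J (P x) o\<^sub>L P)) y w u \<bullet> v = 0" for u v w
      using closed_two_formD(3)[OF J Py, of "P u" "P v" "P w"] by (simp add: P)
  qed
qed

abbreviation darboux_form ::
    "nat \<Rightarrow> (nat \<Rightarrow> 'a \<Rightarrow> real) \<Rightarrow> (nat \<Rightarrow> 'a \<Rightarrow> real) \<Rightarrow> 'a::real_normed_vector \<Rightarrow> 'a \<Rightarrow> 'a \<Rightarrow> real"
  where "darboux_form r q p y u v \<equiv>
    (\<Sum>i=1..r. fderiv (q i) y u * fderiv (p i) y v - fderiv (q i) y v * fderiv (p i) y u)"

text \<open>With \<open>W\<close> the range of \<open>J 0\<close>, which is the orthogonal complement of its kernel, the map \<open>F\<close> straightens
  the kernels and \<open>G\<close> makes the form on \<open>W\<close> constant. Both have the identity as derivative at the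
  origin, so \<open>F \<circ> G\<close> is a local diffeomorphism, and it pulls the form back to its
  value at the origin.\<close>

theorem darboux_constant_rank_at_0:
  fixes J :: "'a::euclidean_space \<Rightarrow> 'a \<Rightarrow>\<^sub>L 'a"
  assumes S: "open S" "0 \<in> S" and J: "closed_two_form S J"
    and rank: "\<And>y. y \<in> S \<Longrightarrow> dim (range (J y)) = 2 * r"
  obtains N and q p :: "nat \<Rightarrow> 'a \<Rightarrow> real" where "open N" "0 \<in> N" "N \<subseteq> S"
    "\<And>i. smooth_on N (q i)" "\<And>i. smooth_on N (p i)"
    "\<And>y u v. y \<in> N \<Longrightarrow> J y u \<bullet> v = darboux_form r q p y u v"
proof -
  define J0 where "J0 = J 0"
  have skew0: "J0 u \<bullet> v = - (J0 v \<bullet> u)" for u v unfolding J0_def by (rule closed_two_formD(2)[OF J S(2)])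
  have linJ0: "linear J0" by (rule bounded_linear.linear[OF blinfun.bounded_linear_right])
  have sW: "subspace (range J0)" by (rule linear_subspace_image[OF linJ0 subspace_UNIV])
  obtain P :: "'a \<Rightarrow>\<^sub>L 'a" where P: "\<And>x. P x \<in> range J0" "\<And>x. x \<in> range J0 \<Longrightarrow> P x = x"
    "\<And>x y. P x \<bullet> y = x \<bullet> P y"
    using orthogonal_projection_exists[OF sW] by blast
  have PP: "P (P x) = P x" and PJ0: "P (J0 x) = J0 x" for x using P by auto
  have J0P: "J0 (P x) = J0 x" for x
  proof -
    have "J0 (P x) \<bullet> v = J0 x \<bullet> v" for v
      using skew0[of "P x" v] skew0[of x v] P(3)[of "J0 v" x] PJ0[of v] by simp
    then show ?thesis by (metis inner_commute vector_eq_ldot)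
  qed
  have rangeP: "range P = range J0"
  proof
    show "range J0 \<subseteq> range P" using PJ0 by (metis image_subsetI rangeI)
  qed (use P(1) in auto)
  define C where "C x = J0 x + (x - P x)" for x
  have linC: "linear C"
    unfolding C_def by (intro linearI) (simp_all add: blinfun.bilinear_simps algebra_simps)
  have "x = 0" if "C x = 0" for x
  proof -
    have "P (J0 x + (x - P x)) = 0" using that by (simp add: C_def blinfun.zero_right)
    then have J0x: "J0 x = 0" by (simp add: blinfun.add_right blinfun.diff_right PP PJ0)
    then have "x = P x" using that by (simp add: C_def)
    then obtain z where z: "x = J0 z" using P(1) by (metis imageE)
    have "x \<bullet> x = - (J0 x \<bullet> z)" using skew0[of z x] z by simp
    then show "x = 0" using J0x by simp
  qed
  then have "inj C" using linear_injective_0[OF linC] by blast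
  then obtain Q' where Q': "linear Q'" "\<And>x. C (Q' x) = x" "\<And>x. Q' (C x) = x"
    using linear_injective_isomorphism[OF linC] by blast
  define Q where "Q = Blinfun Q'"
  have QQ': "blinfun_apply Q = Q'"
    unfolding Q_def using Q'(1) linear_conv_bounded_linear bounded_linear_Blinfun_apply by blast
  have Q1: "Q (J0 x + (x - P x)) = x" and Q2: "J0 (Q x) + (Q x - P (Q x)) = x" for x
    using Q'(2,3)[of x] by (simp_all add: C_def QQ')

  \<comment> \<open>First deformation: \<open>P x\<close> is moved along the kernels, and \<open>S1\<close> is where the projected equation for
    the velocity implies the equation itself.\<close>
  define S1 where "S1 = S \<inter> {y. norm (Q o\<^sub>L (P o\<^sub>L (J0 - J y))) < 1}"
  have cJ: "continuous_on S J" by (rule smooth_on_imp_continuous[OF closed_two_formD(1)[OF J]])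
  have S1: "open S1" "0 \<in> S1" "S1 \<subseteq> S"
  proof -
    have "continuous_on S (\<lambda>y. norm (Q o\<^sub>L (P o\<^sub>L (J0 - J y))))"
      by (intro continuous_on_norm bounded_bilinear.continuous_on[OF bounded_bilinear_blinfun_compose]
          continuous_on_const continuous_on_diff cJ)
    from continuous_on_open_vimage[OF S(1), THEN iffD1, OF this, rule_format, OF open_lessThan[of 1]]
    show "open S1" by (simp add: S1_def vimage_def Int_commute)
    show "0 \<in> S1" using S by (simp add: S1_def J0_def)
  qed (simp add: S1_def)
  have J1: "closed_two_form S1 J" by (rule closed_two_form_subset[OF J S1(3)])
  have zero1: "closed_two_form S1 (\<lambda>_. 0 :: 'a \<Rightarrow>\<^sub>L 'a)"
    by (rule closed_two_form_const[OF S1(1)]) simp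
  have c1: "bounded_linear (\<lambda>x. P x - x)"
    by (intro bounded_linear_sub blinfun.bounded_linear_right bounded_linear_ident)
  obtain \<delta>1 V1 where V1: "\<delta>1 > 0" "param_smooth_on {0..1} (ball 0 \<delta>1) V1"
    "\<And>t x. t \<in> {0..1} \<Longrightarrow> x \<in> ball 0 \<delta>1 \<Longrightarrow> P x + time_integral V1 t x \<in> S1"
    "\<And>t x. t \<in> {0..1} \<Longrightarrow> x \<in> ball 0 \<delta>1 \<Longrightarrow>
      P ((J (P x + time_integral V1 t x) + t *\<^sub>R 0) (V1 t x)) = - 0"
    "time_integral V1 1 0 = 0"
    "((\<lambda>x. P x + time_integral V1 1 x) has_derivative (\<lambda>v. P v - Q (P v - v))) (at 0)"
    using moser_flow_exists[OF S1(1,2) closed_two_formD(1)[OF J1] smooth_on_const[OF S1(1)] smooth_on_const[OF S1(1)]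
        refl refl _ PP PJ0[unfolded J0_def] _ Q1[unfolded J0_def] Q2[unfolded J0_def]
        blinfun.bounded_linear_right[of P] c1]
    by (auto simp: blinfun.diff_right PP blinfun.zero_right)
  define F where "F x = P x + time_integral V1 1 x" for x
  have J_V1: "(J (P x + time_integral V1 t x) + t *\<^sub>R 0) (V1 t x) = - 0"
    if "t \<in> {0..1}" "x \<in> ball 0 \<delta>1" for t x
  proof -
    let ?y = "P x + time_integral V1 t x"
    have y: "?y \<in> S1" by (rule V1(3)[OF that])
    have dim: "dim (range (J ?y)) = dim (range P)"
      unfolding rangeP using rank[of ?y] rank[OF S(2)] y S1(3) by (auto simp: J0_def)
    have "J ?y (V1 t x) = 0"
      by (rule projection_injective_on_nearby_range[OF PP PJ0 Q1 _ dim])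
        (use y V1(4)[OF that] in \<open>auto simp: S1_def\<close>)
    then show ?thesis by simp
  qed
  have F_pull: "J (F x) (fderiv F x u) \<bullet> fderiv F x v = J (P x) (P u) \<bullet> P v"
    if "x \<in> ball 0 \<delta>1" for x u v
    using moser_pullback[OF open_ball V1(2) blinfun.bounded_linear_right[of P] J1 zero1
        smooth_on_const[OF S1(1), of 0] _ V1(3) J_V1 that, of u v]
    unfolding F_def[abs_def] by simp
  have F_smooth: "smooth_on (ball 0 \<delta>1) F"
    unfolding F_def
    by (intro smooth_on_add smooth_on_linear_map open_ball blinfun.bounded_linear_right
        smooth_on_time_slice[OF param_smooth_on_time_integral[OF open_ball V1(2)]]) simp
  have F0: "F 0 = 0" using V1(5) by (simp add: F_def blinfun.zero_right)
  have F_S: "F x \<in> S" if "x \<in> ball 0 \<delta>1" for x using V1(3)[OF _ that, of 1] S1(3) by (auto simp: F_def)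
  have F_d: "(F has_derivative (\<lambda>v. v)) (at 0)"
  proof -
    have "P v - Q (P v - v) = v" for v
    proof -
      have "Q (v - P v) = v - P v"
        using Q1[of "v - P v"] by (simp add: blinfun.diff_right PP J0P)
      then have "Q (P v - v) = P v - v" by (metis blinfun.minus_right minus_diff_eq)
      then show ?thesis by simp
    qed
    then show ?thesis using V1(6) unfolding F_def[abs_def] by simp
  qed

  \<comment> \<open>Second deformation: all forms \<open>J0 + t \<tau>\<close> and the primitive \<open>\<beta>\<close> take values in the range of \<open>P\<close>, so the
    projection in the velocity equation is vacuous.\<close>
  define \<sigma> where "\<sigma> x = P o\<^sub>L (J (P x) o\<^sub>L P)" for x
  have \<sigma>: "closed_two_form (P -` S) \<sigma>"
    unfolding \<sigma>_def by (rule closed_two_form_pullback_projection[OF S(1) J P(3)])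
  have \<sigma>0: "\<sigma> 0 = J0"
    by (rule blinfun_eqI) (simp add: \<sigma>_def J0_def[symmetric] J0P PJ0 blinfun.zero_right)
  have "open (P -` S)" by (rule open_vimage[OF S(1) linear_continuous_on[OF blinfun.bounded_linear_right]])
  moreover have "0 \<in> P -` S" using S by (simp add: blinfun.zero_right)
  ultimately obtain R where R: "R > 0" "ball 0 R \<subseteq> P -` S" using open_contains_ball by blast
  have cJ0: "closed_two_form (ball 0 R) (\<lambda>_. J0)" by (rule closed_two_form_const[OF open_ball skew0])
  define \<tau> where "\<tau> y = \<sigma> y - J0" for y
  have \<tau>: "closed_two_form (ball 0 R) \<tau>"
    unfolding \<tau>_def by (rule closed_two_form_diff[OF open_ball closed_two_form_subset[OF \<sigma> R(2)] cJ0])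
  have P\<tau>: "P (\<tau> y u) = \<tau> y u" for y u
    by (simp add: \<tau>_def \<sigma>_def blinfun.diff_left blinfun.diff_right PP PJ0)
  have \<tau>0: "\<tau> 0 = 0" by (simp add: \<tau>_def \<sigma>0)
  obtain \<beta> where \<beta>: "smooth_on (ball 0 R) \<beta>"
    "\<And>y u v. y \<in> ball 0 R \<Longrightarrow>
      fderiv \<beta> y u \<bullet> v - fderiv \<beta> y v \<bullet> u = \<tau> y u \<bullet> v"
    "\<beta> 0 = 0" "\<And>u. fderiv \<beta> 0 u = 0" "\<And>y. y \<in> ball 0 R \<Longrightarrow> P (\<beta> y) = \<beta> y"
    using poincare_two_form[OF \<tau>] R(1) \<tau>0 P\<tau> blinfun.bounded_linear_right[of P] by metis
  have z0: "bounded_linear (\<lambda>x. 0)" by (rule bounded_linear_zero)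
  obtain \<delta>2 V2 where V2: "\<delta>2 > 0" "param_smooth_on {0..1} (ball 0 \<delta>2) V2"
    "\<And>t x. t \<in> {0..1} \<Longrightarrow> x \<in> ball 0 \<delta>2 \<Longrightarrow> x + time_integral V2 t x \<in> ball 0 R"
    "\<And>t x. t \<in> {0..1} \<Longrightarrow> x \<in> ball 0 \<delta>2 \<Longrightarrow>
      P ((J0 + t *\<^sub>R \<tau> (x + time_integral V2 t x)) (V2 t x)) = - \<beta> (x + time_integral V2 t x)"
    "time_integral V2 1 0 = 0"
    "((\<lambda>x. x + time_integral V2 1 x) has_derivative (\<lambda>v. v - Q 0)) (at 0)"
    using moser_flow_exists[OF open_ball _ closed_two_formD(1)[OF cJ0] closed_two_formD(1)[OF \<tau>] \<beta>(1)
        \<tau>0 \<beta>(3,4) PP PJ0 \<beta>(5) Q1 Q2 bounded_linear_ident z0 blinfun.zero_right] R(1)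
    by auto
  define G where "G x = x + time_integral V2 1 x" for x
  have eq2: "(J0 + t *\<^sub>R \<tau> (x + time_integral V2 t x)) (V2 t x) = - \<beta> (x + time_integral V2 t x)"
    if "t \<in> {0..1}" "x \<in> ball 0 \<delta>2" for t x
    using V2(4)[OF that]
    by (simp add: blinfun.add_left blinfun.scaleR_left blinfun.add_right blinfun.scaleR_right PJ0 P\<tau>)
  have G_pull: "\<sigma> (G x) (fderiv G x u) \<bullet> fderiv G x v = J0 u \<bullet> v"
    if "x \<in> ball 0 \<delta>2" for x u v
    using moser_pullback[OF open_ball V2(2) bounded_linear_ident cJ0 \<tau> \<beta>(1,2) V2(3) eq2 that, of u v]
    unfolding G_def[abs_def] by (simp add: \<tau>_def)
  have G_smooth: "smooth_on (ball 0 \<delta>2) G"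
    unfolding G_def
    by (intro smooth_on_add smooth_on_linear_map open_ball bounded_linear_ident
        smooth_on_time_slice[OF param_smooth_on_time_integral[OF open_ball V2(2)]]) simp
  have G0: "G 0 = 0" using V2(5) by (simp add: G_def)
  have G_d: "(G has_derivative (\<lambda>v. v)) (at 0)"
    using V2(6) unfolding G_def[abs_def] by (simp add: blinfun.zero_right)

  define T where "T = G -` ball 0 \<delta>1 \<inter> ball 0 \<delta>2"
  have T: "open T" "0 \<in> T"
    unfolding T_def using V1(1) V2(1) G0
      continuous_on_open_vimage[OF open_ball, THEN iffD1, OF smooth_on_imp_continuous[OF G_smooth], rule_format, OF open_ball]
    by auto
  define H where "H x = F (G x)" for x
  have H_smooth: "smooth_on T H"
    unfolding H_def
    by (rule smooth_on_compose[OF T(1) F_smooth smooth_on_subset[OF G_smooth]]) (auto simp: T_def)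
  have H_d: "(H has_derivative (\<lambda>v. v)) (at 0)"
    unfolding H_def[abs_def] using has_derivative_compose[OF G_d, of F "\<lambda>v. v"] F_d G0 by simp
  have inj: "inj (\<lambda>v :: 'a. v)" by (simp add: inj_def)
  obtain N0 K where N0: "open N0" "0 \<in> N0" "N0 \<subseteq> T" "open (H ` N0)" "smooth_on (H ` N0) K"
    "\<And>x. x \<in> N0 \<Longrightarrow> K (H x) = x"
    by (rule smooth_local_inverse[OF T H_smooth H_d inj]) (rule that)
  have H_pull: "J (H x) (fderiv H x u) \<bullet> fderiv H x v = J0 u \<bullet> v"
    if "x \<in> T" for x u v
  proof -
    have G: "G x \<in> ball 0 \<delta>1" and x: "x \<in> ball 0 \<delta>2" using that by (auto simp: T_def)
    have "(H has_derivative (\<lambda>u. fderiv F (G x) (fderiv G x u))) (at x)"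
      unfolding H_def[abs_def]
      by (rule has_derivative_compose[OF smooth_on_has_derivative[OF G_smooth x] smooth_on_has_derivative[OF F_smooth G]])
    from frechet_derivative_at[OF this, symmetric] show ?thesis
      using F_pull[OF G] G_pull[OF x, of u v] by (simp add: H_def \<sigma>_def P(3))
  qed
  obtain a b where ab: "J0 u \<bullet> v = (\<Sum>i=1..r. (a i \<bullet> u) * (b i \<bullet> v) - (a i \<bullet> v) * (b i \<bullet> u))" for u v
    using skew_rank_normal_form[OF linJ0 skew0, of r] rank[OF S(2)] by (auto simp: J0_def)
  define q where "q i y = a i \<bullet> K y" for i :: nat and y
  define p where "p i y = b i \<bullet> K y" for i :: nat and y
  show thesis
  proof (rule that[of "H ` N0" q p])
    show "0 \<in> H ` N0" using N0(2) F0 G0 by (intro image_eqI[of _ _ 0]) (auto simp: H_def)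
    show "H ` N0 \<subseteq> S" using N0(3) F_S by (auto simp: H_def T_def)
    show "smooth_on (H ` N0) (q i)" "smooth_on (H ` N0) (p i)" for i
      unfolding q_def p_def by (intro smooth_on_linear[OF bounded_linear_inner_right N0(4,5)])+
    fix y u v assume y: "y \<in> H ` N0"
    then obtain x where x: "x \<in> N0" "y = H x" by blast
    then have xT: "x \<in> T" and Ky: "K y = x" using N0 by auto
    let ?K = "fderiv K y" and ?H = "fderiv H x"
    have dK: "(K has_derivative ?K) (at y)" by (rule smooth_on_has_derivative[OF N0(5) y])
    have dH: "(H has_derivative ?H) (at (K y))" unfolding Ky by (rule smooth_on_has_derivative[OF H_smooth xT])
    have "H (K z) = z" if "z \<in> H ` N0" for z using that N0(6) by auto
    then have "((\<lambda>z. H (K z)) has_derivative (\<lambda>v. v)) (at y)"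
      by (intro has_derivative_transform_within_open[OF has_derivative_ident N0(4) y]) auto
    from has_derivative_unique[OF has_derivative_compose[OF dK dH] this]
    have HK: "?H (?K w) = w" for w by (simp add: fun_eq_iff)
    have dq: "fderiv (q i) y w = a i \<bullet> ?K w" for i w
      using frechet_derivative_at[OF bounded_linear.has_derivative[OF bounded_linear_inner_right dK], of "a i"]
      unfolding q_def[abs_def] by (simp add: fun_eq_iff)
    have dp: "fderiv (p i) y w = b i \<bullet> ?K w" for i w
      using frechet_derivative_at[OF bounded_linear.has_derivative[OF bounded_linear_inner_right dK], of "b i"]
      unfolding p_def[abs_def] by (simp add: fun_eq_iff)
    have "J y u \<bullet> v = J0 (?K u) \<bullet> ?K v"
      using H_pull[OF xT, of "?K u" "?K v"] by (simp add: HK x(2)[symmetric])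
    then show "J y u \<bullet> v = darboux_form r q p y u v"
      by (simp add: ab dq dp)
  qed (rule N0(4))
qed

section \<open>Local coordinates on Euclidean space\<close>

lemma smooth_on_shift:
  fixes f :: "'a::euclidean_space \<Rightarrow> 'b::real_normed_vector"
  assumes S: "open S" and f: "smooth_on S f"
  shows "open ((\<lambda>z. x0 + z) -` S)" "smooth_on ((\<lambda>z. x0 + z) -` S) (\<lambda>z. f (x0 + z))"
    and "x0 + z \<in> S \<Longrightarrow> fderiv (\<lambda>z. f (x0 + z)) z = fderiv f (x0 + z)"
proof -
  show o: "open ((\<lambda>z. x0 + z) -` S)" by (rule open_vimage[OF S]) (intro continuous_intros)
  show "smooth_on ((\<lambda>z. x0 + z) -` S) (\<lambda>z. f (x0 + z))"
    by (rule smooth_on_compose[OF o f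
          smooth_on_add[OF o smooth_on_const[OF o] smooth_on_linear_map[OF o bounded_linear_ident]]]) simp
  assume "x0 + z \<in> S"
  then have "(f has_derivative fderiv f (x0 + z)) (at (x0 + z))" by (rule smooth_on_has_derivative[OF f])
  moreover have "((\<lambda>z. x0 + z) has_derivative (\<lambda>v. v)) (at z)" by (auto intro!: derivative_eq_intros)
  ultimately have "((\<lambda>z. f (x0 + z)) has_derivative fderiv f (x0 + z)) (at z)"
    using has_derivative_compose by blast
  from frechet_derivative_at[OF this, symmetric]
  show "fderiv (\<lambda>z. f (x0 + z)) z = fderiv f (x0 + z)" .
qed

theorem darboux_constant_rank:
  fixes J :: "'a::euclidean_space \<Rightarrow> 'a \<Rightarrow>\<^sub>L 'a"
  assumes S: "open S" "x0 \<in> S" and J: "closed_two_form S J"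
    and rank: "\<And>y. y \<in> S \<Longrightarrow> dim (range (J y)) = 2 * r"
  obtains N and q p :: "nat \<Rightarrow> 'a \<Rightarrow> real" where "open N" "x0 \<in> N" "N \<subseteq> S"
    "\<And>i. smooth_on N (q i)" "\<And>i. smooth_on N (p i)"
    "\<And>y u v. y \<in> N \<Longrightarrow> J y u \<bullet> v = darboux_form r q p y u v"
proof -
  let ?S = "(\<lambda>z. x0 + z) -` S" and ?J = "\<lambda>z. J (x0 + z)"
  note shift = smooth_on_shift[OF S(1) closed_two_formD(1)[OF J], of x0]
  have J': "closed_two_form ?S ?J"
    unfolding closed_two_form_def
  proof (intro conjI ballI allI)
    fix y assume "y \<in> ?S"
    then have y: "x0 + y \<in> S" by simp
    show "?J y u \<bullet> v = - (?J y v \<bullet> u)" for u v by (rule closed_two_formD(2)[OF J y])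
    show "fderiv ?J y u v \<bullet> w - fderiv ?J y v u \<bullet> w
      + fderiv ?J y w u \<bullet> v = 0" for u v w
      unfolding shift(3)[OF y] by (rule closed_two_formD(3)[OF J y])
  qed (rule shift(2))
  have z: "0 \<in> ?S" using S by simp
  obtain N and q p :: "nat \<Rightarrow> 'a \<Rightarrow> real" where N: "open N" "0 \<in> N" "N \<subseteq> ?S"
    "\<And>i. smooth_on N (q i)" "\<And>i. smooth_on N (p i)"
    "\<And>y u v. y \<in> N \<Longrightarrow> ?J y u \<bullet> v = darboux_form r q p y u v"
    by (rule darboux_constant_rank_at_0[OF shift(1) z J', of r]) (use rank in simp, rule that)
  note unshift = smooth_on_shift[OF N(1), of _ "- x0"]
  let ?N = "(\<lambda>z. - x0 + z) -` N"
  show thesis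
  proof (rule that[of ?N "\<lambda>i y. q i (- x0 + y)" "\<lambda>i y. p i (- x0 + y)"])
    show "open ?N" by (rule unshift(1)[OF N(4)])
    show "smooth_on ?N (\<lambda>y. q i (- x0 + y))" "smooth_on ?N (\<lambda>y. p i (- x0 + y))" for i
      by (rule unshift(2)[OF N(4)], rule unshift(2)[OF N(5)])
    show "?N \<subseteq> S" using N(3) by auto
    fix y u v assume "y \<in> ?N"
    then have y: "- x0 + y \<in> N" by simp
    then show "J y u \<bullet> v = (\<Sum>i=1..r.
        fderiv (\<lambda>y. q i (- x0 + y)) y u * fderiv (\<lambda>y. p i (- x0 + y)) y v
        - fderiv (\<lambda>y. q i (- x0 + y)) y v * fderiv (\<lambda>y. p i (- x0 + y)) y u)"
      using N(6)[OF y, of u v] unfolding unshift(3)[OF N(4) y] unshift(3)[OF N(5) y] by simp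
  qed (use N(2) in simp)
qed

lemma local_potential:
  fixes \<eta> :: "'a::euclidean_space \<Rightarrow> 'a"
  assumes S: "open S" "x0 \<in> S" and \<eta>: "smooth_on S \<eta>"
    and closed: "\<And>y u v. y \<in> S \<Longrightarrow>
      fderiv \<eta> y u \<bullet> v = fderiv \<eta> y v \<bullet> u"
  obtains N f where "open N" "x0 \<in> N" "N \<subseteq> S" "smooth_on N f"
    "\<And>y. y \<in> N \<Longrightarrow> (f has_derivative (\<lambda>v. \<eta> y \<bullet> v)) (at y)"
proof -
  obtain R where R: "R > 0" "ball x0 R \<subseteq> S" using S open_contains_ball by blast
  have sub: "ball 0 R \<subseteq> (\<lambda>z. x0 + z) -` S"
  proof
    fix z :: 'a assume "z \<in> ball 0 R"
    then have "x0 + z \<in> ball x0 R" by (simp add: dist_norm)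
    then show "z \<in> (\<lambda>z. x0 + z) -` S" using R by auto
  qed
  note shift = smooth_on_shift[OF S(1) \<eta>, of x0]
  have cl: "fderiv (\<lambda>z. \<eta> (x0 + z)) y u \<bullet> v = fderiv (\<lambda>z. \<eta> (x0 + z)) y v \<bullet> u"
    if "y \<in> ball 0 R" for y u v
  proof -
    have y: "x0 + y \<in> S" using that sub by auto
    show ?thesis unfolding shift(3)[OF y] by (rule closed[OF y])
  qed
  obtain f where f: "smooth_on (ball 0 R) f"
    "\<And>y. y \<in> ball 0 R \<Longrightarrow> (f has_derivative (\<lambda>v. \<eta> (x0 + y) \<bullet> v)) (at y)"
    by (rule poincare_one_form[OF smooth_on_subset[OF shift(2) sub] cl]) (assumption, rule that)
  note unshift = smooth_on_shift[OF open_ball f(1), of "- x0"]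
  let ?N = "(\<lambda>z. - x0 + z) -` ball 0 R"
  show thesis
  proof (rule that[OF unshift(1) _ _ unshift(2)])
    show "?N \<subseteq> S" using sub by fastforce
    fix y assume "y \<in> ?N"
    then have y: "- x0 + y \<in> ball 0 R" by (simp only: vimage_eq)
    have "((\<lambda>z. - x0 + z) has_derivative (\<lambda>v. v)) (at y)" by (auto intro!: derivative_eq_intros)
    from has_derivative_compose[OF this f(2)[OF y]]
    show "((\<lambda>z. f (- x0 + z)) has_derivative (\<lambda>v. \<eta> y \<bullet> v)) (at y)" by simp
  qed (use R in simp)
qed

text \<open>Basis extension; the given list need not be independent.\<close>

lemma complete_to_spanning_list:
  fixes cs :: "'a::euclidean_space list"
  obtains ds where "length ds = DIM('a) - dim (set cs)" "span (set (cs @ ds)) = UNIV"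
proof -
  obtain B0 where B0: "B0 \<subseteq> set cs" "independent B0" "set cs \<subseteq> span B0" "card B0 = dim (set cs)"
    using basis_exists by blast
  obtain B where B: "B0 \<subseteq> B" "independent B" "UNIV \<subseteq> span B"
    using maximal_independent_subset_extend[OF subset_UNIV B0(2)] by metis
  have fin: "finite B" using B(2) independent_imp_finite by blast
  have "card B = DIM('a)"
    using basis_card_eq_dim[OF subset_UNIV B(3,2)] by simp
  then have card: "card (B - B0) = DIM('a) - dim (set cs)"
    using B0(4) B(1) fin by (simp add: card_Diff_subset finite_subset)
  obtain ds where ds: "set ds = B - B0" "distinct ds" using finite_distinct_list[of "B - B0"] fin by auto
  show thesis
  proof (rule that)
    show "length ds = DIM('a) - dim (set cs)" using ds card distinct_card by metis
    have "B \<subseteq> set (cs @ ds)" using ds B0(1) by auto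
    then show "span (set (cs @ ds)) = UNIV" using B(3) span_mono by blast
  qed
qed

text \<open>The gradients at \<open>x0\<close> of the \<open>q i\<close> and \<open>p i\<close> span the range of \<open>J x0\<close>: they span at least the range, by the
  formula for \<open>J\<close>, and there are only \<open>2 r\<close> of them. All elements of the range are orthogonal to the
  kernel vector \<open>k\<close>, but \<open>\<eta> x0\<close> is not. Hence \<open>2 r + 1\<close> coordinates have independent gradients, and linear
  functions \<open>z j\<close> supply the remaining ones.\<close>

theorem precosymplectic_local_coordinates:
  fixes J :: "'a::euclidean_space \<Rightarrow> 'a \<Rightarrow>\<^sub>L 'a" and \<eta> :: "'a \<Rightarrow> 'a" and bs :: "'a list"
  assumes S: "open S" "x0 \<in> S" and J: "closed_two_form S J"
    and rank: "\<And>y. y \<in> S \<Longrightarrow> dim (range (J y)) = 2 * r"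
    and \<eta>: "smooth_on S \<eta>" and d\<eta>: "\<And>y u v. y \<in> S \<Longrightarrow>
      fderiv \<eta> y u \<bullet> v = fderiv \<eta> y v \<bullet> u"
    and k: "J x0 k = 0" "\<eta> x0 \<bullet> k \<noteq> 0"
    and bs: "distinct bs" "set bs = Basis"
  obtains N t and q p z :: "nat \<Rightarrow> 'a \<Rightarrow> real" and fl \<phi> G where
    "open N" "x0 \<in> N" "N \<subseteq> S"
    "fl = [t] @ map q [1..<r + 1] @ map p [1..<r + 1] @ map z [1..<(DIM('a) - 1 - 2 * r) + 1]"
    "length fl = DIM('a)" "\<And>f. f \<in> set fl \<Longrightarrow> smooth_on N f"
    "\<phi> = (\<lambda>y. \<Sum>i<DIM('a). (fl ! i) y *\<^sub>R (bs ! i))" "smooth_on N \<phi>"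
    "open (\<phi> ` N)" "smooth_on (\<phi> ` N) G" "\<And>y. y \<in> N \<Longrightarrow> G (\<phi> y) = y"
    "\<And>y v. y \<in> N \<Longrightarrow> fderiv t y v = \<eta> y \<bullet> v"
    "\<And>y u v. y \<in> N \<Longrightarrow> J y u \<bullet> v = darboux_form r q p y u v"
proof -
  note [simp del] = upt_Suc
  obtain N1 and q p :: "nat \<Rightarrow> 'a \<Rightarrow> real" where N1: "open N1" "x0 \<in> N1" "N1 \<subseteq> S"
    "\<And>i. smooth_on N1 (q i)" "\<And>i. smooth_on N1 (p i)"
    "\<And>y u v. y \<in> N1 \<Longrightarrow> J y u \<bullet> v = darboux_form r q p y u v"
    by (rule darboux_constant_rank[OF S J rank]) (assumption, rule that)
  obtain N2 t where N2: "open N2" "x0 \<in> N2" "N2 \<subseteq> S" "smooth_on N2 t"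
    "\<And>y. y \<in> N2 \<Longrightarrow> (t has_derivative (\<lambda>v. \<eta> y \<bullet> v)) (at y)"
    by (rule local_potential[OF S \<eta> d\<eta>]) (assumption, rule that)
  define grad where "grad f = (\<Sum>i\<in>Basis. fderiv f x0 i *\<^sub>R i)" for f :: "'a \<Rightarrow> real"
  have grad: "(f has_derivative (\<lambda>v. grad f \<bullet> v)) (at x0)" if f: "smooth_on N1 f" for f
  proof -
    have d: "(f has_derivative fderiv f x0) (at x0)" by (rule smooth_on_has_derivative[OF f N1(2)])
    have eq: "fderiv f x0 v = grad f \<bullet> v" for v
    proof -
      have "fderiv f x0 v = (\<Sum>i\<in>Basis. (v \<bullet> i) *\<^sub>R fderiv f x0 i)"
        by (rule linear_eq_sum_Basis[OF has_derivative_linear[OF d]])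
      then show ?thesis by (simp add: grad_def inner_sum_left inner_commute[of v] mult.commute)
    qed
    show ?thesis by (rule has_derivative_eq_rhs[OF d ext]) (rule eq)
  qed
  define a where "a i = grad (q i)" for i
  define b where "b i = grad (p i)" for i
  have fq: "fderiv (q i) x0 v = a i \<bullet> v" and fp: "fderiv (p i) x0 v = b i \<bullet> v" for i v
    using frechet_derivative_at[OF grad[OF N1(4)]] frechet_derivative_at[OF grad[OF N1(5)]]
    by (simp_all add: a_def b_def fun_eq_iff)
  define ab where "ab = map a [1..<r + 1] @ map b [1..<r + 1]"
  have set_ab: "set ab = a ` {1..r} \<union> b ` {1..r}"
    by (simp add: ab_def atLeastLessThanSuc_atLeastAtMost del: upt_Suc)
  have "J x0 u \<in> span (set ab)" for u
  proof -
    have "J x0 u = (\<Sum>i=1..r. (a i \<bullet> u) *\<^sub>R b i - (b i \<bullet> u) *\<^sub>R a i)"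
    proof (rule vector_eq_ldot[THEN iffD1, rule_format])
      fix v
      show "v \<bullet> J x0 u = v \<bullet> (\<Sum>i=1..r. (a i \<bullet> u) *\<^sub>R b i - (b i \<bullet> u) *\<^sub>R a i)"
        using N1(6)[OF N1(2), of u v]
        by (simp add: fq fp inner_sum_right inner_diff_right inner_commute[of v] mult.commute)
    qed
    moreover have "a i \<in> span (set ab)" "b i \<in> span (set ab)" if "i \<in> {1..r}" for i
      using that unfolding set_ab by (auto intro!: span_base)
    ultimately show ?thesis by (auto intro!: span_sum span_diff span_scale)
  qed
  then have sub: "range (J x0) \<subseteq> span (set ab)" by auto
  have "dim (set ab) \<le> card (set ab)" by (rule dim_le_card) (auto intro: span_base)
  also have "\<dots> \<le> 2 * r" using card_length[of ab] by (simp add: ab_def)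
  finally have dab: "dim (set ab) \<le> 2 * r" .
  have sR: "subspace (range (J x0))"
    using linear_subspace_image[OF bounded_linear.linear[OF blinfun.bounded_linear_right] subspace_UNIV] by blast
  have R: "range (J x0) = span (set ab)"
    by (rule subspace_dim_equal[OF sR subspace_span sub]) (use dab rank[OF S(2)] in simp)
  have ninj: "\<eta> x0 \<notin> span (set ab)"
  proof
    assume "\<eta> x0 \<in> span (set ab)"
    then obtain w where "\<eta> x0 = J x0 w" unfolding R[symmetric] by auto
    then have "\<eta> x0 \<bullet> k = - (J x0 k \<bullet> w)" using closed_two_formD(2)[OF J S(2), of w k] by simp
    then show False using k by simp
  qed
  define cs where "cs = \<eta> x0 # ab"
  have dcs: "dim (set cs) = 2 * r + 1"
  proof -
    have "dim (set ab) = 2 * r" using R rank[OF S(2)] by (metis dim_span)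
    then show ?thesis using ninj by (simp add: cs_def dim_insert)
  qed
  obtain ds where ds: "length ds = DIM('a) - dim (set cs)" "span (set (cs @ ds)) = UNIV"
    by (rule complete_to_spanning_list)
  have le: "2 * r + 1 \<le> DIM('a)" using dcs dim_subset_UNIV[of "set cs"] by simp
  define z where "z j y = ds ! (j - 1) \<bullet> y" for j y
  define fl where "fl = [t] @ map q [1..<r + 1] @ map p [1..<r + 1] @ map z [1..<(DIM('a) - 1 - 2 * r) + 1]"
  have lds: "length ds = DIM('a) - 1 - 2 * r" using ds(1) dcs by simp
  have len: "length fl = DIM('a)" using le by (simp add: fl_def)
  have "map (\<lambda>j. ds ! (j - 1)) [1..<(DIM('a) - 1 - 2 * r) + 1] = ds"
    by (rule nth_equalityI) (simp_all add: lds)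
  then have cs_ds: "cs @ ds = [\<eta> x0] @ map a [1..<r + 1] @ map b [1..<r + 1] @
      map (\<lambda>j. ds ! (j - 1)) [1..<(DIM('a) - 1 - 2 * r) + 1]"
    by (simp add: cs_def ab_def)
  have "list_all2 (\<lambda>f c. (f has_derivative (\<lambda>v. c \<bullet> v)) (at x0)) fl (cs @ ds)"
    unfolding cs_ds fl_def
    by (intro list_all2_appendI)
      (auto simp: list_all2_map1 list_all2_map2 list_all2_same N2(5)[OF N2(2)] a_def b_def z_def[abs_def]
        grad[OF N1(4)] grad[OF N1(5)] bounded_linear_imp_has_derivative[OF bounded_linear_inner_right])
  then have dfl: "(fl ! i has_derivative (\<lambda>v. (cs @ ds) ! i \<bullet> v)) (at x0)" if "i < DIM('a)" for i
    using that len by (auto simp: list_all2_conv_all_nth)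
  have lcs: "length (cs @ ds) = DIM('a)" using le lds by (simp add: cs_def ab_def)
  define N3 where "N3 = N1 \<inter> N2"
  have N3: "open N3" "x0 \<in> N3" "N3 \<subseteq> S" using N1 N2 by (auto simp: N3_def)
  have sm: "smooth_on N3 f" if "f \<in> set fl" for f
    using that smooth_on_subset[OF N2(4), of N3] smooth_on_subset[OF N1(4), of N3] smooth_on_subset[OF N1(5), of N3]
      smooth_on_linear_map[OF N3(1) bounded_linear_inner_right]
    by (auto simp: fl_def N3_def z_def[abs_def])
  define \<phi> where "\<phi> y = (\<Sum>i<DIM('a). (fl ! i) y *\<^sub>R (bs ! i))" for y
  have sm\<phi>: "smooth_on N3 \<phi>"
    unfolding \<phi>_def
    by (intro smooth_on_sum N3(1) smooth_on_linear[OF bounded_linear_scaleR_left] sm) (simp add: len)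
  define L where "L v = (\<Sum>i<DIM('a). ((cs @ ds) ! i \<bullet> v) *\<^sub>R (bs ! i))" for v
  have d\<phi>: "(\<phi> has_derivative L) (at x0)"
    unfolding \<phi>_def[abs_def] L_def[abs_def]
    by (intro has_derivative_sum bounded_linear.has_derivative[OF bounded_linear_scaleR_left] dfl) simp
  have lbs: "length bs = DIM('a)" using bs distinct_card by metis
  have "inj L"
  proof (rule linear_injective_0[OF has_derivative_linear[OF d\<phi>], THEN iffD2], intro allI impI)
    fix v assume v: "L v = 0"
    have "(cs @ ds) ! j \<bullet> v = 0" if j: "j < DIM('a)" for j
    proof -
      have "L v \<bullet> bs ! j = (\<Sum>i<DIM('a). if i = j then (cs @ ds) ! i \<bullet> v else 0)"
        unfolding L_def inner_sum_left
      proof (rule sum.cong)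
        fix i assume i: "i \<in> {..<DIM('a)}"
        have "bs ! i \<in> set bs" "bs ! j \<in> set bs" using i j lbs by simp_all
        moreover have "bs ! i = bs ! j \<longleftrightarrow> i = j"
          using nth_eq_iff_index_eq[OF bs(1)] i j lbs by simp
        ultimately show "((cs @ ds) ! i \<bullet> v) *\<^sub>R bs ! i \<bullet> bs ! j = (if i = j then (cs @ ds) ! i \<bullet> v else 0)"
          unfolding bs(2) by (simp add: inner_Basis)
      qed simp
      then show ?thesis using v j by simp
    qed
    then have "c \<bullet> v = 0" if "c \<in> set (cs @ ds)" for c
      using that lcs by (metis in_set_conv_nth)
    then have "span (set (cs @ ds)) \<subseteq> {c. v \<bullet> c = 0}"
      by (intro span_minimal subspace_hyperplane) (auto simp: inner_commute)
    then have "v \<bullet> v = 0" using ds(2) by blast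
    then show "v = 0" by simp
  qed
  then obtain N G where N: "open N" "x0 \<in> N" "N \<subseteq> N3" "open (\<phi> ` N)" "smooth_on (\<phi> ` N) G"
    "\<And>x. x \<in> N \<Longrightarrow> G (\<phi> x) = x"
    using smooth_local_inverse[OF N3(1,2) sm\<phi> d\<phi>] by blast
  show thesis
  proof (rule that[of N fl t q p z \<phi> G])
    show "fderiv t y v = \<eta> y \<bullet> v" if "y \<in> N" for y v
      using frechet_derivative_at[OF N2(5), of y] that N(3) by (simp add: N3_def subset_iff fun_eq_iff)
    show "J y u \<bullet> v = darboux_form r q p y u v" if "y \<in> N" for y u v
      using N1(6) that N(3) by (auto simp: N3_def)
    show "smooth_on N f" if "f \<in> set fl" for f by (rule smooth_on_subset[OF sm[OF that] N(3)])
    show "smooth_on N \<phi>" by (rule smooth_on_subset[OF sm\<phi> N(3)])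
    show "\<phi> = (\<lambda>y. \<Sum>i<DIM('a). (fl ! i) y *\<^sub>R (bs ! i))" by (rule ext) (rule \<phi>_def)
  qed (use N N3(3) len fl_def in auto)
qed

section \<open>Forms and charts on a manifold\<close>

lemma is_chartD:
  fixes c :: "('m::topological_space, 'e::euclidean_space) chart"
  assumes "is_chart c"
  shows "open (chart_dom c)" "open (chart_map c ` chart_dom c)"
    "x \<in> chart_dom c \<Longrightarrow> chart_inv c (chart_map c x) = x"
    "open U \<Longrightarrow> open (chart_map c ` (U \<inter> chart_dom c))"
    "continuous_on (chart_dom c) (chart_map c)"
    "continuous_on (chart_map c ` chart_dom c) (chart_inv c)"
proof -
  have h: "homeomorphism (chart_dom c) (chart_map c ` chart_dom c) (chart_map c) (chart_inv c)"
    and o: "open (chart_dom c)" "open (chart_map c ` chart_dom c)"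
    using assms by (auto simp: is_chart_def)
  show "open (chart_dom c)" "open (chart_map c ` chart_dom c)" by (fact o)+
  show "x \<in> chart_dom c \<Longrightarrow> chart_inv c (chart_map c x) = x"
    "continuous_on (chart_dom c) (chart_map c)" "continuous_on (chart_map c ` chart_dom c) (chart_inv c)"
    using h by (auto simp: homeomorphism_def)
  assume "open U"
  then have "openin (top_of_set (chart_dom c)) (U \<inter> chart_dom c)" by (auto simp: openin_open)
  from homeomorphism_imp_open_map[OF h this] show "open (chart_map c ` (U \<inter> chart_dom c))"
    using o(2) openin_open_eq by blast
qed

text \<open>The inverse of a chart is fixed as \<open>inv_into\<close>, whereas homeomorphisms come with an inverse of
  their own; on the image they agree.\<close>

lemma is_chartI:
  fixes f :: "'m::topological_space \<Rightarrow> 'e::euclidean_space"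
  assumes "open U" "open V" and h: "homeomorphism U V f g"
  shows "is_chart (U, f)" "y \<in> V \<Longrightarrow> chart_inv (U, f) y = g y"
proof -
  have V: "f ` U = V" using h by (simp add: homeomorphism_def)
  show eq: "chart_inv (U, f) y = g y" if "y \<in> V" for y
  proof -
    have "f (g y) = y" "g y \<in> U" using h that by (auto simp: homeomorphism_def)
    moreover have "inj_on f U" using h by (auto simp: homeomorphism_def intro: inj_on_inverseI)
    ultimately show ?thesis unfolding chart_inv_def by (metis fst_conv inv_into_f_f snd_conv)
  qed
  have "homeomorphism U (f ` U) f (chart_inv (U, f))"
    unfolding V by (rule homeomorphism_cong[OF h]) (auto simp: eq)
  then show "is_chart (U, f)" using assms V by (simp add: is_chart_def)
qed

lemma maximal_smooth_atlasD:
  assumes "maximal_smooth_atlas A"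
  shows "c \<in> A \<Longrightarrow> is_chart c" "\<exists>c\<in>A. x \<in> chart_dom c"
    "c \<in> A \<Longrightarrow> d \<in> A \<Longrightarrow> smooth_on (chart_map c ` (chart_dom c \<inter> chart_dom d)) (transition c d)"
    "is_chart c \<Longrightarrow> (\<And>d. d \<in> A \<Longrightarrow> smoothly_compatible c d) \<Longrightarrow> c \<in> A"
  using assms unfolding maximal_smooth_atlas_def smoothly_compatible_def by blast+

lemma transition_apply: "is_chart c \<Longrightarrow> x \<in> chart_dom c \<Longrightarrow> transition c d (chart_map c x) = chart_map d x"
  by (simp add: transition_def is_chartD(3))

lemma transition_has_derivative:
  assumes "maximal_smooth_atlas A" "c \<in> A" "d \<in> A" "x \<in> chart_dom c" "x \<in> chart_dom d"
  shows "(transition c d has_derivative fderiv (transition c d) (chart_map c x)) (at (chart_map c x))"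
  by (rule smooth_on_has_derivative[OF maximal_smooth_atlasD(3)[OF assms(1-3)]]) (use assms in auto)

text \<open>The chain rule for transition maps, on which all compatibilities between charts below rest.\<close>

lemma transition_cocycle:
  assumes A: "maximal_smooth_atlas A" and cde: "c \<in> A" "d \<in> A" "e \<in> A"
    and x: "x \<in> chart_dom c" "x \<in> chart_dom d" "x \<in> chart_dom e"
  shows "fderiv (transition d e) (chart_map d x)
      (fderiv (transition c d) (chart_map c x) u) =
    fderiv (transition c e) (chart_map c x) u"
proof -
  note ch = maximal_smooth_atlasD(1)[OF A]
  have de: "(transition d e has_derivative fderiv (transition d e) (chart_map d x))
      (at (transition c d (chart_map c x)))"
    unfolding transition_apply[OF ch[OF cde(1)] x(1)]
    by (rule transition_has_derivative[OF A cde(2,3) x(2,3)])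
  have "((\<lambda>y. transition d e (transition c d y)) has_derivative
      (\<lambda>u. fderiv (transition d e) (chart_map d x)
        (fderiv (transition c d) (chart_map c x) u))) (at (chart_map c x))"
    by (rule has_derivative_compose[OF transition_has_derivative[OF A cde(1,2) x(1,2)] de])
  then have "(transition c e has_derivative
      (\<lambda>u. fderiv (transition d e) (chart_map d x)
        (fderiv (transition c d) (chart_map c x) u))) (at (chart_map c x))"
  proof (rule has_derivative_transform_within_open)
    show "open (chart_map c ` (chart_dom d \<inter> chart_dom c))"
      by (rule is_chartD(4)[OF ch[OF cde(1)] is_chartD(1)[OF ch[OF cde(2)]]])
    fix y assume "y \<in> chart_map c ` (chart_dom d \<inter> chart_dom c)"
    then obtain z where "z \<in> chart_dom d" "z \<in> chart_dom c" "y = chart_map c z" by blast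
    then show "transition d e (transition c d y) = transition c e y"
      using ch cde by (simp add: transition_apply)
  qed (use x in auto)
  from frechet_derivative_at[OF this, symmetric] show ?thesis by simp
qed

lemma transition_self_derivative:
  assumes A: "maximal_smooth_atlas A" and c: "c \<in> A" and x: "x \<in> chart_dom c"
  shows "fderiv (transition c c) (chart_map c x) u = u"
proof -
  note ch = maximal_smooth_atlasD(1)[OF A c]
  have "(transition c c has_derivative (\<lambda>u. u)) (at (chart_map c x))"
    by (rule has_derivative_transform_within_open[OF has_derivative_ident is_chartD(2)[OF ch]])
      (use x ch in \<open>auto simp: transition_apply\<close>)
  from frechet_derivative_at[OF this, symmetric] show ?thesis by simp
qed

lemma coord_vect_in_tangent_space:
  assumes A: "maximal_smooth_atlas A" and c: "c \<in> A" "x \<in> chart_dom c"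
  shows "coord_vect A c x u \<in> tangent_space A x"
  unfolding tangent_space_def coord_vect_def
  using transition_cocycle[OF A c(1) _ _ c(2)] by auto

lemma coord_vect_component:
  assumes A: "maximal_smooth_atlas A" and c: "c \<in> A" "x \<in> chart_dom c"
  shows "coord_vect A c x u c = u"
  using transition_self_derivative[OF A c] c by (simp add: coord_vect_def)

lemma tangent_vector_components:
  assumes v: "v \<in> tangent_space A x" and "c \<in> A" "d \<in> A" "x \<in> chart_dom c" "x \<in> chart_dom d"
  shows "v d = fderiv (transition c d) (chart_map c x) (v c)"
  by (rule CollectD[OF v[unfolded tangent_space_def], THEN conjunct1, rule_format]) (use assms in auto)

lemma tangent_vector_eq_coord_vect:
  assumes "c \<in> A" "x \<in> chart_dom c" "v \<in> tangent_space A x"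
  shows "coord_vect A c x (v c) = v"
proof
  fix d
  have "d \<in> A \<Longrightarrow> x \<in> chart_dom d \<Longrightarrow>
      v d = fderiv (transition c d) (chart_map c x) (v c)"
    by (rule tangent_vector_components[OF assms(3,1) _ assms(2)])
  moreover have "d \<notin> A \<or> x \<notin> chart_dom d \<Longrightarrow> v d = 0"
    using CollectD[OF assms(3)[unfolded tangent_space_def], THEN conjunct2] by blast
  ultimately show "coord_vect A c x (v c) d = v d" unfolding coord_vect_def by presburger
qed

lemma linear_coord_vect:
  assumes A: "maximal_smooth_atlas A" and c: "c \<in> A" "x \<in> chart_dom c"
  shows "coord_vect A c x (u + w) = coord_vect A c x u + coord_vect A c x w"
    "coord_vect A c x (a *\<^sub>R u) = a *\<^sub>R coord_vect A c x u"
proof -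
  have lin: "linear (fderiv (transition c d) (chart_map c x))"
    if "d \<in> A" "x \<in> chart_dom d" for d
    using has_derivative_linear[OF transition_has_derivative[OF A c(1) that(1) c(2) that(2)]] .
  show "coord_vect A c x (u + w) = coord_vect A c x u + coord_vect A c x w"
    "coord_vect A c x (a *\<^sub>R u) = a *\<^sub>R coord_vect A c x u"
    using linear_add[OF lin] linear_cmul[OF lin]
    by (auto simp: coord_vect_def fun_eq_iff scaleR_fun_def)
qed

text \<open>The differential is defined through an arbitrarily chosen chart; this makes it computable
  in any chart.\<close>

lemma differential_in_chart:
  assumes A: "maximal_smooth_atlas A" and c: "c \<in> A" and y: "y \<in> chart_dom c"
    and g: "(g has_derivative g') (at (chart_map c y))" and v: "v \<in> tangent_space A y"
  shows "differential A (\<lambda>x. g (chart_map c x)) y v = g' (v c)"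
proof -
  define d where "d = (SOME d. d \<in> A \<and> y \<in> chart_dom d)"
  have "\<exists>d. d \<in> A \<and> y \<in> chart_dom d" using c y by blast
  then have d: "d \<in> A" "y \<in> chart_dom d" unfolding d_def by (metis (mono_tags, lifting) someI_ex)+
  have g1: "(g has_derivative g') (at (transition d c (chart_map d y)))"
    unfolding transition_apply[OF maximal_smooth_atlasD(1)[OF A d(1)] d(2)] by (rule g)
  have "((\<lambda>z. g (transition d c z)) has_derivative
      (\<lambda>u. g' (fderiv (transition d c) (chart_map d y) u))) (at (chart_map d y))"
    by (rule has_derivative_compose[OF transition_has_derivative[OF A d(1) c d(2) y] g1])
  from frechet_derivative_at[OF this, symmetric]
  have "differential A (\<lambda>x. g (chart_map c x)) y v =
      g' (fderiv (transition d c) (chart_map d y) (v d))"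
    unfolding differential_def d_def[symmetric] Let_def by (simp add: transition_def o_def)
  also have "fderiv (transition d c) (chart_map d y) (v d) = v c"
    by (rule tangent_vector_components[OF v d(1) c d(2) y, symmetric])
  finally show ?thesis .
qed

text \<open>Composing a chart with a local diffeomorphism of the model space gives a chart compatible with all
  others, which belongs to the atlas by maximality.\<close>

lemma chart_from_local_diffeomorphism:
  fixes A :: "('m::topological_space, 'e::euclidean_space) chart set"
  assumes A: "maximal_smooth_atlas A" and c: "c \<in> A"
    and N: "open N" "N \<subseteq> chart_map c ` chart_dom c" and \<phi>: "smooth_on N \<phi>" "open (\<phi> ` N)"
    and G: "smooth_on (\<phi> ` N) G" "\<And>y. y \<in> N \<Longrightarrow> G (\<phi> y) = y"
  defines "U \<equiv> {x \<in> chart_dom c. chart_map c x \<in> N}"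
  shows "(U, \<lambda>x. \<phi> (chart_map c x)) \<in> A" "open U"
proof -
  let ?d = "(U, \<lambda>x. \<phi> (chart_map c x))"
  note ch = maximal_smooth_atlasD(1)[OF A]
  note C = is_chartD[OF ch[OF c]]
  have mapU: "chart_map c ` U = N" using N by (auto simp: U_def)
  show U: "open U"
    using continuous_on_open_vimage[OF C(1), THEN iffD1, OF C(5), rule_format, OF N(1)]
    by (simp add: U_def vimage_def Int_def conj_commute)
  have h: "homeomorphism U (\<phi> ` N) (\<lambda>x. \<phi> (chart_map c x)) (\<lambda>y. chart_inv c (G y))"
    unfolding homeomorphism_def
  proof (intro conjI ballI)
    show "continuous_on U (\<lambda>x. \<phi> (chart_map c x))"
      by (rule continuous_on_compose2[OF smooth_on_imp_continuous[OF \<phi>(1)] continuous_on_subset[OF C(5)]])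
        (auto simp: U_def)
    show "continuous_on (\<phi> ` N) (\<lambda>y. chart_inv c (G y))"
      by (rule continuous_on_compose2[OF C(6) smooth_on_imp_continuous[OF G(1)]]) (use G N in auto)
    show "(\<lambda>x. \<phi> (chart_map c x)) ` U = \<phi> ` N" using mapU by auto
    have Uinv: "chart_inv c y \<in> U" "chart_map c (chart_inv c y) = y" if "y \<in> N" for y
      using that N(2) C(3) by (auto simp: U_def)
    show "(\<lambda>y. chart_inv c (G y)) ` \<phi> ` N = U"
    proof
      show "(\<lambda>y. chart_inv c (G y)) ` \<phi> ` N \<subseteq> U" using G(2) Uinv by auto
      show "U \<subseteq> (\<lambda>y. chart_inv c (G y)) ` \<phi> ` N"
      proof
        fix x assume "x \<in> U"
        then have "chart_map c x \<in> N" "chart_inv c (chart_map c x) = x" using C(3) by (auto simp: U_def)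
        then show "x \<in> (\<lambda>y. chart_inv c (G y)) ` \<phi> ` N"
          by (intro image_eqI[of _ _ "\<phi> (chart_map c x)"] imageI) (simp_all add: G(2))
      qed
    qed
    show "chart_inv c (G (\<phi> (chart_map c x))) = x" if "x \<in> U" for x
      using that G(2) C(3) by (simp add: U_def)
    show "\<phi> (chart_map c (chart_inv c (G y))) = y" if "y \<in> \<phi> ` N" for y
      using that G(2) Uinv by auto
  qed
  note d = is_chartI[OF U \<phi>(2) h]
  show "?d \<in> A"
  proof (rule maximal_smooth_atlasD(4)[OF A d(1)])
    fix e assume e: "e \<in> A"
    note E = is_chartD[OF ch[OF e]]
    have tce: "smooth_on (chart_map c ` (chart_dom c \<inter> chart_dom e)) (transition c e)"
      and tec: "smooth_on (chart_map e ` (chart_dom e \<inter> chart_dom c)) (transition e c)"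
      by (rule maximal_smooth_atlasD(3)[OF A c e], rule maximal_smooth_atlasD(3)[OF A e c])
    show "smoothly_compatible ?d e"
      unfolding smoothly_compatible_def fst_conv snd_conv
    proof
      let ?X = "(\<lambda>x. \<phi> (chart_map c x)) ` (U \<inter> chart_dom e)"
      have o: "open ?X" using is_chartD(4)[OF d(1) E(1)] by (simp add: Int_commute)
      have sub: "?X \<subseteq> \<phi> ` N" by (auto simp: U_def)
      have "smooth_on ?X (\<lambda>y. transition c e (G y))"
        by (rule smooth_on_compose[OF o tce smooth_on_subset[OF G(1) sub]]) (auto simp: U_def G(2))
      then show "smooth_on ?X (transition ?d e)"
        by (rule smooth_on_cong[OF o]) (use sub d(2) in \<open>auto simp: transition_def\<close>)
    next
      let ?X = "chart_map e ` (U \<inter> chart_dom e)"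
      have o: "open ?X" by (rule E(4)[OF U])
      have "smooth_on ?X (transition e c)"
        by (rule smooth_on_subset[OF tec]) (auto simp: U_def)
      then have "smooth_on ?X (\<lambda>y. \<phi> (transition e c y))"
        by (rule smooth_on_compose[OF o \<phi>(1)]) (auto simp: U_def transition_apply ch e)
      then show "smooth_on ?X (transition e ?d)"
        by (rule smooth_on_cong[OF o]) (auto simp: transition_def)
    qed
  qed
qed

lemma frechet_derivative_inner_right:
  fixes f :: "'a::euclidean_space \<Rightarrow> 'b::euclidean_space"
  assumes "smooth_on S f" "open S" "y \<in> S" "\<And>z. z \<in> S \<Longrightarrow> g z = f z \<bullet> v"
  shows "fderiv g y u = fderiv f y u \<bullet> v"
proof -
  have "((\<lambda>z. f z \<bullet> v) has_derivative (\<lambda>u. fderiv f y u \<bullet> v)) (at y)"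
    by (rule bounded_linear.has_derivative[OF bounded_linear_inner_left smooth_on_has_derivative[OF assms(1,3)]])
  then have "(g has_derivative (\<lambda>u. fderiv f y u \<bullet> v)) (at y)"
    by (rule has_derivative_transform_within_open[OF _ assms(2,3)]) (simp add: assms(4))
  from frechet_derivative_at[OF this, symmetric] show ?thesis by simp
qed

lemma form1_in_chart:
  fixes A :: "('m::topological_space, 'e::euclidean_space) chart set"
  assumes A: "maximal_smooth_atlas A" and c: "c \<in> A" and \<eta>: "closed_form1 A \<eta>"
  obtains n where "smooth_on (chart_map c ` chart_dom c) n"
    "\<And>y u v. y \<in> chart_map c ` chart_dom c \<Longrightarrow> fderiv n y u \<bullet> v = fderiv n y v \<bullet> u"
    "\<And>x v. x \<in> chart_dom c \<Longrightarrow> v \<in> tangent_space A x \<Longrightarrow> \<eta> x v = n (chart_map c x) \<bullet> v c"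
proof -
  let ?E = "chart_map c ` chart_dom c"
  note C = is_chartD[OF maximal_smooth_atlasD(1)[OF A c]]
  have sf: "smooth_form1 A \<eta>" using \<eta> by (simp add: closed_form1_def)
  define n where "n y = (\<Sum>i\<in>Basis. comp1 A \<eta> c y i *\<^sub>R i)" for y
  have lin: "linear (comp1 A \<eta> c y)" if y: "y \<in> ?E" for y
  proof -
    have x: "chart_inv c y \<in> chart_dom c" using y C(3) by auto
    have l: "linear_form_on (tangent_space A (chart_inv c y)) (\<eta> (chart_inv c y))"
      using sf by (simp add: smooth_form1_def)
    show ?thesis
      unfolding comp1_def
      by (rule linearI)
        (use l coord_vect_in_tangent_space[OF A c x] in \<open>simp_all add: linear_coord_vect[OF A c x] linear_form_on_def\<close>)
  qed
  have n: "comp1 A \<eta> c y v = n y \<bullet> v" if "y \<in> ?E" for y v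
    using linear_eq_sum_Basis[OF lin[OF that], of v]
    by (simp add: n_def inner_sum_left inner_commute[of v] mult.commute)
  have sn: "smooth_on ?E n"
    unfolding n_def
    by (intro smooth_on_sum C(2) smooth_on_linear[OF bounded_linear_scaleR_left])
      (use sf c in \<open>simp add: smooth_form1_def\<close>)
  show thesis
  proof (rule that[OF sn])
    fix y u v assume y: "y \<in> ?E"
    have "ext_deriv1 A \<eta> c y u v = 0" using \<eta> c y unfolding closed_form1_def by blast
    then show "fderiv n y u \<bullet> v = fderiv n y v \<bullet> u"
      unfolding ext_deriv1_def
      using frechet_derivative_inner_right[OF sn C(2) y n] by simp
  next
    fix x v assume x: "x \<in> chart_dom c" and v: "v \<in> tangent_space A x"
    have "comp1 A \<eta> c (chart_map c x) (v c) = \<eta> x v"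
      unfolding comp1_def C(3)[OF x] tangent_vector_eq_coord_vect[OF c x v] ..
    then show "\<eta> x v = n (chart_map c x) \<bullet> v c" using n x by simp
  qed
qed

lemma form2_in_chart:
  fixes A :: "('m::topological_space, 'e::euclidean_space) chart set"
  assumes A: "maximal_smooth_atlas A" and c: "c \<in> A" and \<omega>: "closed_form2 A \<omega>"
  obtains J where "closed_two_form (chart_map c ` chart_dom c) J"
    "\<And>x v w. x \<in> chart_dom c \<Longrightarrow> v \<in> tangent_space A x \<Longrightarrow> w \<in> tangent_space A x \<Longrightarrow>
      \<omega> x v w = J (chart_map c x) (v c) \<bullet> w c"
proof -
  let ?E = "chart_map c ` chart_dom c"
  let ?w = "comp2 A \<omega> c"
  note C = is_chartD[OF maximal_smooth_atlasD(1)[OF A c]]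
  have sf: "smooth_form2 A \<omega>" using \<omega> by (simp add: closed_form2_def)
  have alt: "?w y u v = - ?w y v u" if y: "y \<in> ?E" for y u v
  proof -
    have x: "chart_inv c y \<in> chart_dom c" using y C(3) by auto
    show ?thesis
      using sf coord_vect_in_tangent_space[OF A c x] unfolding comp2_def smooth_form2_def by blast
  qed
  have lin2: "linear (?w y u)" if y: "y \<in> ?E" for y u
  proof -
    have x: "chart_inv c y \<in> chart_dom c" using y C(3) by auto
    have "linear_form_on (tangent_space A (chart_inv c y))
        (\<omega> (chart_inv c y) (coord_vect A c (chart_inv c y) u))"
      using sf coord_vect_in_tangent_space[OF A c x] by (simp add: smooth_form2_def)
    then show ?thesis
      unfolding comp2_def
      by (intro linearI)
        (use coord_vect_in_tangent_space[OF A c x] in \<open>simp_all add: linear_coord_vect[OF A c x] linear_form_on_def\<close>)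
  qed
  define j where "j y u = (\<Sum>i\<in>Basis. ?w y u i *\<^sub>R i)" for y u
  have j: "?w y u v = j y u \<bullet> v" if "y \<in> ?E" for y u v
    using linear_eq_sum_Basis[OF lin2[OF that], of u v]
    by (simp add: j_def inner_sum_left inner_commute[of v] mult.commute)
  have linj: "linear (j y)" if y: "y \<in> ?E" for y
  proof (rule linearI)
    show "j y (u + v) = j y u + j y v" for u v
    proof -
      have "?w y (u + v) i = ?w y u i + ?w y v i" for i
        using alt[OF y, of "u + v" i] alt[OF y, of u i] alt[OF y, of v i] linear_add[OF lin2[OF y], of i u v] by simp
      then show ?thesis by (simp add: j_def scaleR_add_left sum.distrib)
    qed
    show "j y (a *\<^sub>R u) = a *\<^sub>R j y u" for a u
    proof -
      have "?w y (a *\<^sub>R u) i = a * ?w y u i" for i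
        using alt[OF y, of "a *\<^sub>R u" i] alt[OF y, of u i] linear_cmul[OF lin2[OF y], of i a u] by simp
      then show ?thesis by (simp add: j_def scaleR_sum_right)
    qed
  qed
  define J where "J y = Blinfun (j y)" for y
  have J: "J y u \<bullet> v = ?w y u v" if "y \<in> ?E" for y u v
    using j[OF that] linj[OF that] by (simp add: J_def bounded_linear_Blinfun_apply linear_conv_bounded_linear)
  have sJ: "smooth_on ?E J"
    unfolding smooth_on_iff_param J_def
  proof (rule param_smooth_on_blinfun[OF C(2)])
    fix u :: 'e
    have "smooth_on ?E (\<lambda>y. j y u)"
      unfolding j_def
      by (intro smooth_on_sum C(2) smooth_on_linear[OF bounded_linear_scaleR_left])
        (use sf c in \<open>simp add: smooth_form2_def\<close>)
    then show "param_smooth_on {0} ?E (\<lambda>t y. j y u)" by (simp add: smooth_on_iff_param)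
  qed (rule linj)
  show thesis
  proof (rule that)
    show "closed_two_form ?E J"
      unfolding closed_two_form_def
    proof (intro conjI ballI allI)
      fix y assume y: "y \<in> ?E"
      show "J y u \<bullet> v = - (J y v \<bullet> u)" for u v unfolding J[OF y] by (rule alt[OF y])
      have D: "fderiv (\<lambda>z. ?w z u v) y h = fderiv J y h u \<bullet> v" for u v h
      proof -
        have su: "smooth_on ?E (\<lambda>z. J z u)" by (rule smooth_on_linear[OF blinfun.bounded_linear_left C(2) sJ])
        have "fderiv (\<lambda>z. ?w z u v) y h = fderiv (\<lambda>z. J z u) y h \<bullet> v"
          by (rule frechet_derivative_inner_right[OF su C(2) y]) (simp add: J)
        also have "fderiv (\<lambda>z. J z u) y h = fderiv J y h u"
          using frechet_derivative_at[OF blinfun_field_apply_has_derivative[OF sJ y], symmetric] by simp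
        finally show ?thesis .
      qed
      have "ext_deriv2 A \<omega> c y u v w = 0" for u v w using \<omega> c y unfolding closed_form2_def by blast
      then show "fderiv J y u v \<bullet> w - fderiv J y v u \<bullet> w
        + fderiv J y w u \<bullet> v = 0" for u v w
        unfolding ext_deriv2_def D .
    qed (rule sJ)
  next
    fix x v w assume x: "x \<in> chart_dom c" and v: "v \<in> tangent_space A x" and w: "w \<in> tangent_space A x"
    have "?w (chart_map c x) (v c) (w c) = \<omega> x v w"
      unfolding comp2_def C(3)[OF x] tangent_vector_eq_coord_vect[OF c x v] tangent_vector_eq_coord_vect[OF c x w] ..
    then show "\<omega> x v w = J (chart_map c x) (v c) \<bullet> w c" using J x by simp
  qed
qed

text \<open>In the chart the covector \<open>\<omega>(v, -)\<close> corresponds to the vector \<open>J (v c)\<close> under the injective linear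
  map \<open>L\<close> from the model space to covectors.\<close>

lemma form_rank_in_chart:
  fixes A :: "('m::topological_space, 'e::euclidean_space) chart set" and J :: "'e \<Rightarrow> 'e"
  assumes A: "maximal_smooth_atlas A" and c: "c \<in> A" and x: "x \<in> chart_dom c"
    and J: "\<And>v w. v \<in> tangent_space A x \<Longrightarrow> w \<in> tangent_space A x \<Longrightarrow> \<omega> x v w = J (v c) \<bullet> w c"
  shows "form_rank A \<omega> x = dim (range J)"
proof -
  let ?T = "tangent_space A x"
  define L where "L z = (\<lambda>w :: ('m, 'e) vect. if w \<in> ?T then z \<bullet> w c else 0)" for z
  have linL: "linear L"
    by (rule linearI) (auto simp: L_def fun_eq_iff scaleR_fun_def inner_add_left)
  have injL: "inj L"
  proof (rule linear_injective_0[OF linL, THEN iffD2], intro allI impI)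
    fix z assume "L z = 0"
    then have "L z (coord_vect A c x z) = 0" by (simp add: fun_eq_iff)
    then show "z = 0"
      using coord_vect_in_tangent_space[OF A c x] coord_vect_component[OF A c x] by (simp add: L_def)
  qed
  have fl: "flat A \<omega> x v = L (J (v c))" if "v \<in> ?T" for v
    using that J by (auto simp: flat_def L_def fun_eq_iff)
  have "flat A \<omega> x ` ?T = L ` range J"
  proof
    show "flat A \<omega> x ` ?T \<subseteq> L ` range J" using fl by auto
    show "L ` range J \<subseteq> flat A \<omega> x ` ?T"
    proof
      fix f assume "f \<in> L ` range J"
      then obtain u where "f = L (J u)" by blast
      then have "f = flat A \<omega> x (coord_vect A c x u)"
        using fl[OF coord_vect_in_tangent_space[OF A c x]] coord_vect_component[OF A c x] by simp
      then show "f \<in> flat A \<omega> x ` ?T" using coord_vect_in_tangent_space[OF A c x] by blast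
    qed
  qed
  moreover have "dim (L ` range J) = dim (range J)"
    by (rule dim_image_eq[OF linL inj_on_subset[OF injL subset_UNIV]])
  ultimately show ?thesis by (simp add: form_rank_def)
qed

theorem theorem2p21:
  fixes A :: "('m::{t2_space, second_countable_topology}, 'e::euclidean_space) chart set"
    and \<omega> :: "('m, 'e) form2" and \<eta> :: "('m, 'e) form1" and r :: nat and x :: 'm
  assumes "smooth_manifold A"
    and "precosymplectic A \<omega> \<eta>"
    and "\<forall>y. form_rank A \<omega> y = 2 * r"
    and "2 * r \<le> DIM('e) - 1"
  shows "\<exists>(U :: 'm set) (t :: 'm \<Rightarrow> real) (q :: nat \<Rightarrow> 'm \<Rightarrow> real)
            (p :: nat \<Rightarrow> 'm \<Rightarrow> real) (z :: nat \<Rightarrow> 'm \<Rightarrow> real).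
      x \<in> U \<and>
      local_coordinates A U
        ([t] @ map q [1..<r + 1] @ map p [1..<r + 1] @ map z [1..<(DIM('e) - 1 - 2 * r) + 1]) \<and>
      (\<forall>y\<in>U. \<forall>v \<in> tangent_space A y. \<eta> y v = differential A t y v) \<and>
      (\<forall>y\<in>U. \<forall>v \<in> tangent_space A y. \<forall>w \<in> tangent_space A y.
         \<omega> y v w = (\<Sum>i=1..r. wedge (differential A (q i) y) (differential A (p i) y) v w))"
proof -
  have A: "maximal_smooth_atlas A" using assms(1) by (simp add: smooth_manifold_def)
  have \<omega>: "closed_form2 A \<omega>" and \<eta>: "closed_form1 A \<eta>"
    and ker: "ker1 A \<eta> x \<inter> ker2 A \<omega> x \<subset> ker2 A \<omega> x"
    using assms(2) by (auto simp: precosymplectic_def)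
  obtain c where c: "c \<in> A" "x \<in> chart_dom c" using maximal_smooth_atlasD(2)[OF A] by blast
  let ?E = "chart_map c ` chart_dom c"
  have E: "open ?E" by (rule is_chartD(2)[OF maximal_smooth_atlasD(1)[OF A c(1)]])
  obtain n where n: "smooth_on ?E n"
    "\<And>y u v. y \<in> ?E \<Longrightarrow> fderiv n y u \<bullet> v = fderiv n y v \<bullet> u"
    "\<And>x v. x \<in> chart_dom c \<Longrightarrow> v \<in> tangent_space A x \<Longrightarrow> \<eta> x v = n (chart_map c x) \<bullet> v c"
    by (rule form1_in_chart[OF A c(1) \<eta>]) (rule that)
  obtain J where J: "closed_two_form ?E J"
    "\<And>x v w. x \<in> chart_dom c \<Longrightarrow> v \<in> tangent_space A x \<Longrightarrow> w \<in> tangent_space A x \<Longrightarrow>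
      \<omega> x v w = J (chart_map c x) (v c) \<bullet> w c"
    by (rule form2_in_chart[OF A c(1) \<omega>]) (rule that)
  have rank: "dim (range (J y)) = 2 * r" if y: "y \<in> ?E" for y
  proof -
    obtain y' where y': "y' \<in> chart_dom c" "y = chart_map c y'" using y by blast
    have "form_rank A \<omega> y' = dim (range (J y))"
      unfolding y'(2) by (rule form_rank_in_chart[OF A c(1) y'(1)]) (rule J(2)[OF y'(1)])
    then show ?thesis using assms(3) by simp
  qed
  \<comment> \<open>The strict inclusion of distributions provides a kernel vector of \<open>\<omega>\<close> on which \<open>\<eta>\<close> does not vanish.\<close>
  obtain k where k: "k \<in> ker2 A \<omega> x" "k \<notin> ker1 A \<eta> x" using ker by blast
  then have kT: "k \<in> tangent_space A x" by (simp add: ker2_def)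
  have Jk: "J (chart_map c x) (k c) = 0"
  proof -
    have "J (chart_map c x) (k c) \<bullet> u = 0" for u
      using J(2)[OF c(2) kT coord_vect_in_tangent_space[OF A c, of u]] k(1)
        coord_vect_in_tangent_space[OF A c, of u] coord_vect_component[OF A c, of u]
      by (simp add: ker2_def)
    then show ?thesis by (metis inner_eq_zero_iff)
  qed
  have nk: "n (chart_map c x) \<bullet> k c \<noteq> 0"
    using n(3)[OF c(2) kT] k(2) kT by (simp add: ker1_def)
  obtain bs :: "'e list" where bs: "distinct bs" "set bs = Basis"
    using finite_distinct_list[OF finite_Basis] by metis
  have x0: "chart_map c x \<in> ?E" using c by blast
  obtain N t and q p z :: "nat \<Rightarrow> 'e \<Rightarrow> real" and fl \<phi> G where N:
    "open N" "chart_map c x \<in> N" "N \<subseteq> ?E"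
    "fl = [t] @ map q [1..<r + 1] @ map p [1..<r + 1] @ map z [1..<(DIM('e) - 1 - 2 * r) + 1]"
    "length fl = DIM('e)" "\<And>f. f \<in> set fl \<Longrightarrow> smooth_on N f"
    "\<phi> = (\<lambda>y. \<Sum>i<DIM('e). (fl ! i) y *\<^sub>R (bs ! i))" "smooth_on N \<phi>"
    "open (\<phi> ` N)" "smooth_on (\<phi> ` N) G" "\<And>y. y \<in> N \<Longrightarrow> G (\<phi> y) = y"
    "\<And>y v. y \<in> N \<Longrightarrow> fderiv t y v = n y \<bullet> v"
    "\<And>y u v. y \<in> N \<Longrightarrow> J y u \<bullet> v = darboux_form r q p y u v"
    by (rule precosymplectic_local_coordinates[OF E x0 J(1) rank n(1,2) Jk nk bs])
      (assumption, assumption, rule that)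
  define U where "U = {y \<in> chart_dom c. chart_map c y \<in> N}"
  let ?pull = "\<lambda>f y. f (chart_map c y)"
  have diff: "differential A (?pull f) y v = fderiv f (chart_map c y) (v c)"
    if "f \<in> set fl" "y \<in> U" "v \<in> tangent_space A y" for f y v
    using that by (intro differential_in_chart[OF A c(1)] smooth_on_has_derivative[OF N(6)]) (auto simp: U_def)
  have mem: "t \<in> set fl" "i \<in> {1..r} \<Longrightarrow> q i \<in> set fl" "i \<in> {1..r} \<Longrightarrow> p i \<in> set fl" for i
    unfolding N(4) by (auto simp del: upt_Suc)
  show ?thesis
  proof (intro exI conjI ballI)
    show "x \<in> U" using c N(2) by (simp add: U_def)
    let ?fs = "[?pull t] @ map (\<lambda>i. ?pull (q i)) [1..<r + 1] @ map (\<lambda>i. ?pull (p i)) [1..<r + 1]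
      @ map (\<lambda>i. ?pull (z i)) [1..<(DIM('e) - 1 - 2 * r) + 1]"
    have fs: "?fs = map ?pull fl" unfolding N(4) by (simp del: upt_Suc)
    show "local_coordinates A U ?fs"
      unfolding local_coordinates_def
    proof (intro conjI exI[of _ bs])
      show "length ?fs = DIM('e)" unfolding fs using N(5) by simp
      have "(\<lambda>x. \<Sum>i<DIM('e). (?fs ! i) x *\<^sub>R (bs ! i)) = (\<lambda>y. \<phi> (chart_map c y))"
        unfolding fs N(7) using N(5) by simp
      then show "(U, \<lambda>x. \<Sum>i<DIM('e). (?fs ! i) x *\<^sub>R (bs ! i)) \<in> A"
        using chart_from_local_diffeomorphism(1)[OF A c(1) N(1,3,8,9,10,11)] by (simp add: U_def)
    qed (use bs in auto)
  next
    fix y v assume y: "y \<in> U" and v: "v \<in> tangent_space A y"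
    then have yc: "y \<in> chart_dom c" "chart_map c y \<in> N" by (auto simp: U_def)
    show "\<eta> y v = differential A (?pull t) y v"
      unfolding diff[OF mem(1) y v] N(12)[OF yc(2)] by (rule n(3)[OF yc(1) v])
    fix w assume w: "w \<in> tangent_space A y"
    show "\<omega> y v w = (\<Sum>i=1..r. wedge (differential A (?pull (q i)) y) (differential A (?pull (p i)) y) v w)"
      unfolding J(2)[OF yc(1) v w] N(13)[OF yc(2)] wedge_def
      by (rule sum.cong) (simp_all only: diff[OF mem(2) y v] diff[OF mem(2) y w] diff[OF mem(3) y v] diff[OF mem(3) y w])
  qed
qed

end
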